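(* Let $n\geq1$. The subgroup $\mathrm{Inn}(F_n)\,IA_n^+$ of $IA_n$ satisfies the Andreadakis equality.
   Context: $F_n$ is the free group with a fixed ordered basis $(x_1,\dots,x_n)$; $IA_n$ is the group of automorphisms of $F_n$ acting trivially on $F_n^{ab}$; $\mathrm{Inn}(F_n)$ is the group of inner automorphisms. Write $x^w=w^{-1}xw$, and let $F_{i-1}$ denote the subgroup $\langle x_j\rangle_{j<i}$ of $F_n$. The subgroup $IA_n^+$ of $IA_n$ consists of the triangular automorphisms, i.e. the automorphisms $\varphi$ acting as $\varphi:x_i\mapsto(x_i^{w_i})\gamma_i$ for all $i$, where $w_i\in F_{i-1}$ and $\gamma_i\in\Gamma_2(F_{i-1})$. $\mathrm{Inn}(F_n)IA_n^+$ is the product of these two subgroups ($\mathrm{Inn}(F_n)$ being normal). The lower central series of a group $K$ is $\Gamma_1(K)=K$, $\Gamma_{j+1}(K)=[K,\Gamma_j(K)]$. The Andreadakis filtration on $IA_n$ is $\mathcal{A}_j=\{\varphi\in\mathrm{Aut}(F_n) : \forall i\geq1,\ \forall g\in\Gamma_i(F_n),\ \varphi(g)g^{-1}\in\Gamma_{i+j}(F_n)\}$. A subgroup $K\subseteq IA_n$ satisfies the Andreadakis equality if the inclusions $\Gamma_j(K)\subseteq K\cap\Gamma_j(IA_n)\subseteq K\cap\mathcal{A}_j$ are equalities for all $j\geq1$. *)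

theory Defs
  imports "HOL-Algebra.Algebra"
begin

section \<open>The free group on an ordered basis\<close>

text \<open>
  The letter \<open>(i, True)\<close> stands for the basis element \<open>x\<^sub>i\<close>, the letter \<open>(i, False)\<close> for its
  inverse. Elements of the free group are the reduced words; the basis is indexed from 1, as in
  \<open>x\<^sub>1, \<dots>, x\<^sub>n\<close>.
\<close>

type_synonym letter = "nat \<times> bool"

definition inv_letter :: "letter \<Rightarrow> letter" where
  "inv_letter a = (fst a, \<not> snd a)"

definition reduced :: "letter list \<Rightarrow> bool" where
  "reduced w \<longleftrightarrow> successively (\<lambda>a b. b \<noteq> inv_letter a) w"

fun push_letter :: "letter \<Rightarrow> letter list \<Rightarrow> letter list" where
  "push_letter a [] = [a]"
| "push_letter a (b # w) = (if b = inv_letter a then w else a # b # w)"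

text \<open>The product of two reduced words is the reduced form of their concatenation.\<close>

definition free_group :: "nat \<Rightarrow> letter list monoid" where
  "free_group n =
     \<lparr>carrier = {w. reduced w \<and> fst ` set w \<subseteq> {1..n}},
      monoid.mult = (\<lambda>u v. foldr push_letter u v),
      one = []\<rparr>"

definition gen :: "nat \<Rightarrow> letter list" where
  "gen i = [(i, True)]"

subsection \<open>Group axioms and universal property\<close>

lemma inv_letter_inv_letter [simp]: "inv_letter (inv_letter a) = a"
  by (simp add: inv_letter_def)

lemma inv_letter_neq [simp]: "inv_letter a \<noteq> a" "a \<noteq> inv_letter a"
  by (auto simp: inv_letter_def prod_eq_iff)

lemma fst_inv_letter [simp]: "fst (inv_letter a) = fst a"
  by (simp add: inv_letter_def)

lemma reduced_Nil [simp]: "reduced []"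
  by (simp add: reduced_def)

lemma reduced_Cons: "reduced (a # w) \<longleftrightarrow> reduced w \<and> (w = [] \<or> hd w \<noteq> inv_letter a)"
  by (cases w) (auto simp: reduced_def)

lemma reduced_push: "reduced w \<Longrightarrow> reduced (push_letter a w)"
  by (cases w) (auto simp: reduced_Cons)

lemma reduced_foldr: "reduced w \<Longrightarrow> reduced (foldr push_letter u w)"
  by (induction u) (auto simp: reduced_push)

lemma push_inv: "reduced w \<Longrightarrow> push_letter a (push_letter (inv_letter a) w) = w"
  by (cases w; cases "tl w") (auto simp: reduced_Cons)

lemma push_reduced_Cons: "reduced (a # w) \<Longrightarrow> push_letter a w = a # w"
  by (cases w) (auto simp: reduced_Cons)

lemma foldr_push_Nil: "reduced w \<Longrightarrow> foldr push_letter w [] = w"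
  by (induction w) (auto simp: push_reduced_Cons reduced_Cons[of _ w for w])

lemma foldr_push_push:
  assumes "reduced w"
  shows "foldr push_letter (push_letter a v) w = push_letter a (foldr push_letter v w)"
proof (cases v)
  case (Cons b u)
  then show ?thesis
    using push_inv[OF reduced_foldr[OF assms], of a] by auto
qed auto

lemma foldr_push_assoc:
  assumes "reduced w"
  shows "foldr push_letter (foldr push_letter u v) w = foldr push_letter u (foldr push_letter v w)"
  by (induction u) (simp_all add: foldr_push_push[OF assms])

lemma set_push: "set (push_letter a w) \<subseteq> insert a (set w)"
  by (cases w) auto

lemma set_foldr_push: "set (foldr push_letter u w) \<subseteq> set u \<union> set w"
  using set_push by (induction u) fastforce+

lemma foldr_push_inverse: "foldr push_letter (rev (map inv_letter w)) w = []"
proof (induction w)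
  case (Cons a w)
  have "push_letter (inv_letter a) (a # w) = w"
    by simp
  then show ?case
    using Cons by simp
qed auto

lemma reduced_inverse: "reduced w \<Longrightarrow> reduced (rev (map inv_letter w))"
proof -
  assume "reduced w"
  then have "successively (\<lambda>a b. inv_letter a \<noteq> b) w"
    unfolding reduced_def by (rule successively_mono) auto
  then show ?thesis
    unfolding reduced_def successively_rev successively_map
    by (rule successively_mono) auto
qed

lemma group_free_group: "group (free_group n)"
proof (rule groupI)
  fix u v w
  assume "u \<in> carrier (free_group n)" "v \<in> carrier (free_group n)" "w \<in> carrier (free_group n)"
  then show "u \<otimes>\<^bsub>free_group n\<^esub> v \<otimes>\<^bsub>free_group n\<^esub> w = u \<otimes>\<^bsub>free_group n\<^esub> (v \<otimes>\<^bsub>free_group n\<^esub> w)"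
    by (simp add: free_group_def foldr_push_assoc)
next
  fix u v
  assume "u \<in> carrier (free_group n)" "v \<in> carrier (free_group n)"
  then show "u \<otimes>\<^bsub>free_group n\<^esub> v \<in> carrier (free_group n)"
    using image_mono[OF set_foldr_push[of u v], of fst]
    by (simp add: free_group_def reduced_foldr image_Un) blast
next
  fix w
  assume w: "w \<in> carrier (free_group n)"
  let ?v = "rev (map inv_letter w)"
  have "?v \<in> carrier (free_group n)"
    using w reduced_inverse[of w] by (auto simp: free_group_def)
  moreover have "?v \<otimes>\<^bsub>free_group n\<^esub> w = \<one>\<^bsub>free_group n\<^esub>"
    by (simp add: free_group_def foldr_push_inverse)
  ultimately show "\<exists>v\<in>carrier (free_group n). v \<otimes>\<^bsub>free_group n\<^esub> w = \<one>\<^bsub>free_group n\<^esub>"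
    by blast
qed (auto simp: free_group_def)

lemma gen_closed: "i \<in> {1..n} \<Longrightarrow> gen i \<in> carrier (free_group n)"
  by (simp add: gen_def free_group_def reduced_Cons)

lemma inv_gen: "i \<in> {1..n} \<Longrightarrow> inv\<^bsub>free_group n\<^esub> (gen i) = [(i, False)]"
  by (rule group.inv_equality[OF group_free_group])
     (auto simp: gen_def free_group_def reduced_Cons inv_letter_def)

lemma generate_gen: "generate (free_group n) (gen ` {1..n}) = carrier (free_group n)"
proof
  interpret group "free_group n" by (rule group_free_group)
  show "generate (free_group n) (gen ` {1..n}) \<subseteq> carrier (free_group n)"
    by (rule generate_incl) (use gen_closed in blast)
  show "carrier (free_group n) \<subseteq> generate (free_group n) (gen ` {1..n})"
  proof
    fix w assume "w \<in> carrier (free_group n)"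
    then show "w \<in> generate (free_group n) (gen ` {1..n})"
    proof (induction w)
      case Nil
      then show ?case
        using generate.one[of "free_group n"] by (simp add: free_group_def)
    next
      case (Cons a w)
      obtain i e where a: "a = (i, e)" by fastforce
      have i: "i \<in> {1..n}" and w: "w \<in> carrier (free_group n)"
        using Cons.prems by (auto simp: a free_group_def reduced_Cons)
      have "[a] \<in> generate (free_group n) (gen ` {1..n})"
        using generate.incl[of "gen i" "gen ` {1..n}" "free_group n"]
          generate.inv[of "gen i" "gen ` {1..n}" "free_group n"] i inv_gen[OF i]
        by (cases e) (auto simp: a gen_def)
      moreover have "[a] \<otimes>\<^bsub>free_group n\<^esub> w = a # w"
        using Cons.prems push_reduced_Cons by (simp add: free_group_def)
      ultimately show ?case
        using generate.eng[of "[a]" "free_group n" "gen ` {1..n}" w] Cons.IH[OF w] by simp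
    qed
  qed
qed

lemma free_group_extension:
  assumes "group G" and f: "f \<in> {1..n} \<rightarrow> carrier G"
  shows "\<exists>h \<in> hom (free_group n) G. \<forall>i\<in>{1..n}. h (gen i) = f i"
proof -
  interpret group G by fact
  define l where "l = (\<lambda>(i, e). if e then f i else inv\<^bsub>G\<^esub> (f i))"
  define h where "h w = foldr (\<lambda>a g. l a \<otimes>\<^bsub>G\<^esub> g) w \<one>\<^bsub>G\<^esub>" for w
  have l: "l a \<in> carrier G" "l (inv_letter a) = inv\<^bsub>G\<^esub> (l a)" if "fst a \<in> {1..n}" for a
  proof -
    have "f (fst a) \<in> carrier G"
      using that f by (rule Pi_mem[rotated])
    then show "l a \<in> carrier G" "l (inv_letter a) = inv\<^bsub>G\<^esub> (l a)"
      by (simp_all add: l_def inv_letter_def case_prod_beta)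
  qed
  have h: "h w \<in> carrier G" if "fst ` set w \<subseteq> {1..n}" for w
    using that by (induction w) (auto simp: h_def l)
  have push: "h (push_letter a w) = l a \<otimes>\<^bsub>G\<^esub> h w" if "fst a \<in> {1..n}" "fst ` set w \<subseteq> {1..n}" for a w
  proof (cases w)
    case (Cons b v)
    then have "h v \<in> carrier G"
      using h that by simp
    then have "l a \<otimes>\<^bsub>G\<^esub> (inv\<^bsub>G\<^esub> (l a) \<otimes>\<^bsub>G\<^esub> h v) = h v"
      using l(1)[OF that(1)] by (simp add: m_assoc[symmetric])
    then show ?thesis
      using Cons l that by (auto simp: h_def)
  qed (simp add: h_def)
  have "h (foldr push_letter u w) = h u \<otimes>\<^bsub>G\<^esub> h w"
    if "fst ` set u \<subseteq> {1..n}" "fst ` set w \<subseteq> {1..n}" for u w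
    using that(1)
  proof (induction u)
    case Nil
    then show ?case
      using h[OF that(2)] by (simp add: h_def)
  next
    case (Cons a u)
    have "fst ` set (foldr push_letter u w) \<subseteq> {1..n}"
      using image_mono[OF set_foldr_push[of u w], of fst] Cons.prems that(2)
      by (simp add: image_Un) blast
    moreover have "h (a # u) = l a \<otimes>\<^bsub>G\<^esub> h u"
      by (simp add: h_def)
    ultimately show ?case
      using Cons push h[of u] h[OF that(2)] l(1)[of a] by (auto simp: m_assoc)
  qed
  then have "h \<in> hom (free_group n) G"
    using h by (auto simp: hom_def free_group_def)
  moreover have "h (gen i) = f i" if "i \<in> {1..n}" for i
    using f that by (auto simp: h_def l_def gen_def Pi_iff)
  ultimately show ?thesis
    by blast
qed


section \<open>Lower central series\<close>

definition commutator_subgroup :: "('a, 'b) monoid_scheme \<Rightarrow> 'a set \<Rightarrow> 'a set \<Rightarrow> 'a set" where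
  "commutator_subgroup G H K =
     generate G {h \<otimes>\<^bsub>G\<^esub> k \<otimes>\<^bsub>G\<^esub> inv\<^bsub>G\<^esub> h \<otimes>\<^bsub>G\<^esub> inv\<^bsub>G\<^esub> k | h k. h \<in> H \<and> k \<in> K}"

text \<open>
  \<open>lower_central G K j\<close> is \<open>\<Gamma>\<^sub>j(K)\<close> for a subgroup \<open>K\<close> of \<open>G\<close>. The series starts at index 1;
  the value at index 0 is a convention and is never used.
\<close>

primrec lower_central :: "('a, 'b) monoid_scheme \<Rightarrow> 'a set \<Rightarrow> nat \<Rightarrow> 'a set" where
  "lower_central G K 0 = K"
| "lower_central G K (Suc j) =
     (if j = 0 then K else commutator_subgroup G K (lower_central G K j))"


section \<open>Automorphisms of the free group\<close>

text \<open>
  \<^const>\<open>AutoGroup\<close> multiplies by composition, \<open>(\<phi>\<psi>)(g) = \<phi>(\<psi>(g))\<close>; its elements are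
  extensional functions on the carrier.
\<close>

abbreviation Aut_free :: "nat \<Rightarrow> (letter list \<Rightarrow> letter list) monoid" where
  "Aut_free n \<equiv> AutoGroup (free_group n)"

text \<open>The map induced by \<open>\<phi>\<close> on the abelianization sends a coset to its image under \<open>\<phi>\<close>.\<close>

definition IA :: "nat \<Rightarrow> (letter list \<Rightarrow> letter list) set" where
  "IA n = {\<phi> \<in> carrier (Aut_free n).
     \<forall>C \<in> carrier (free_group n Mod derived (free_group n) (carrier (free_group n))). \<phi> ` C = C}"

definition conj_by :: "('a, 'b) monoid_scheme \<Rightarrow> 'a \<Rightarrow> 'a \<Rightarrow> 'a" where
  "conj_by G x w = inv\<^bsub>G\<^esub> w \<otimes>\<^bsub>G\<^esub> x \<otimes>\<^bsub>G\<^esub> w"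

definition Inn :: "('a, 'b) monoid_scheme \<Rightarrow> ('a \<Rightarrow> 'a) set" where
  "Inn G = {\<lambda>x \<in> carrier G. conj_by G x w | w. w \<in> carrier G}"

definition gens_below :: "nat \<Rightarrow> nat \<Rightarrow> letter list set" where
  "gens_below n i = generate (free_group n) (gen ` {1..<i})"

definition IA_plus :: "nat \<Rightarrow> (letter list \<Rightarrow> letter list) set" where
  "IA_plus n = {\<phi> \<in> carrier (Aut_free n).
     \<forall>i \<in> {1..n}. \<exists>w \<in> gens_below n i. \<exists>\<gamma> \<in> lower_central (free_group n) (gens_below n i) 2.
       \<phi> (gen i) = conj_by (free_group n) (gen i) w \<otimes>\<^bsub>free_group n\<^esub> \<gamma>}"

definition andreadakis_filtration :: "nat \<Rightarrow> nat \<Rightarrow> (letter list \<Rightarrow> letter list) set" where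
  "andreadakis_filtration n j = {\<phi> \<in> carrier (Aut_free n).
     \<forall>i \<ge> 1. \<forall>g \<in> lower_central (free_group n) (carrier (free_group n)) i.
       \<phi> g \<otimes>\<^bsub>free_group n\<^esub> inv\<^bsub>free_group n\<^esub> g
         \<in> lower_central (free_group n) (carrier (free_group n)) (i + j)}"

definition satisfies_andreadakis_equality :: "nat \<Rightarrow> (letter list \<Rightarrow> letter list) set \<Rightarrow> bool" where
  "satisfies_andreadakis_equality n K \<longleftrightarrow>
     subgroup K (Aut_free n) \<and> K \<subseteq> IA n \<and>
     (\<forall>j \<ge> 1.
        lower_central (Aut_free n) K j = K \<inter> lower_central (Aut_free n) (IA n) j \<and>
        K \<inter> lower_central (Aut_free n) (IA n) j = K \<inter> andreadakis_filtration n j)"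

end

theory Submission
  imports Defs "HOL-Library.List_Lexorder"
begin

text \<open>
  Everything rests on one fact: if \<open>[w, x\<^sub>i] \<in> \<Gamma>\<^sub>j\<^sub>+\<^sub>1(F)\<close>, then \<open>w\<close> lies in
  \<open>\<langle>x\<^sub>i\<rangle> \<Gamma>\<^sub>j(F)\<close>. It follows from Magnus's theorem that an element of \<open>\<Gamma>\<^sub>k(F)\<close> whose Magnus
  expansion has no terms of degree \<open>k\<close> lies in \<open>\<Gamma>\<^sub>k\<^sub>+\<^sub>1(F)\<close>: a noncommutative polynomial commuting with
  the variable \<open>X\<^sub>i\<close> and homogeneous of degree \<open>k\<close> is a multiple of \<open>X\<^sub>i\<^sup>k\<close>. Magnus's theorem holds because the
  bracketings of the Lyndon words of length \<open>k\<close> generate \<open>\<Gamma>\<^sub>k\<close> modulo \<open>\<Gamma>\<^sub>k\<^sub>+\<^sub>1\<close>, and the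
  leading part of each is its Lyndon word plus lexicographically larger ones.

  Given \<open>\<phi> = c\<^sub>w \<psi>\<close> in \<open>\<A>\<^sub>j\<close> with \<open>\<psi>\<close> triangular, evaluation at \<open>x\<^sub>1\<close>, which \<open>\<psi>\<close> fixes, shows
  \<open>w \<in> \<langle>x\<^sub>1\<rangle> \<Gamma>\<^sub>j(F)\<close>. Conjugation by \<open>x\<^sub>1\<close> is triangular, so one may assume \<open>w \<in> \<Gamma>\<^sub>j(F)\<close>, and then
  \<open>\<psi> \<in> \<A>\<^sub>j\<close> is a product of automorphisms \<open>x\<^sub>m \<mapsto> x\<^sub>m\<^sup>v \<gamma>\<close> moving a single generator. The same
  fact gives \<open>v \<in> \<Gamma>\<^sub>j(F\<^sub>m\<^sub>-\<^sub>1)\<close> and \<open>\<gamma> \<in> \<Gamma>\<^sub>j\<^sub>+\<^sub>1(F\<^sub>m\<^sub>-\<^sub>1)\<close>, and such an automorphism is a product of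
  \<open>j\<close>-fold commutators.
\<close>


section \<open>Commutators and lower central series\<close>

text \<open>The chain of inclusions holds for any subgroup of \<open>IA n\<close>, so the content is
  that K \<inter> A_j lies in \<Gamma>_j(K). The obstacle is that A_j measures depth in the lower
  central series of F, while commutators in K are built from depth in the smaller groups F_{m-1}.
  The retraction of F onto F_{m-1} closes this gap: it maps \<Gamma>_j(F) into \<Gamma>_j(F_{m-1})
  and fixes F_{m-1}. It also removes the unknown power of x_m that the centralizer statement leaves
  open. For the inner factor no retraction helps, which is why the power of x_1 is moved into the
  triangular factor instead. Lyndon words enter because the easy half of Magnus's theorem only
  bounds the order of an expansion from below. Concluding membership in \<Gamma>_{k+1} from
  vanishing coefficients needs a spanning set that is unitriangular over the integers. No graded Lie
  ring is formed: its identities are congruences in the quotients F/\<Gamma>_N, and its spans are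
  subgroups between \<Gamma>_{k+1} and \<Gamma>_k.\<close>

definition commutator :: "('a, 'b) monoid_scheme \<Rightarrow> 'a \<Rightarrow> 'a \<Rightarrow> 'a" where
  "commutator G x y = x \<otimes>\<^bsub>G\<^esub> y \<otimes>\<^bsub>G\<^esub> inv\<^bsub>G\<^esub> x \<otimes>\<^bsub>G\<^esub> inv\<^bsub>G\<^esub> y"

lemma commutator_subgroup_eq:
  "commutator_subgroup G H K = generate G {commutator G h k | h k. h \<in> H \<and> k \<in> K}"
  by (simp add: commutator_subgroup_def commutator_def)

lemma lower_central_1 [simp]: "lower_central G K (Suc 0) = K"
  by simp

lemma lower_central_Suc:
  "1 \<le> j \<Longrightarrow> lower_central G K (Suc j) = commutator_subgroup G K (lower_central G K j)"
  by simp

declare lower_central.simps(2) [simp del]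

context group
begin

lemma cancel_inv:
  "x \<in> carrier G \<Longrightarrow> y \<in> carrier G \<Longrightarrow> x \<otimes> (inv x \<otimes> y) = y"
  "x \<in> carrier G \<Longrightarrow> y \<in> carrier G \<Longrightarrow> inv x \<otimes> (x \<otimes> y) = y"
  by (simp_all add: m_assoc [symmetric])

text \<open>After right-association the pair x, inv x is followed by a tail, so the plain inverse
  laws no longer match; \<open>cancel_inv\<close> supplies the version with a tail. Together with
  the simp rules of the group these normalize words, which settles identities valid in all
  groups.\<close>

lemmas word_simps = m_assoc inv_mult_group cancel_inv

lemma commutator_closed [intro, simp]:
  "x \<in> carrier G \<Longrightarrow> y \<in> carrier G \<Longrightarrow> commutator G x y \<in> carrier G"
  by (simp add: commutator_def)

lemma inv_commutator:
  "x \<in> carrier G \<Longrightarrow> y \<in> carrier G \<Longrightarrow> inv (commutator G x y) = commutator G y x"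
  by (simp add: commutator_def word_simps)

lemma commutator_swap:
  assumes "subgroup H G" "x \<in> carrier G" "y \<in> carrier G" "commutator G x y \<in> H"
  shows "commutator G y x \<in> H"
  using subgroup.m_inv_closed[OF assms(1,4)] assms(2,3) by (simp add: inv_commutator)

lemma commutator_eq_one_iff:
  assumes "x \<in> carrier G" "y \<in> carrier G"
  shows "commutator G x y = \<one> \<longleftrightarrow> x \<otimes> y = y \<otimes> x"
proof -
  have "commutator G x y = (x \<otimes> y) \<otimes> inv (y \<otimes> x)"
    using assms by (simp add: commutator_def word_simps)
  then show ?thesis
    using assms by (metis inv_closed inv_equality inv_inv m_closed r_inv)
qed

lemma commutator_mult: "x \<in> carrier G \<Longrightarrow> y \<in> carrier G \<Longrightarrow> commutator G x y \<otimes> (y \<otimes> x) = x \<otimes> y"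
  by (simp add: commutator_def word_simps)

lemma commutator_mult_left:
  assumes "x \<in> carrier G" "x' \<in> carrier G" "y \<in> carrier G"
  shows "commutator G (x \<otimes> x') y = x \<otimes> commutator G x' y \<otimes> inv x \<otimes> commutator G x y"
  using assms by (simp add: commutator_def word_simps)

lemma commutator_inv_left:
  assumes "x \<in> carrier G" "y \<in> carrier G"
  shows "commutator G (inv x) y = inv x \<otimes> commutator G y x \<otimes> x"
  using assms by (simp add: commutator_def word_simps)

lemma commutator_mem_normal:
  assumes "H \<lhd> G" "x \<in> H" "y \<in> carrier G"
  shows "commutator G x y \<in> H" "commutator G y x \<in> H"
proof -
  interpret N: normal H G by fact
  have x: "x \<in> carrier G" using assms by auto
  have "y \<otimes> x \<otimes> inv y \<in> H" "y \<otimes> inv x \<otimes> inv y \<in> H"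
    using assms N.inv_op_closed2 by auto
  then have "x \<otimes> (y \<otimes> inv x \<otimes> inv y) \<in> H" "(y \<otimes> x \<otimes> inv y) \<otimes> inv x \<in> H"
    using assms by auto
  then show "commutator G x y \<in> H" "commutator G y x \<in> H"
    using x assms(3) by (simp_all add: commutator_def m_assoc)
qed

text \<open>Modulo the normal subgroup \<open>H\<close> the generators in \<open>A\<close> commute
  with those in \<open>B\<close>, hence so do the subgroups they generate. The proof extends the
  left slot first and reaches the right slot through the inverse of the commutator.\<close>

lemma commutator_generate:
  assumes H: "H \<lhd> G" and A: "A \<subseteq> carrier G" and B: "B \<subseteq> carrier G"
    and AB: "\<And>a b. a \<in> A \<Longrightarrow> b \<in> B \<Longrightarrow> commutator G a b \<in> H"
    and g: "g \<in> generate G A" and h: "h \<in> generate G B"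
  shows "commutator G g h \<in> H"
proof -
  interpret N: normal H G by fact
  have left: "commutator G g y \<in> H"
    if "g \<in> generate G C" "C \<subseteq> carrier G" "y \<in> carrier G" "\<And>c. c \<in> C \<Longrightarrow> commutator G c y \<in> H"
    for g y C
    using that
  proof (induction g rule: generate.induct)
    case one
    then show ?case by (simp add: commutator_def)
  next
    case (incl c)
    then show ?case by simp
  next
    case (inv c)
    then have c: "c \<in> carrier G" by auto
    have "commutator G y c \<in> H"
      using commutator_swap[OF N.subgroup_axioms c inv.prems(2)] inv by simp
    then show ?case
      using N.inv_op_closed1[OF c] c inv by (simp add: commutator_inv_left)
  next
    case (eng a b)
    have ab: "a \<in> carrier G" "b \<in> carrier G"
      using eng generate_in_carrier by auto
    show ?case
      unfolding commutator_mult_left[OF ab eng.prems(2)]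
      by (rule N.m_closed) (use eng ab N.inv_op_closed2 in auto)
  qed
  have h': "h \<in> carrier G" and g': "g \<in> carrier G"
    using h g A B generate_in_carrier by auto
  have "commutator G a h \<in> H" if a: "a \<in> A" for a
  proof (rule commutator_swap[OF N.subgroup_axioms h'])
    show "commutator G h a \<in> H"
      using a A B AB by (intro left[OF h B] commutator_swap[OF N.subgroup_axioms, of a]) auto
  qed (use a A in auto)
  then show ?thesis
    using left[OF g A h'] by auto
qed

section \<open>Functoriality and normality of the lower central series\<close>

lemma lower_central_subgroup:
  assumes "subgroup K G"
  shows "subgroup (lower_central G K j) G \<and> lower_central G K j \<subseteq> K"
proof (induction j)
  case (Suc j)
  interpret K: subgroup K G by fact
  show ?case
  proof (cases "j = 0")
    case False
    have "commutator G h k \<in> K" if "h \<in> K" "k \<in> lower_central G K j" for h k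
      using that Suc by (auto simp: commutator_def)
    then have "{commutator G h k |h k. h \<in> K \<and> k \<in> lower_central G K j} \<subseteq> K" by auto
    then show ?thesis
      using generate_is_subgroup[of "{commutator G h k |h k. h \<in> K \<and> k \<in> lower_central G K j}"]
        generate_subgroup_incl[OF _ assms] K.subset False
      by (auto simp: lower_central_Suc commutator_subgroup_eq)
  qed (use assms in simp)
qed (use assms in simp)

lemma lower_central_commutator:
  assumes "1 \<le> j" "h \<in> K" "k \<in> lower_central G K j"
  shows "commutator G h k \<in> lower_central G K (Suc j)"
  using assms by (auto simp: lower_central_Suc commutator_subgroup_eq intro!: generate.incl)

lemma lower_central_mono:
  assumes "subgroup K G" "subgroup L G" "K \<subseteq> L"
  shows "lower_central G K j \<subseteq> lower_central G L j"
proof (induction j)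
  case (Suc j)
  show ?case
  proof (cases "j = 0")
    case False
    have "{commutator G h k |h k. h \<in> K \<and> k \<in> lower_central G K j}
        \<subseteq> {commutator G h k |h k. h \<in> L \<and> k \<in> lower_central G L j}"
      by (intro Collect_mono) (use Suc assms(3) in auto)
    from mono_generate[OF this] show ?thesis
      using False by (simp add: lower_central_Suc commutator_subgroup_eq)
  qed (use assms in simp)
qed (use assms in simp)

text \<open>A homomorphism carries commutators to commutators. The subgroups on both sides are kept
  general because the lemma is applied to conjugations, automorphisms, retractions onto subgroups,
  and maps from the free group into its automorphism group.\<close>

lemma lower_central_hom:
  assumes "group H" and f: "f \<in> hom G H" and A: "subgroup A G" and B: "subgroup B H" and AB: "f ` A \<subseteq> B"
    and x: "x \<in> lower_central G A j"
  shows "f x \<in> lower_central H B j"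
  using x
proof (induction j arbitrary: x)
  case 0
  then show ?case using AB by auto
next
  case (Suc j)
  interpret H: group H by fact
  interpret f: group_hom G H f
    using f by unfold_locales
  show ?case
  proof (cases "j = 0")
    case True
    then show ?thesis using Suc AB by auto
  next
    case False
    let ?C = "{commutator G h k |h k. h \<in> A \<and> k \<in> lower_central G A j}"
    have C: "?C \<subseteq> carrier G"
      using lower_central_subgroup[OF A, of j] subgroup.subset[OF A] by auto
    have hom: "f (commutator G h k) = commutator H (f h) (f k)" if "h \<in> carrier G" "k \<in> carrier G" for h k
      using that by (simp add: commutator_def)
    have "f ` ?C \<subseteq> {commutator H h k |h k. h \<in> B \<and> k \<in> lower_central H B j}"
    proof (rule image_subsetI)
      fix c assume "c \<in> ?C"
      then obtain h k where c: "c = commutator G h k" "h \<in> A" "k \<in> lower_central G A j"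
        by auto
      then have "h \<in> carrier G" "k \<in> carrier G"
        using lower_central_subgroup[OF A, of j] subgroup.subset[OF A] by auto
      then have "f c = commutator H (f h) (f k)"
        by (simp add: c hom)
      moreover have "f h \<in> B" "f k \<in> lower_central H B j"
        using Suc.IH[OF c(3)] AB c(2) by auto
      ultimately show "f c \<in> {commutator H h k |h k. h \<in> B \<and> k \<in> lower_central H B j}"
        by blast
    qed
    note H.mono_generate[OF this]
    moreover have "f x \<in> generate H (f ` ?C)"
      using Suc.prems f.generate_img[OF C] False by (auto simp: lower_central_Suc commutator_subgroup_eq)
    ultimately have "f x \<in> generate H {commutator H h k |h k. h \<in> B \<and> k \<in> lower_central H B j}"
      by (rule subsetD)
    then show ?thesis
      using False by (simp add: lower_central_Suc commutator_subgroup_eq)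
  qed
qed

lemma conj_hom: "x \<in> carrier G \<Longrightarrow> (\<lambda>y. x \<otimes> y \<otimes> inv x) \<in> hom G G"
  by (auto simp: hom_def word_simps)

text \<open>Conjugation by an element of \<open>K\<close> is an endomorphism of \<open>G\<close>
  that maps \<open>K\<close> into itself.\<close>

lemma lower_central_normalized:
  assumes K: "subgroup K G" and "x \<in> K" "y \<in> lower_central G K j"
  shows "x \<otimes> y \<otimes> inv x \<in> lower_central G K j"
  by (rule lower_central_hom[OF _ conj_hom K K]) (use assms subgroupE[OF K] in auto)

abbreviation \<Gamma> :: "nat \<Rightarrow> 'a set" where
  "\<Gamma> j \<equiv> lower_central G (carrier G) j"

lemma \<Gamma>_subgroup: "subgroup (\<Gamma> j) G"
  using lower_central_subgroup[OF subgroup_self] by blast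

lemma \<Gamma>_carrier: "x \<in> \<Gamma> j \<Longrightarrow> x \<in> carrier G"
  using lower_central_subgroup[OF subgroup_self] by blast

lemma \<Gamma>_normal: "\<Gamma> j \<lhd> G"
  unfolding normal_inv_iff
  by (intro conjI ballI \<Gamma>_subgroup lower_central_normalized[OF subgroup_self])

lemma \<Gamma>_Suc_subset: "\<Gamma> (Suc j) \<subseteq> \<Gamma> j"
proof (cases "j = 0")
  case False
  have "commutator G h k \<in> \<Gamma> j" if "h \<in> carrier G" "k \<in> \<Gamma> j" for h k
    using commutator_mem_normal(2)[OF \<Gamma>_normal that(2,1)] .
  then have "{commutator G h k |h k. h \<in> carrier G \<and> k \<in> \<Gamma> j} \<subseteq> \<Gamma> j"
    by auto
  from generate_subgroup_incl[OF this \<Gamma>_subgroup] show ?thesis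
    using False by (simp add: lower_central_Suc commutator_subgroup_eq)
qed simp

lemma \<Gamma>_antimono: "i \<le> j \<Longrightarrow> \<Gamma> j \<subseteq> \<Gamma> i"
  by (induction j rule: dec_induct) (use \<Gamma>_Suc_subset in blast)+

text \<open>Computing modulo \<^term>\<open>N\<close> is done in the quotient group, where membership in \<^term>\<open>N\<close>
  becomes an equation.\<close>

lemma Mod_eq_one_iff:
  assumes "N \<lhd> G" "x \<in> carrier G"
  shows "N #> x = \<one>\<^bsub>G Mod N\<^esub> \<longleftrightarrow> x \<in> N"
  unfolding one_FactGroup
  using coset_join1[OF _ assms(2) normal_imp_subgroup[OF assms(1)]]
    coset_join2[OF assms(2) normal_imp_subgroup[OF assms(1)]] by blast

lemma r_coset_eqD:
  assumes "N \<lhd> G" "x \<in> carrier G" "y \<in> carrier G" "N #> x = N #> y"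
  shows "x \<otimes> inv y \<in> N"
proof -
  have "x \<in> N #> y"
    using rcos_self[OF assms(2) normal_imp_subgroup[OF assms(1)]] assms(4) by simp
  then show ?thesis
    using subgroup.rcos_module[OF normal_imp_subgroup[OF assms(1)] is_group assms(3,2)] by simp
qed

lemma Mod_mult:
  assumes "N \<lhd> G" "x \<in> carrier G" "y \<in> carrier G"
  shows "N #> (x \<otimes> y) = (N #> x) \<otimes>\<^bsub>G Mod N\<^esub> (N #> y)"
  using normal.rcos_sum[OF assms] by simp

lemma Mod_commutator:
  assumes "N \<lhd> G" "x \<in> carrier G" "y \<in> carrier G"
  shows "N #> commutator G x y = commutator (G Mod N) (N #> x) (N #> y)"
proof -
  interpret normal N G by fact
  interpret Q: group "G Mod N" by (rule factorgroup_is_group)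
  interpret \<pi>: group_hom G "G Mod N" "\<lambda>x. N #> x"
    using r_coset_hom_Mod by unfold_locales
  show ?thesis
    using assms(2,3) \<pi>.hom_mult \<pi>.hom_inv by (simp add: commutator_def del: mult_FactGroup)
qed

section \<open>Commutator calculus modulo a term of the lower central series\<close>

lemma commutator_conj:
  "x \<in> carrier G \<Longrightarrow> y \<in> carrier G \<Longrightarrow> z \<in> carrier G \<Longrightarrow>
    z \<otimes> commutator G x y \<otimes> inv z = commutator G (x \<otimes> commutator G (inv x) z) (y \<otimes> commutator G (inv y) z)"
  by (simp add: commutator_def word_simps)

text \<open>Both versions write the conjugate of a commutator as the commutator of the conjugates.
  The correction stands on the right for \<open>commutator_perturb\<close> and on the left for
  \<open>commutator_mult_mult\<close>.\<close>

lemma commutator_conj':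
  "x \<in> carrier G \<Longrightarrow> y \<in> carrier G \<Longrightarrow> z \<in> carrier G \<Longrightarrow>
    z \<otimes> commutator G x y \<otimes> inv z = commutator G (commutator G z x \<otimes> x) (commutator G z y \<otimes> y)"
  by (simp add: commutator_def word_simps)

lemma left_commute:
  assumes "x \<in> carrier G" "y \<in> carrier G" "z \<in> carrier G" "x \<otimes> y = y \<otimes> x"
  shows "x \<otimes> (y \<otimes> z) = y \<otimes> (x \<otimes> z)"
  using assms by (simp add: m_assoc [symmetric])

lemma commute_inv:
  assumes "x \<in> carrier G" "y \<in> carrier G" "x \<otimes> y = y \<otimes> x"
  shows "x \<otimes> inv y = inv y \<otimes> x"
proof -
  have "x \<otimes> inv y = inv y \<otimes> (y \<otimes> x) \<otimes> inv y"
    using assms(1,2) by (simp add: word_simps)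
  also have "\<dots> = inv y \<otimes> x"
    unfolding assms(3)[symmetric] using assms(1,2) by (simp add: word_simps)
  finally show ?thesis .
qed

text \<open>The factor \<open>b\<close> commutes with everything it meets and cancels against its
  inverse; afterwards \<open>a\<close> passes through \<open>y\<close> and cancels too. This is how
  corrections of high weight disappear in a quotient.\<close>

lemma commutator_perturb:
  assumes [simp]: "x \<in> carrier G" "y \<in> carrier G" "a \<in> carrier G" "b \<in> carrier G"
    and b: "x \<otimes> b = b \<otimes> x" "a \<otimes> b = b \<otimes> a" "y \<otimes> b = b \<otimes> y" and a: "a \<otimes> y = y \<otimes> a"
  shows "commutator G (x \<otimes> a) (y \<otimes> b) = commutator G x y"
proof -
  note lc = b[THEN left_commute[rotated -1]] a[THEN left_commute[rotated -1]]
  have ai: "a \<otimes> (y \<otimes> (inv a \<otimes> z)) = y \<otimes> z" if "z \<in> carrier G" for z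
    using that by (simp add: lc cancel_inv)
  have bi: "b \<otimes> (x \<otimes> (y \<otimes> (inv x \<otimes> (inv b \<otimes> inv y)))) = x \<otimes> (y \<otimes> (inv x \<otimes> inv y))"
  proof -
    have "inv x \<otimes> b = b \<otimes> inv x"
      using commute_inv[of b x] b by simp
    note lc' = lc this[THEN left_commute[rotated -1]]
    have "b \<otimes> (x \<otimes> (y \<otimes> (inv x \<otimes> (inv b \<otimes> inv y)))) = x \<otimes> (y \<otimes> (inv x \<otimes> (b \<otimes> (inv b \<otimes> inv y))))"
      by (simp add: lc')
    then show ?thesis by (simp add: cancel_inv)
  qed
  have "commutator G (x \<otimes> a) (y \<otimes> b) = x \<otimes> (a \<otimes> (y \<otimes> (b \<otimes> (inv a \<otimes> (inv x \<otimes> (inv b \<otimes> inv y))))))"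
    by (simp add: commutator_def word_simps)
  also have "\<dots> = b \<otimes> (x \<otimes> (a \<otimes> (y \<otimes> (inv a \<otimes> (inv x \<otimes> (inv b \<otimes> inv y))))))"
    by (simp add: lc)
  also have "\<dots> = commutator G x y"
    by (simp only: ai bi m_closed inv_closed assms(1-4)) (simp add: commutator_def m_assoc)
  finally show ?thesis .
qed

text \<open>The bilinear expansion of a commutator, exact because the error terms commute with what
  they pass. The fourth term, the commutator of \<open>c\<close> and \<open>d\<close>, is trivial
  since these commute.\<close>

lemma commutator_mult_mult:
  assumes [simp]: "x \<in> carrier G" "y \<in> carrier G" "c \<in> carrier G" "d \<in> carrier G"
    and p: "\<And>u. u \<in> {c, d} \<Longrightarrow> u \<otimes> commutator G x d = commutator G x d \<otimes> u"
    and q: "\<And>u. u \<in> {d, commutator G x y} \<Longrightarrow> u \<otimes> commutator G c y = commutator G c y \<otimes> u"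
    and cd: "c \<otimes> d = d \<otimes> c" "c \<otimes> commutator G x y = commutator G x y \<otimes> c"
      "d \<otimes> commutator G x y = commutator G x y \<otimes> d"
  shows "commutator G (c \<otimes> x) (d \<otimes> y) = commutator G x d \<otimes> commutator G c y \<otimes> commutator G x y"
proof -
  define m where "m = commutator G x y"
  define p where "p = commutator G x d"
  define q where "q = commutator G c y"
  have [simp]: "m \<in> carrier G" "p \<in> carrier G" "q \<in> carrier G"
    by (simp_all add: m_def p_def q_def)
  have 1: "x \<otimes> d = p \<otimes> d \<otimes> x" and 2: "x \<otimes> y \<otimes> inv x = m \<otimes> y" and 3: "y \<otimes> inv c \<otimes> inv y = inv c \<otimes> q"
    by (simp_all add: p_def m_def q_def commutator_def word_simps)
  have "inv d \<otimes> q = q \<otimes> inv d"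
    using commute_inv[of q d] q[of d] by (simp add: q_def)
  note c = cd[folded m_def] p[of c, folded p_def, simplified] p[of d, folded p_def, simplified]
    q[of d, folded q_def, simplified] q[of m, folded q_def, unfolded m_def, simplified, folded m_def] this
  note lc = c(1-6)[THEN left_commute[rotated -1]]
  have "commutator G (c \<otimes> x) (d \<otimes> y) = c \<otimes> (x \<otimes> d) \<otimes> y \<otimes> inv x \<otimes> inv c \<otimes> inv y \<otimes> inv d"
    by (simp add: commutator_def word_simps)
  also have "\<dots> = c \<otimes> p \<otimes> d \<otimes> (x \<otimes> y \<otimes> inv x) \<otimes> inv c \<otimes> inv y \<otimes> inv d"
    unfolding 1 by (simp add: word_simps)
  also have "\<dots> = c \<otimes> p \<otimes> d \<otimes> m \<otimes> (y \<otimes> inv c \<otimes> inv y) \<otimes> inv d"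
    unfolding 2 by (simp add: word_simps)
  also have "\<dots> = c \<otimes> (p \<otimes> (d \<otimes> (m \<otimes> (inv c \<otimes> (q \<otimes> inv d)))))"
    unfolding 3 by (simp add: word_simps)
  also have "\<dots> = p \<otimes> (m \<otimes> (d \<otimes> (c \<otimes> (inv c \<otimes> (q \<otimes> inv d)))))"
    by (simp add: lc)
  also have "\<dots> = p \<otimes> (m \<otimes> q)"
    by (simp add: cancel_inv lc)
  also have "\<dots> = p \<otimes> (q \<otimes> m)"
    using c(7) by simp
  finally show ?thesis
    by (simp add: p_def q_def m_def m_assoc)
qed

text \<open>In place of the three subgroups lemma, a generator [h, k] of \<Gamma>_{i+1} is
  conjugated by z in \<Gamma>_j. This replaces h by h a and k by k b with a in \<Gamma>_{j+1} and b
  in \<Gamma>_{i+j}. Modulo \<Gamma>_{i+1+j} the element b is central and a commutes with k, so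
  [h, k] is unchanged.\<close>

lemma \<Gamma>_commutator:
  assumes "1 \<le> i" "1 \<le> j" "x \<in> \<Gamma> i" "y \<in> \<Gamma> j"
  shows "commutator G x y \<in> \<Gamma> (i + j)"
  using assms
proof (induction i arbitrary: j x y rule: dec_induct)
  case base
  then show ?case
    using lower_central_commutator[of j x "carrier G" y] by simp
next
  case (step i)
  let ?N = "\<Gamma> (Suc i + j)"
  interpret N: normal ?N G by (rule \<Gamma>_normal)
  interpret Q: group "G Mod ?N" by (rule N.factorgroup_is_group)
  interpret \<pi>: group_hom G "G Mod ?N" "\<lambda>x. ?N #> x"
    using N.r_coset_hom_Mod by unfold_locales
  have commute: "(?N #> u) \<otimes>\<^bsub>G Mod ?N\<^esub> (?N #> v) = (?N #> v) \<otimes>\<^bsub>G Mod ?N\<^esub> (?N #> u)"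
    if "commutator G u v \<in> ?N" "u \<in> carrier G" "v \<in> carrier G" for u v
    using that Q.commutator_eq_one_iff Mod_commutator[OF \<Gamma>_normal] Mod_eq_one_iff[OF \<Gamma>_normal]
      \<pi>.hom_closed by (metis commutator_closed)
  have "commutator G z (commutator G h k) \<in> ?N"
    if h: "h \<in> carrier G" and k: "k \<in> \<Gamma> i" and z: "z \<in> \<Gamma> j" for h k z
  proof -
    have [simp]: "h \<in> carrier G" "k \<in> carrier G" "z \<in> carrier G"
      using that \<Gamma>_carrier by auto
    define a where "a = commutator G (inv h) z"
    define b where "b = commutator G (inv k) z"
    have a: "a \<in> \<Gamma> (Suc j)"
      unfolding a_def using step.prems z by (intro lower_central_commutator) auto
    have b: "b \<in> \<Gamma> (i + j)"
      unfolding b_def using step z k subgroup.m_inv_closed[OF \<Gamma>_subgroup] by (intro step.IH) auto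
    have [simp]: "a \<in> carrier G" "b \<in> carrier G"
      using a b \<Gamma>_carrier by auto
    have cb: "commutator G u b \<in> ?N" if "u \<in> carrier G" for u
      using lower_central_commutator[of "i + j" u "carrier G" b] b that step by simp
    \<comment> \<open>The induction hypothesis is used at \<open>Suc j\<close>, which is why
      \<open>j\<close> is generalized.\<close>
    have ca: "commutator G a k \<in> ?N"
      using step.IH[of "Suc j" k a] a k step.prems
      by (intro commutator_swap[OF N.subgroup_axioms, of k]) auto
    have "?N #> (z \<otimes> commutator G h k \<otimes> inv z) = ?N #> commutator G h k"
    proof -
      have "?N #> (z \<otimes> commutator G h k \<otimes> inv z)
          = commutator (G Mod ?N) ((?N #> h) \<otimes>\<^bsub>G Mod ?N\<^esub> (?N #> a)) ((?N #> k) \<otimes>\<^bsub>G Mod ?N\<^esub> (?N #> b))"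
        by (simp add: commutator_conj a_def[symmetric] b_def[symmetric] Mod_commutator[OF \<Gamma>_normal]
            Mod_mult[OF \<Gamma>_normal] del: mult_FactGroup \<pi>.hom_mult)
      also have "\<dots> = commutator (G Mod ?N) (?N #> h) (?N #> k)"
        by (rule Q.commutator_perturb) (rule commute cb ca \<pi>.hom_closed | simp)+
      finally show ?thesis by (simp add: Mod_commutator[OF \<Gamma>_normal])
    qed
    then have "z \<otimes> commutator G h k \<otimes> inv z \<otimes> inv (commutator G h k) \<in> ?N"
      by (intro r_coset_eqD[OF \<Gamma>_normal]) auto
    then show ?thesis
      by (simp add: commutator_def[of G z])
  qed
  then have 1: "commutator G u z \<in> ?N"
    if "u \<in> {commutator G h k |h k. h \<in> carrier G \<and> k \<in> \<Gamma> i}" "z \<in> \<Gamma> j" for u z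
    using that N.m_inv_closed[of "commutator G z u"] \<Gamma>_carrier by (auto simp: inv_commutator)
  show ?case
  proof (rule commutator_generate[OF \<Gamma>_normal _ _ 1])
    show "x \<in> generate G {commutator G h k |h k. h \<in> carrier G \<and> k \<in> \<Gamma> i}"
      using step by (simp add: lower_central_Suc commutator_subgroup_eq)
    show "y \<in> generate G (\<Gamma> j)"
      using step.prems by (intro generate.incl)
  qed (use \<Gamma>_carrier in auto)
qed

lemma \<Gamma>_commute_mod:
  assumes "1 \<le> i" "1 \<le> j" "u \<in> \<Gamma> i" "v \<in> \<Gamma> j" "N \<le> i + j"
  shows "(\<Gamma> N #> u) \<otimes>\<^bsub>G Mod \<Gamma> N\<^esub> (\<Gamma> N #> v) = (\<Gamma> N #> v) \<otimes>\<^bsub>G Mod \<Gamma> N\<^esub> (\<Gamma> N #> u)"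
proof -
  interpret N: normal "\<Gamma> N" G by (rule \<Gamma>_normal)
  interpret Q: group "G Mod \<Gamma> N" by (rule N.factorgroup_is_group)
  interpret \<pi>: group_hom G "G Mod \<Gamma> N" "\<lambda>x. \<Gamma> N #> x"
    using N.r_coset_hom_Mod by unfold_locales
  have "u \<in> carrier G" "v \<in> carrier G" "commutator G u v \<in> \<Gamma> N"
    using \<Gamma>_commutator[OF assms(1-4)] \<Gamma>_antimono[OF assms(5)] assms \<Gamma>_carrier by auto
  then show ?thesis
    using Q.commutator_eq_one_iff Mod_commutator[OF \<Gamma>_normal] Mod_eq_one_iff[OF \<Gamma>_normal]
      \<pi>.hom_closed by (metis commutator_closed)
qed

text \<open>The Jacobi identity modulo \<open>\<Gamma>\<^bsub>a+b+c+1\<^esub>\<close>, obtained by expanding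
  \<open>z [x, y] z\<inverse> = [[z, x] x, [z, y] y]\<close>.\<close>

lemma \<Gamma>_jacobi:
  assumes abc: "1 \<le> a" "1 \<le> b" "1 \<le> c" and x: "x \<in> \<Gamma> a" and y: "y \<in> \<Gamma> b" and z: "z \<in> \<Gamma> c"
    and H: "subgroup H G" "\<Gamma> (Suc (a + b + c)) \<subseteq> H"
    and "commutator G x (commutator G z y) \<in> H" "commutator G (commutator G z x) y \<in> H"
  shows "commutator G z (commutator G x y) \<in> H"
proof -
  let ?N = "\<Gamma> (Suc (a + b + c))"
  interpret H: subgroup H G by fact
  interpret N: normal ?N G by (rule \<Gamma>_normal)
  interpret Q: group "G Mod ?N" by (rule N.factorgroup_is_group)
  interpret \<pi>: group_hom G "G Mod ?N" "\<lambda>x. ?N #> x"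
    using N.r_coset_hom_Mod by unfold_locales
  have [simp]: "x \<in> carrier G" "y \<in> carrier G" "z \<in> carrier G"
    using x y z \<Gamma>_carrier by auto
  define u where "u = commutator G z x"
  define v where "v = commutator G z y"
  define p where "p = commutator G x v"
  define q where "q = commutator G u y"
  define m where "m = commutator G x y"
  \<comment> \<open>Only the weights matter below: every pair that has to commute has total weight
    at least a + b + c + 1, the index of \<open>?N\<close>.\<close>
  have uvm: "u \<in> \<Gamma> (c + a)" "v \<in> \<Gamma> (c + b)" "m \<in> \<Gamma> (a + b)"
    using \<Gamma>_commutator abc x y z by (auto simp: u_def v_def m_def)
  have pq: "p \<in> \<Gamma> (a + b + c)" "q \<in> \<Gamma> (a + b + c)"
    using \<Gamma>_commutator[of a "c + b" x v] \<Gamma>_commutator[of "c + a" b u y] abc x y uvm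
    by (auto simp: p_def q_def ac_simps)
  have [simp]: "u \<in> carrier G" "v \<in> carrier G" "m \<in> carrier G" "p \<in> carrier G" "q \<in> carrier G"
    using uvm pq \<Gamma>_carrier by auto
  have "?N #> (z \<otimes> m \<otimes> inv z) = ?N #> (p \<otimes> q \<otimes> m)"
  proof -
    have "?N #> (z \<otimes> m \<otimes> inv z)
        = commutator (G Mod ?N) ((?N #> u) \<otimes>\<^bsub>G Mod ?N\<^esub> (?N #> x)) ((?N #> v) \<otimes>\<^bsub>G Mod ?N\<^esub> (?N #> y))"
      by (simp add: commutator_conj' u_def[symmetric] v_def[symmetric] m_def Mod_commutator[OF \<Gamma>_normal]
          Mod_mult[OF \<Gamma>_normal] del: mult_FactGroup \<pi>.hom_mult)
    also have "\<dots> = (?N #> p) \<otimes>\<^bsub>G Mod ?N\<^esub> (?N #> q) \<otimes>\<^bsub>G Mod ?N\<^esub> (?N #> m)"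
      unfolding p_def q_def m_def Mod_commutator[OF \<Gamma>_normal \<open>x \<in> carrier G\<close> \<open>v \<in> carrier G\<close>]
        Mod_commutator[OF \<Gamma>_normal \<open>u \<in> carrier G\<close> \<open>y \<in> carrier G\<close>]
        Mod_commutator[OF \<Gamma>_normal \<open>x \<in> carrier G\<close> \<open>y \<in> carrier G\<close>]
    proof (rule Q.commutator_mult_mult)
      note M = Mod_commutator[OF \<Gamma>_normal, symmetric] p_def[symmetric] q_def[symmetric] m_def[symmetric]
      have comm: "(?N #> w) \<otimes>\<^bsub>G Mod ?N\<^esub> (?N #> w') = (?N #> w') \<otimes>\<^bsub>G Mod ?N\<^esub> (?N #> w)"
        if "w \<in> \<Gamma> i" "w' \<in> \<Gamma> j" "1 \<le> i" "1 \<le> j" "Suc (a + b + c) \<le> i + j" for w w' i j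
        using that by (intro \<Gamma>_commute_mod)
      fix w assume "w \<in> {?N #> u, ?N #> v}"
      then show "w \<otimes>\<^bsub>G Mod ?N\<^esub> commutator (G Mod ?N) (?N #> x) (?N #> v) =
          commutator (G Mod ?N) (?N #> x) (?N #> v) \<otimes>\<^bsub>G Mod ?N\<^esub> w"
        using comm[OF uvm(1) pq(1)] comm[OF uvm(2) pq(1)] abc by (auto simp: M simp del: mult_FactGroup)
    next
      note M = Mod_commutator[OF \<Gamma>_normal, symmetric] p_def[symmetric] q_def[symmetric] m_def[symmetric]
      have comm: "(?N #> w) \<otimes>\<^bsub>G Mod ?N\<^esub> (?N #> w') = (?N #> w') \<otimes>\<^bsub>G Mod ?N\<^esub> (?N #> w)"
        if "w \<in> \<Gamma> i" "w' \<in> \<Gamma> j" "1 \<le> i" "1 \<le> j" "Suc (a + b + c) \<le> i + j" for w w' i j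
        using that by (intro \<Gamma>_commute_mod)
      show "(?N #> u) \<otimes>\<^bsub>G Mod ?N\<^esub> (?N #> v) = (?N #> v) \<otimes>\<^bsub>G Mod ?N\<^esub> (?N #> u)"
        using comm[OF uvm(1) uvm(2)] abc by simp
      show "(?N #> u) \<otimes>\<^bsub>G Mod ?N\<^esub> commutator (G Mod ?N) (?N #> x) (?N #> y) =
          commutator (G Mod ?N) (?N #> x) (?N #> y) \<otimes>\<^bsub>G Mod ?N\<^esub> (?N #> u)"
        using comm[OF uvm(1) uvm(3)] abc by (simp add: M del: mult_FactGroup)
      show "(?N #> v) \<otimes>\<^bsub>G Mod ?N\<^esub> commutator (G Mod ?N) (?N #> x) (?N #> y) =
          commutator (G Mod ?N) (?N #> x) (?N #> y) \<otimes>\<^bsub>G Mod ?N\<^esub> (?N #> v)"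
        using comm[OF uvm(2) uvm(3)] abc by (simp add: M del: mult_FactGroup)
      fix w assume "w \<in> {?N #> v, commutator (G Mod ?N) (?N #> x) (?N #> y)}"
      then show "w \<otimes>\<^bsub>G Mod ?N\<^esub> commutator (G Mod ?N) (?N #> u) (?N #> y) =
          commutator (G Mod ?N) (?N #> u) (?N #> y) \<otimes>\<^bsub>G Mod ?N\<^esub> w"
        using comm[OF uvm(2) pq(2)] comm[OF uvm(3) pq(2)] abc by (auto simp: M simp del: mult_FactGroup)
    qed (simp_all)
    finally show ?thesis by (simp add: Mod_mult[OF \<Gamma>_normal] del: mult_FactGroup \<pi>.hom_mult)
  qed
  then have "z \<otimes> m \<otimes> inv z \<otimes> inv (p \<otimes> q \<otimes> m) \<in> ?N"
    by (intro r_coset_eqD[OF \<Gamma>_normal]) auto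
  \<comment> \<open>The congruence says that [z, m] equals p q modulo \<open>?N\<close>, and
    \<open>H\<close> contains \<open>?N\<close>.\<close>
  then have "(z \<otimes> m \<otimes> inv z \<otimes> inv m) \<otimes> (inv q \<otimes> inv p) \<in> H"
    using H(2) by (simp add: word_simps subset_iff)
  moreover have "p \<in> H" "q \<in> H"
    using assms by (auto simp: p_def q_def u_def v_def)
  ultimately have "(z \<otimes> m \<otimes> inv z \<otimes> inv m) \<otimes> (inv q \<otimes> inv p) \<otimes> (p \<otimes> q) \<in> H"
    by blast
  then show ?thesis
    by (simp add: word_simps commutator_def[of G z] m_def[symmetric])
qed

end

section \<open>The Magnus expansion\<close>

text \<open>Power series in noncommuting variables are given by their coefficients at words; \<open>conv\<close> is
  the product, summing over the factorizations of a word by recursion on its first letter.\<close>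

primrec conv :: "(nat list \<Rightarrow> int) \<Rightarrow> (nat list \<Rightarrow> int) \<Rightarrow> nat list \<Rightarrow> int" where
  "conv f g [] = f [] * g []"
| "conv f g (x # w) = f [] * g (x # w) + conv (\<lambda>u. f (x # u)) g w"

text \<open>Solves h * f = k for the left factor h when f has constant term 1, reading off one
  letter at a time. It supplies the inverses in the group of power series.\<close>

primrec left_quotient :: "(nat list \<Rightarrow> int) \<Rightarrow> (nat list \<Rightarrow> int) \<Rightarrow> nat list \<Rightarrow> int" where
  "left_quotient f k [] = k []"
| "left_quotient f k (x # w) = left_quotient f (\<lambda>u. k (x # u) - k [] * f (x # u)) w"

lemma conv_eq_sum: "conv f g w = (\<Sum>i\<le>length w. f (take i w) * g (drop i w))"
  by (induction w arbitrary: f) (simp_all add: sum.atMost_Suc_shift del: sum.atMost_Suc)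

lemma conv_zero [simp]: "conv (\<lambda>u. 0) f w = 0"
  by (simp add: conv_eq_sum)

lemma conv_linear: "conv (\<lambda>u. c * a u + b u) h w = c * conv a h w + conv b h w"
  by (simp add: conv_eq_sum sum_distrib_left sum.distrib algebra_simps)

lemma conv_assoc: "conv (conv f g) h w = conv f (conv g h) w"
  by (induction w arbitrary: f) (simp_all add: conv_linear algebra_simps)

lemma conv_left_quotient: "f [] = 1 \<Longrightarrow> conv (left_quotient f k) f w = k w"
  by (induction w arbitrary: k) simp_all

text \<open>Integer power series with constant term 1. Words over all natural numbers are allowed,
  so one group serves every rank.\<close>

definition magnus_group :: "(nat list \<Rightarrow> int) monoid" where
  "magnus_group = \<lparr>carrier = {f. f [] = 1}, monoid.mult = conv, one = (\<lambda>w. if w = [] then 1 else 0)\<rparr>"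

lemma magnus_group_simps [simp]:
  "f \<in> carrier magnus_group \<longleftrightarrow> f [] = 1"
  "monoid.mult magnus_group = conv"
  "\<one>\<^bsub>magnus_group\<^esub> = (\<lambda>w. if w = [] then 1 else 0)"
  by (simp_all add: magnus_group_def)

lemma group_magnus_group: "group magnus_group"
proof (rule groupI)
  fix f assume f: "f \<in> carrier magnus_group"
  show "\<exists>g\<in>carrier magnus_group. g \<otimes>\<^bsub>magnus_group\<^esub> f = \<one>\<^bsub>magnus_group\<^esub>"
    using f by (intro bexI[of _ "left_quotient f \<one>\<^bsub>magnus_group\<^esub>"]) (auto simp: conv_left_quotient)
  show "\<one>\<^bsub>magnus_group\<^esub> \<otimes>\<^bsub>magnus_group\<^esub> f = f"
  proof
    fix w show "(\<one>\<^bsub>magnus_group\<^esub> \<otimes>\<^bsub>magnus_group\<^esub> f) w = f w"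
      by (cases w) simp_all
  qed
qed (auto simp: conv_assoc)

interpretation Mag: group magnus_group
  by (rule group_magnus_group)

text \<open>These are the series 1 + (terms of degree at least \<open>k\<close>), the congruence
  subgroup for the \<open>k\<close>-th power of the augmentation ideal.\<close>

definition low_order :: "nat \<Rightarrow> (nat list \<Rightarrow> int) set" where
  "low_order k = {f. f [] = 1 \<and> (\<forall>w. w \<noteq> [] \<longrightarrow> length w < k \<longrightarrow> f w = 0)}"

lemma low_orderD: "f \<in> low_order k \<Longrightarrow> w \<noteq> [] \<Longrightarrow> length w < k \<Longrightarrow> f w = 0"
  and low_order_Nil: "f \<in> low_order k \<Longrightarrow> f [] = 1"
  by (auto simp: low_order_def)

text \<open>In (1 + f')(1 + g') the cross term f' g' starts in degree a + b, and in that degree only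
  the splitting after \<open>a\<close> letters contributes.\<close>

lemma conv_low:
  assumes f: "f \<in> low_order a" and g: "g \<in> low_order b" and ab: "1 \<le> a" "1 \<le> b"
    and w: "w \<noteq> []" "length w \<le> a + b"
  shows "conv f g w = f w + g w + (if length w = a + b then f (take a w) * g (drop a w) else 0)"
proof -
  let ?t = "\<lambda>i. f (take i w) * g (drop i w)"
  have 0: "?t i = 0" if "0 < i" "i < length w" "\<not> (length w = a + b \<and> i = a)" for i
  proof (cases "i < a")
    case True
    then have "f (take i w) = 0" using that w by (intro low_orderD[OF f]) auto
    then show ?thesis by simp
  next
    case False
    then have "length w - i < b" using that w by linarith
    then have "g (drop i w) = 0" using that by (intro low_orderD[OF g]) auto
    then show ?thesis by simp
  qed
  define S where "S = (if length w = a + b then {a} else {})"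
  have "conv f g w = sum ?t ({0, length w} \<union> S)"
    unfolding conv_eq_sum
    by (rule sum.mono_neutral_right) (use 0 w in \<open>auto simp: S_def split: if_splits\<close>)
  also have "\<dots> = sum ?t {0, length w} + sum ?t S"
    by (rule sum.union_disjoint) (use ab in \<open>auto simp: S_def\<close>)
  finally show ?thesis
    using w low_order_Nil[OF f] low_order_Nil[OF g] by (auto simp: S_def)
qed

lemma conv_low_add:
  assumes "f \<in> low_order k" "g \<in> low_order k" "1 \<le> k" "w \<noteq> []" "length w \<le> k"
  shows "conv f g w = f w + g w"
  using conv_low[OF assms(1,2), of w] assms by auto

text \<open>The inverse of 1 + f' begins with 1 - f'. By induction on length its shorter
  coefficients vanish, so multiplying by \<open>f\<close> leaves only the two linear terms at
  \<open>w\<close>.\<close>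

lemma inv_low:
  assumes f: "f \<in> low_order k" "1 \<le> k" and w: "w \<noteq> []" "length w \<le> k"
  shows "(inv\<^bsub>magnus_group\<^esub> f) w = - f w"
  using w
proof (induction "length w" arbitrary: w rule: less_induct)
  case less
  let ?g = "inv\<^bsub>magnus_group\<^esub> f"
  have f': "f \<in> carrier magnus_group" using low_order_Nil[OF f(1)] by simp
  then have g1: "?g [] = 1" using Mag.inv_closed by fastforce
  have "?g u = 0" if "u \<noteq> []" "length u < length w" for u
    using less.hyps[OF that(2,1)] less.prems that low_orderD[OF f(1), of u] by simp
  then have g: "?g \<in> low_order (length w)"
    using g1 by (simp add: low_order_def)
  have "conv ?g f w = 0"
    using Mag.l_inv[OF f'] less.prems by simp
  moreover have "conv ?g f w = ?g w + f w"
    using conv_low[OF g f(1), of w] f(2) less.prems by (cases "length w = 0") auto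
  ultimately show ?case by simp
qed

lemma subgroup_low_order:
  assumes "1 \<le> k"
  shows "subgroup (low_order k) magnus_group"
proof (rule Mag.subgroupI)
  show "low_order k \<subseteq> carrier magnus_group"
    by (auto simp: low_order_def)
  show "low_order k \<noteq> {}"
    by (rule ex_in_conv[THEN iffD1], rule exI[of _ "\<one>\<^bsub>magnus_group\<^esub>"]) (simp add: low_order_def)
  fix f g assume f: "f \<in> low_order k"
  then have "f \<in> carrier magnus_group" by (simp add: low_order_def)
  then have "(inv\<^bsub>magnus_group\<^esub> f) [] = 1"
    using Mag.inv_closed by fastforce
  then show "inv\<^bsub>magnus_group\<^esub> f \<in> low_order k"
    using inv_low[OF f assms] low_orderD[OF f] by (auto simp: low_order_def)
  assume g: "g \<in> low_order k"
  then show "f \<otimes>\<^bsub>magnus_group\<^esub> g \<in> low_order k"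
    using conv_low_add[OF f g assms] low_orderD[OF f] low_orderD[OF g] f g by (auto simp: low_order_def)
qed

text \<open>The leading part of a group commutator is the ring commutator f' g' - g' f'. It is read
  off from [f, g] (g f) = f g, which avoids expanding inverses.\<close>

lemma commutator_low:
  assumes f: "f \<in> low_order a" and g: "g \<in> low_order b" and ab: "1 \<le> a" "1 \<le> b"
    and w: "w \<noteq> []" "length w \<le> a + b"
  shows "commutator magnus_group f g w =
    (if length w = a + b then f (take a w) * g (drop a w) - g (take b w) * f (drop b w) else 0)"
  using w
proof (induction "length w" arbitrary: w rule: less_induct)
  case less
  let ?c = "commutator magnus_group f g"
  have fg: "f \<in> carrier magnus_group" "g \<in> carrier magnus_group"
    using f g low_order_Nil by auto
  then have c: "?c [] = 1"
    using Mag.commutator_closed by fastforce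
  have "?c u = 0" if "u \<noteq> []" "length u < length w" for u
    using less.hyps[OF that(2,1)] less.prems that by simp
  then have c: "?c \<in> low_order (length w)"
    using c by (simp add: low_order_def)
  \<comment> \<open>Order 1 suffices here: \<open>?c\<close> already has order
    \<open>length w\<close>, so no cross term reaches \<open>w\<close>.\<close>
  have h: "conv g f \<in> low_order 1"
    using low_order_Nil[OF f] low_order_Nil[OF g] by (simp add: low_order_def)
  have "conv ?c (conv g f) w = conv f g w"
    using Mag.commutator_mult[OF fg] by simp
  moreover have "conv ?c (conv g f) w = ?c w + conv g f w"
    using conv_low[OF c h, of w] less.prems by (cases "length w = 0") auto
  moreover have "conv f g w = f w + g w + (if length w = a + b then f (take a w) * g (drop a w) else 0)"
    by (rule conv_low[OF f g ab less.prems])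
  moreover have "conv g f w = g w + f w + (if length w = a + b then g (take b w) * f (drop b w) else 0)"
    using conv_low[OF g f ab(2,1) less.prems(1)] less.prems by (simp add: add.commute)
  ultimately show ?case by (auto split: if_splits)
qed

text \<open>Magnus's map x_i \<mapsto> 1 + X_i. The universal property asserts only existence, hence
  the choice operator.\<close>

definition magnus :: "nat \<Rightarrow> letter list \<Rightarrow> nat list \<Rightarrow> int" where
  "magnus n = (SOME h. h \<in> hom (free_group n) magnus_group \<and>
     (\<forall>i\<in>{1..n}. h (gen i) = (\<lambda>w. if w = [] \<or> w = [i] then 1 else 0)))"

lemma magnus_hom: "magnus n \<in> hom (free_group n) magnus_group"
  and magnus_gen: "i \<in> {1..n} \<Longrightarrow> magnus n (gen i) = (\<lambda>w. if w = [] \<or> w = [i] then 1 else 0)"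
proof -
  have "\<exists>h. h \<in> hom (free_group n) magnus_group \<and>
     (\<forall>i\<in>{1..n}. h (gen i) = (\<lambda>w. if w = [] \<or> w = [i] then 1 else 0))"
    using free_group_extension[OF group_magnus_group, of "\<lambda>i w. if w = [] \<or> w = [i] then 1 else 0" n] by auto
  from someI_ex[OF this] show "magnus n \<in> hom (free_group n) magnus_group"
    and "i \<in> {1..n} \<Longrightarrow> magnus n (gen i) = (\<lambda>w. if w = [] \<or> w = [i] then 1 else 0)"
    unfolding magnus_def by auto
qed

text \<open>The leading coefficients of an element of \<open>\<Gamma>\<^sub>k\<close> are those at the words of length \<open>k\<close>.\<close>

locale free_grp = fixes n :: nat
begin

abbreviation F :: "letter list monoid" where
  "F \<equiv> free_group n"

sublocale group F
  by (rule group_free_group)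

sublocale \<mu>: group_hom F magnus_group "magnus n"
  using magnus_hom by unfold_locales

lemma magnus_commutator:
  "x \<in> carrier F \<Longrightarrow> y \<in> carrier F \<Longrightarrow> magnus n (commutator F x y) = commutator magnus_group (magnus n x) (magnus n y)"
  by (simp add: commutator_def \<mu>.hom_mult \<mu>.hom_inv del: magnus_group_simps)

text \<open>The easy half of Magnus's theorem: a commutator with one more element raises the order
  by one.\<close>

lemma magnus_\<Gamma>: "1 \<le> k \<Longrightarrow> x \<in> \<Gamma> k \<Longrightarrow> magnus n x \<in> low_order k"
proof (induction k arbitrary: x rule: dec_induct)
  case base
  then show ?case using \<mu>.hom_closed[of x] by (simp add: low_order_def)
next
  case (step k)
  let ?C = "{commutator F h g |h g. h \<in> carrier F \<and> g \<in> \<Gamma> k}"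
  have C: "?C \<subseteq> carrier F" using \<Gamma>_carrier by auto
  have "magnus n (commutator F h g) \<in> low_order (Suc k)" if "h \<in> carrier F" "g \<in> \<Gamma> k" for h g
  proof -
    have h: "magnus n h \<in> low_order 1" using \<mu>.hom_closed[OF that(1)] by (simp add: low_order_def)
    have g: "magnus n g \<in> low_order k" using step.IH[OF that(2)] .
    have c: "magnus n (commutator F h g) = commutator magnus_group (magnus n h) (magnus n g)"
      using magnus_commutator that \<Gamma>_carrier by blast
    have "magnus n (commutator F h g) [] = 1"
      using \<mu>.hom_closed[of "commutator F h g"] that \<Gamma>_carrier by auto
    then show ?thesis
      using commutator_low[OF h g] step unfolding c by (auto simp: low_order_def)
  qed
  then have "magnus n ` ?C \<subseteq> low_order (Suc k)" by auto
  then have "generate magnus_group (magnus n ` ?C) \<subseteq> low_order (Suc k)"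
    using Mag.generate_subgroup_incl subgroup_low_order by simp
  moreover have "magnus n x \<in> generate magnus_group (magnus n ` ?C)"
    using step \<mu>.generate_img[OF C] by (auto simp: lower_central_Suc commutator_subgroup_eq)
  ultimately show ?case by blast
qed

text \<open>Taking leading coefficients is thus a homomorphism from \<Gamma>_k to an additive group,
  the substitute for the k-th graded piece.\<close>

lemma magnus_mult_lead:
  assumes "1 \<le> k" "x \<in> \<Gamma> k" "y \<in> \<Gamma> k" "length w = k"
  shows "magnus n (x \<otimes>\<^bsub>F\<^esub> y) w = magnus n x w + magnus n y w"
proof -
  have "w \<noteq> []" using assms by auto
  then show ?thesis
    using conv_low_add[OF magnus_\<Gamma> magnus_\<Gamma>, of k x y w] assms \<Gamma>_carrier \<mu>.hom_mult by auto
qed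

lemma magnus_inv_lead:
  assumes "1 \<le> k" "x \<in> \<Gamma> k" "length w = k"
  shows "magnus n (inv\<^bsub>F\<^esub> x) w = - magnus n x w"
proof -
  have "w \<noteq> []" using assms by auto
  then show ?thesis
    using inv_low[OF magnus_\<Gamma>, of k x w] assms \<Gamma>_carrier \<mu>.hom_inv by auto
qed

lemma magnus_commutator_lead:
  assumes "1 \<le> a" "1 \<le> b" "x \<in> \<Gamma> a" "y \<in> \<Gamma> b" "length w = a + b"
  shows "magnus n (commutator F x y) w
    = magnus n x (take a w) * magnus n y (drop a w) - magnus n y (take b w) * magnus n x (drop b w)"
proof -
  have "w \<noteq> []" using assms by auto
  then show ?thesis
    using commutator_low[OF magnus_\<Gamma> magnus_\<Gamma>, of a x b y w] magnus_commutator assms \<Gamma>_carrier by auto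
qed

lemma \<Gamma>_nat_pow: "x \<in> \<Gamma> k \<Longrightarrow> x [^]\<^bsub>F\<^esub> (m::nat) \<in> \<Gamma> k"
  by (induction m) (simp_all add: subgroup.one_closed[OF \<Gamma>_subgroup] subgroup.m_closed[OF \<Gamma>_subgroup])

lemma magnus_nat_pow_lead:
  assumes "1 \<le> k" "x \<in> \<Gamma> k" "length w = k"
  shows "magnus n (x [^]\<^bsub>F\<^esub> (m::nat)) w = int m * magnus n x w"
proof (induction m)
  case 0
  have "w \<noteq> []" using assms by auto
  then show ?case by (simp add: \<mu>.hom_one)
next
  case (Suc m)
  then show ?case
    using magnus_mult_lead[OF assms(1) \<Gamma>_nat_pow[OF assms(2)] assms(2,3), of m]
    by (simp add: algebra_simps)
qed

lemma magnus_int_pow_lead: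
  assumes "1 \<le> k" "x \<in> \<Gamma> k" "length w = k"
  shows "magnus n (x [^]\<^bsub>F\<^esub> (m::int)) w = m * magnus n x w"
proof (cases "m < 0")
  case True
  then have "x [^]\<^bsub>F\<^esub> m = inv\<^bsub>F\<^esub> (x [^]\<^bsub>F\<^esub> nat (- m))"
    by (simp only: int_pow_def2 if_True)
  then have "magnus n (x [^]\<^bsub>F\<^esub> m) w = - (int (nat (- m)) * magnus n x w)"
    by (simp only: magnus_inv_lead[OF assms(1) \<Gamma>_nat_pow[OF assms(2)] assms(3)] magnus_nat_pow_lead[OF assms])
  then show ?thesis
    using True by simp
next
  case False
  then have "x [^]\<^bsub>F\<^esub> m = x [^]\<^bsub>F\<^esub> nat m"
    by (simp only: int_pow_def2 if_False)
  then show ?thesis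
    using magnus_nat_pow_lead[OF assms, of "nat m"] False by simp
qed

end

section \<open>Basic commutators\<close>

datatype tree = Leaf nat | Node tree tree

primrec foliage :: "tree \<Rightarrow> nat list" where
  "foliage (Leaf i) = [i]"
| "foliage (Node s t) = foliage s @ foliage t"

text \<open>These are the Lyndon words, bracketed by their standard factorizations: the last condition makes
  \<open>foliage t\<close> the smallest proper suffix of the foliage of \<open>Node s t\<close>.\<close>

fun hall :: "tree \<Rightarrow> bool" where
  "hall (Leaf i) \<longleftrightarrow> True"
| "hall (Node (Leaf i) t) \<longleftrightarrow> hall t \<and> [i] < foliage t"
| "hall (Node (Node s s') t) \<longleftrightarrow> hall (Node s s') \<and> hall t \<and> foliage (Node s s') < foliage t \<and> foliage t \<le> foliage s'"

definition lyndon :: "nat list \<Rightarrow> bool" where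
  "lyndon w \<longleftrightarrow> w \<noteq> [] \<and> (\<forall>p q. w = p @ q \<longrightarrow> p \<noteq> [] \<longrightarrow> q \<noteq> [] \<longrightarrow> w < q)"

lemma foliage_neq_Nil [simp]: "foliage t \<noteq> []"
  by (induction t) auto

lemma hall_NodeD: "hall (Node s t) \<Longrightarrow> hall s \<and> hall t \<and> foliage s < foliage t"
  by (cases s) auto

section \<open>Lexicographic order and Lyndon words\<close>

lemma less_append: "(v::nat list) \<noteq> [] \<Longrightarrow> u < u @ v"
  by (induction u) (cases v; auto)+

lemma append_less_append [simp]: "(u @ v :: nat list) < u @ w \<longleftrightarrow> v < w"
  by (induction u) auto

text \<open>Either the words differ at some letter, and then no continuation of \<open>u\<close>
  matters, or \<open>u\<close> is a proper prefix of \<open>v\<close>.\<close>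

lemma less_append_cases:
  assumes "(u::nat list) < v"
  shows "u @ w < v \<or> (\<exists>z. z \<noteq> [] \<and> v = u @ z)"
  using assms
proof (induction u arbitrary: v)
  case Nil
  then show ?case by (cases v) auto
next
  case (Cons a u)
  then obtain b v' where v: "v = b # v'" by (cases v) auto
  show ?case
    using Cons.IH[of v'] Cons.prems by (auto simp: v)
qed

text \<open>Only the case q = p z needs an argument: a Lyndon word is below its suffix z, and
  prepending p to q < z gives p q < p z = q.\<close>

lemma lyndon_append_less:
  assumes "lyndon q" "p < q" "p \<noteq> []"
  shows "p @ q < q"
proof (rule ccontr)
  assume "\<not> p @ q < q"
  with less_append_cases[OF assms(2), of q] obtain z where z: "z \<noteq> []" "q = p @ z" by auto
  then have "q < z"
    using assms(1,3) by (auto simp: lyndon_def)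
  then have "p @ q < p @ z" by simp
  then show False using \<open>\<not> p @ q < q\<close> z by simp
qed

text \<open>The two claims need each other. A proper suffix of the whole word either lies in the
  right factor, which is Lyndon by induction, or has the form r @ foliage t with r a suffix of the
  left factor. Minimality of the right factor together with \<open>lyndon_append_less\<close> then
  makes the whole word Lyndon.\<close>

lemma hall_suffix:
  assumes "hall t"
  shows "lyndon (foliage t) \<and>
    (\<forall>s t'. t = Node s t' \<longrightarrow> (\<forall>p q. foliage t = p @ q \<longrightarrow> p \<noteq> [] \<longrightarrow> q \<noteq> [] \<longrightarrow> foliage t' \<le> q))"
  using assms
proof (induction t)
  case (Leaf i)
  then show ?case by (auto simp: lyndon_def Cons_eq_append_conv)
next
  case (Node s t)
  have st: "hall s" "hall t" "foliage s < foliage t" using hall_NodeD[OF Node.prems] by auto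
  have min: "foliage t \<le> q" if pq: "foliage (Node s t) = p @ q" "p \<noteq> []" "q \<noteq> []" for p q
  proof -
    from pq(1) obtain r where "foliage s @ r = p \<and> foliage t = r @ q \<or> foliage s = p @ r \<and> r @ foliage t = q"
      by (auto simp: append_eq_append_conv2)
    then show ?thesis
    proof
      assume r: "foliage s @ r = p \<and> foliage t = r @ q"
      then show ?thesis
        using Node.IH(2)[OF st(2)] pq by (cases "r = []") (auto simp: lyndon_def intro: less_imp_le)
    next
      assume r: "foliage s = p @ r \<and> r @ foliage t = q"
      show ?thesis
      proof (cases "r = []")
        case False
        \<comment> \<open>A leaf has no proper nonempty suffix, so \<open>s\<close> is a node. The
          last Hall condition then puts \<open>foliage t\<close> below the right factor
          \<open>b\<close> of \<open>s\<close>, which by induction is below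
          \<open>r\<close>.\<close>
        obtain a b where s: "s = Node a b"
          using r False pq by (cases s) (auto simp: Cons_eq_append_conv)
        then have "foliage t \<le> foliage b" using Node.prems by simp
        also have "foliage b \<le> r"
          using Node.IH(1)[OF st(1)] s r pq False by blast
        also have "r \<le> q"
          using less_append[of "foliage t" r] r by auto
        finally show ?thesis .
      qed (use r in auto)
    qed
  qed
  moreover have "foliage (Node s t) < foliage t"
    using lyndon_append_less Node.IH(2)[OF st(2)] st(3) by simp
  ultimately show ?case
    unfolding lyndon_def by (auto intro: less_le_trans)
qed

lemma hall_min_suffix:
  assumes "hall (Node s t)" "foliage s @ foliage t = p @ q" "p \<noteq> []" "q \<noteq> []"
  shows "foliage t \<le> q"
  using hall_suffix[OF assms(1), THEN conjunct2, rule_format, OF refl, of p q] assms by simp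

lemma hall_lyndon: "hall t \<Longrightarrow> lyndon (foliage t)"
  using hall_suffix by blast

lemma hall_append_less: "hall t \<Longrightarrow> foliage s < foliage t \<Longrightarrow> foliage s @ foliage t < foliage t"
  by (rule lyndon_append_less[OF hall_lyndon]) auto

text \<open>The bracketing is determined by the word because the right factor is its smallest proper
  suffix. This is needed where two basic commutators with equal words have to commute.\<close>

lemma foliage_inj: "hall s \<Longrightarrow> hall t \<Longrightarrow> foliage s = foliage t \<Longrightarrow> s = t"
proof (induction s arbitrary: t)
  case (Leaf i)
  then show ?case
    by (cases t) (auto simp: Cons_eq_append_conv)
next
  case (Node a b)
  show ?case
  proof (cases t)
    case (Leaf i)
    then show ?thesis using Node.prems(3) by (auto simp: append_eq_Cons_conv)
  next
    case t: (Node c d)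
    have eq: "foliage a @ foliage b = foliage c @ foliage d" using Node.prems(3) t by simp
    have "foliage b \<le> foliage d"
      by (rule hall_min_suffix[OF Node.prems(1) eq]) auto
    moreover have "foliage d \<le> foliage b"
      by (rule hall_min_suffix[OF Node.prems(2)[unfolded t] eq[symmetric]]) auto
    ultimately have bd: "foliage b = foliage d" by simp
    then have ac: "foliage a = foliage c" using eq by simp
    show ?thesis
      using Node.IH(1)[OF _ _ ac] Node.IH(2)[OF _ _ bd] hall_NodeD[OF Node.prems(1)]
        hall_NodeD[OF Node.prems(2)[unfolded t]] t by simp
  qed
qed

section \<open>Basic commutators in the free group and their leading words\<close>

context free_grp
begin

primrec basic :: "tree \<Rightarrow> letter list" where
  "basic (Leaf i) = gen i"
| "basic (Node s t) = commutator F (basic s) (basic t)"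

definition hall_trees :: "nat \<Rightarrow> tree set" where
  "hall_trees k = {t. hall t \<and> set (foliage t) \<subseteq> {1..n} \<and> length (foliage t) = k}"

text \<open>Including \<Gamma>_{k+1} turns congruences modulo \<Gamma>_{k+1} into memberships. The
  set \<open>W\<close> records which leading words may occur: an initial segment during rewriting, a
  finite set during elimination.\<close>

definition hall_span :: "nat \<Rightarrow> nat list set \<Rightarrow> letter list set" where
  "hall_span k W = generate F (\<Gamma> (Suc k) \<union> {basic t | t. t \<in> hall_trees k \<and> foliage t \<in> W})"

lemma hall_trees_length: "t \<in> hall_trees k \<Longrightarrow> 1 \<le> k"
  using foliage_neq_Nil[of t] by (cases k) (auto simp: hall_trees_def)

lemma hall_trees_Node:
  "Node s t \<in> hall_trees k \<Longrightarrow>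
    s \<in> hall_trees (length (foliage s)) \<and> t \<in> hall_trees (length (foliage t)) \<and> k = length (foliage s) + length (foliage t)"
  using hall_NodeD[of s t] by (auto simp: hall_trees_def)

lemma basic_\<Gamma>: "t \<in> hall_trees k \<Longrightarrow> basic t \<in> \<Gamma> k"
proof (induction t arbitrary: k)
  case (Leaf i)
  then have "k = Suc 0" "i \<in> {1..n}" by (auto simp: hall_trees_def)
  then show ?case using gen_closed[of i n] by simp
next
  case (Node s t)
  let ?a = "length (foliage s)" and ?b = "length (foliage t)"
  have s: "s \<in> hall_trees ?a" and t: "t \<in> hall_trees ?b" and k: "k = ?a + ?b"
    using hall_trees_Node[OF Node.prems] by auto
  show ?case
    using \<Gamma>_commutator[OF hall_trees_length[OF s] hall_trees_length[OF t] Node.IH(1)[OF s] Node.IH(2)[OF t]]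
    unfolding k by simp
qed

text \<open>The leading part of [s, t] is the difference of the products in both orders. At a word w
  not above \<open>foliage s @ foliage t\<close> the second product vanishes: the prefix of w that
  it evaluates at t is at most w, hence below \<open>foliage t\<close>.\<close>

lemma magnus_basic:
  assumes "t \<in> hall_trees k"
  shows "magnus n (basic t) (foliage t) = 1"
    and "length w = k \<Longrightarrow> w < foliage t \<Longrightarrow> magnus n (basic t) w = 0"
proof -
  have "magnus n (basic t) (foliage t) = 1 \<and> (\<forall>w. length w = k \<longrightarrow> w < foliage t \<longrightarrow> magnus n (basic t) w = 0)"
    using assms
  proof (induction t arbitrary: k)
    case (Leaf i)
    then have i: "k = Suc 0" "i \<in> {1..n}" by (auto simp: hall_trees_def)
    show ?case
      by (simp add: magnus_gen[OF i(2)] i(1))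
  next
    case (Node s t)
    define a where "a = length (foliage s)"
    define b where "b = length (foliage t)"
    note D = hall_trees_Node[OF Node.prems]
    have s: "s \<in> hall_trees a" and t: "t \<in> hall_trees b" and k: "k = a + b"
      using D by (auto simp: a_def b_def)
    have ab: "1 \<le> a" "1 \<le> b"
      by (rule hall_trees_length[OF s], rule hall_trees_length[OF t])
    have le: "take i w \<le> w" for i and w :: "nat list"
      using less_append[of "drop i w" "take i w"] by (cases "drop i w = []") simp_all
    have hs: "hall t" "foliage s < foliage t"
      using hall_NodeD[of s t] Node.prems by (auto simp: hall_trees_def)
    have lt: "foliage s @ foliage t < foliage t"
      using hall_append_less[OF hs] .
    have lead: "magnus n (basic (Node s t)) w =
        magnus n (basic s) (take a w) * magnus n (basic t) (drop a w)" if w: "length w = k" "w \<le> foliage s @ foliage t" for w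
    proof -
      have "magnus n (basic t) (take b w) = 0"
      proof -
        have "take b w < foliage t"
        proof (rule ccontr)
          assume "\<not> take b w < foliage t"
          then have "foliage t \<le> take b w" by simp
          also have "\<dots> \<le> w" by (rule le)
          also have "\<dots> < foliage t" using w(2) lt by simp
          finally show False by simp
        qed
        then show ?thesis using Node.IH(2)[OF t, THEN conjunct2, rule_format, of "take b w"] w(1) k by simp
      qed
      then show ?thesis
        using magnus_commutator_lead[OF ab basic_\<Gamma>[OF s] basic_\<Gamma>[OF t], of w] w k by simp
    qed
    show ?case
    proof (intro conjI allI impI)
      show "magnus n (basic (Node s t)) (foliage (Node s t)) = 1"
        using lead[of "foliage s @ foliage t"] Node.IH(1)[OF s] Node.IH(2)[OF t] k by (simp add: a_def b_def)
      fix w assume w: "length w = k" "w < foliage (Node s t)"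
      let ?u = "take a w" and ?v = "drop a w"
      have uv: "w = ?u @ ?v" "length ?u = a" "length ?v = b" using w k by auto
      \<comment> \<open>Cutting \<open>w\<close> into blocks of the lengths of the two factors, the
        first block that differs must be smaller; a first block above \<open>foliage s\<close> of
        equal length would already put \<open>w\<close> above the whole word.\<close>
      have "?u < foliage s \<or> ?u = foliage s \<and> ?v < foliage t"
      proof (rule ccontr)
        assume *: "\<not> (?u < foliage s \<or> ?u = foliage s \<and> ?v < foliage t)"
        show False
        proof (cases "?u = foliage s")
          case True
          then have "foliage s @ ?v < foliage s @ foliage t" using uv(1) w(2) by simp
          then show False using * True by simp
        next
          case False
          then have "foliage s < ?u" using * by auto
          then have "foliage s @ foliage t < ?u"
            using less_append_cases[of "foliage s" ?u "foliage t"] uv(2)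
            by (auto simp: a_def dest!: arg_cong[of _ _ length])
          also have "\<dots> \<le> w" by (rule le)
          finally show False using w by simp
        qed
      qed
      then have "magnus n (basic s) ?u = 0 \<or> magnus n (basic t) ?v = 0"
        using Node.IH(1)[OF s, THEN conjunct2, rule_format, of ?u] Node.IH(2)[OF t, THEN conjunct2, rule_format, of ?v] uv
        by blast
      then show "magnus n (basic (Node s t)) w = 0"
        using lead[of w] w by auto
    qed
  qed
  then show "magnus n (basic t) (foliage t) = 1"
    and "length w = k \<Longrightarrow> w < foliage t \<Longrightarrow> magnus n (basic t) w = 0" by auto
qed


section \<open>Rewriting commutators in terms of basic commutators\<close>

lemma hall_generators:
  "\<Gamma> (Suc k) \<union> {basic t | t. t \<in> hall_trees k \<and> foliage t \<in> W} \<subseteq> \<Gamma> k"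
  using \<Gamma>_Suc_subset basic_\<Gamma> by blast

lemma hall_span_subgroup: "subgroup (hall_span k W) F"
  and hall_span_\<Gamma>: "hall_span k W \<subseteq> \<Gamma> k"
  and \<Gamma>_hall_span: "\<Gamma> (Suc k) \<subseteq> hall_span k W"
proof -
  have "\<Gamma> (Suc k) \<union> {basic t | t. t \<in> hall_trees k \<and> foliage t \<in> W} \<subseteq> carrier F"
    using hall_generators[of k W] \<Gamma>_carrier by blast
  then show "subgroup (hall_span k W) F"
    unfolding hall_span_def by (rule generate_is_subgroup)
  show "hall_span k W \<subseteq> \<Gamma> k"
    unfolding hall_span_def by (rule generate_subgroup_incl[OF hall_generators \<Gamma>_subgroup])
  show "\<Gamma> (Suc k) \<subseteq> hall_span k W"
    unfolding hall_span_def by (auto intro: generate.incl)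
qed

lemma basic_hall_span: "t \<in> hall_trees k \<Longrightarrow> foliage t \<in> W \<Longrightarrow> basic t \<in> hall_span k W"
  unfolding hall_span_def by (auto intro: generate.incl)

lemma hall_span_mono: "W \<subseteq> W' \<Longrightarrow> hall_span k W \<subseteq> hall_span k W'"
  unfolding hall_span_def by (rule mono_generate) auto

text \<open>Any subgroup between \<Gamma>_{k+1} and \<Gamma>_k is normal, since conjugation
  multiplies an element of \<Gamma>_k by a commutator in \<Gamma>_{k+1}.\<close>

lemma hall_span_normal:
  assumes "1 \<le> k"
  shows "hall_span k W \<lhd> F"
  unfolding normal_inv_iff
proof (intro conjI ballI hall_span_subgroup)
  fix x h assume x: "x \<in> carrier F" and h: "h \<in> hall_span k W"
  have h': "h \<in> \<Gamma> k" "h \<in> carrier F"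
    using h hall_span_\<Gamma> \<Gamma>_carrier by blast+
  have "commutator F x h \<in> hall_span k W"
    using lower_central_commutator[OF assms x h'(1)] \<Gamma>_hall_span by blast
  then have "commutator F x h \<otimes>\<^bsub>F\<^esub> h \<in> hall_span k W"
    using h by (rule subgroup.m_closed[OF hall_span_subgroup])
  then show "x \<otimes>\<^bsub>F\<^esub> h \<otimes>\<^bsub>F\<^esub> inv\<^bsub>F\<^esub> x \<in> hall_span k W"
    using x h' by (simp add: commutator_def word_simps)
qed

text \<open>Reduces to the basic generators: those in \<Gamma>_{k+1} yield commutators in
  \<Gamma>_{i+k+1}, which every span of weight i + k contains.\<close>

lemma commutator_hall_span:
  assumes i: "1 \<le> i" and x: "x \<in> \<Gamma> i" and k: "1 \<le> k" and y: "y \<in> hall_span k W"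
    and basic: "\<And>t. t \<in> hall_trees k \<Longrightarrow> foliage t \<in> W \<Longrightarrow> commutator F x (basic t) \<in> hall_span (i + k) V"
  shows "commutator F x y \<in> hall_span (i + k) V"
proof (rule commutator_generate)
  show "x \<in> generate F {x}" by (simp add: generate.incl)
  show "y \<in> generate F (\<Gamma> (Suc k) \<union> {basic t | t. t \<in> hall_trees k \<and> foliage t \<in> W})"
    using y by (simp add: hall_span_def)
  show "hall_span (i + k) V \<lhd> F"
    using i by (intro hall_span_normal) simp
  show "{x} \<subseteq> carrier F" using x \<Gamma>_carrier by blast
  show "\<Gamma> (Suc k) \<union> {basic t | t. t \<in> hall_trees k \<and> foliage t \<in> W} \<subseteq> carrier F"
    using hall_generators[of k W] \<Gamma>_carrier by blast
  fix a b assume "a \<in> {x}" and b: "b \<in> \<Gamma> (Suc k) \<union> {basic t | t. t \<in> hall_trees k \<and> foliage t \<in> W}"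
  then have a: "a = x" by simp
  show "commutator F a b \<in> hall_span (i + k) V"
  proof (cases "b \<in> \<Gamma> (Suc k)")
    case True
    then have "commutator F x b \<in> \<Gamma> (i + Suc k)"
      by (intro \<Gamma>_commutator[OF i _ x]) simp
    then show ?thesis using \<Gamma>_hall_span[of "i + k" V] a by auto
  next
    case False
    then show ?thesis using b basic a by blast
  qed
qed

text \<open>The rank of a word among all words of bounded length makes the lexicographic order available
  for induction.\<close>

definition word_rank :: "nat \<Rightarrow> nat list \<Rightarrow> nat" where
  "word_rank N q = card {w. set w \<subseteq> {1..n} \<and> length w \<le> N \<and> w < q}"

lemma word_rank_less:
  assumes "t \<in> hall_trees k" "k \<le> N" "foliage t < q"
  shows "word_rank N (foliage t) < word_rank N q"
  unfolding word_rank_def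
proof (rule psubset_card_mono)
  have "finite {w::nat list. set w \<subseteq> {1..n} \<and> length w \<le> N}"
    by (rule finite_lists_length_le) simp
  then show "finite {w. set w \<subseteq> {1..n} \<and> length w \<le> N \<and> w < q}"
    by (rule rev_finite_subset) blast
  have "foliage t \<in> {w. set w \<subseteq> {1..n} \<and> length w \<le> N \<and> w < q}"
    using assms by (simp add: hall_trees_def)
  moreover have "{w. set w \<subseteq> {1..n} \<and> length w \<le> N \<and> w < foliage t} \<subseteq> {w. set w \<subseteq> {1..n} \<and> length w \<le> N \<and> w < q}"
    using assms(3) by (blast intro: less_trans)
  ultimately show "{w. set w \<subseteq> {1..n} \<and> length w \<le> N \<and> w < foliage t} \<subset> {w. set w \<subseteq> {1..n} \<and> length w \<le> N \<and> w < q}"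
    by (metis (no_types, lifting) less_irrefl mem_Collect_eq psubsetI)
qed

text \<open>If [s, t] is not basic itself, then s = [x, y] with y < t, and the Jacobi identity leads
  to [x, [t, y]] and [[t, x], y]. The inner brackets have smaller weight, so they expand into basic
  commutators below t. Bracketing these with x or y leaves both factors below t, where the induction
  on the rank of the larger factor applies. The bound \<open>{..<foliage t}\<close> is what makes
  this second induction possible.\<close>

lemma hall_commutator:
  assumes "s \<in> hall_trees a" "t \<in> hall_trees b" "foliage s < foliage t"
  shows "commutator F (basic s) (basic t) \<in> hall_span (a + b) {..<foliage t}"
  using assms
proof (induction "a + b" arbitrary: a b s t rule: less_induct)
  case (less a b s t)
  note outer = less.hyps
  define N where "N = a + b"
  have "commutator F (basic s) (basic t) \<in> hall_span (a + b) {..<foliage t}"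
    if "s \<in> hall_trees a" "t \<in> hall_trees b" "foliage s < foliage t" "a + b = N" for a b s t
    using that
  proof (induction "word_rank N (foliage t)" arbitrary: a b s t rule: less_induct)
    case (less t a b s)
    note inner = less.hyps and st = less.prems
    let ?q = "foliage t"
    have ab: "1 \<le> a" "1 \<le> b"
      by (rule hall_trees_length[OF st(1)], rule hall_trees_length[OF st(2)])
    show ?case
    proof (cases "hall (Node s t)")
      case True
      then have Nst: "Node s t \<in> hall_trees (a + b)"
        using st by (simp add: hall_trees_def)
      have "foliage (Node s t) < ?q"
        using hall_append_less[of t s] st by (simp add: hall_trees_def)
      then show ?thesis
        using basic_hall_span[OF Nst, of "{..<?q}"] by simp
    next
      case False
      have "hall s" "hall t" using st by (simp_all add: hall_trees_def)
      \<comment> \<open>With s below t only the last Hall condition can fail, and it is imposed only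
        when the left factor is a node.\<close>
      with False st(3) obtain x y where s: "s = Node x y" and yq: "foliage y < ?q"
        by (cases s) auto
      let ?c = "length (foliage x)" and ?d = "length (foliage y)"
      have x: "x \<in> hall_trees ?c" and y: "y \<in> hall_trees ?d" and a: "a = ?c + ?d"
        using hall_trees_Node[of x y a] st(1) s by auto
      have cd: "1 \<le> ?c" "1 \<le> ?d"
        by (rule hall_trees_length[OF x], rule hall_trees_length[OF y])
      have xq: "foliage x < ?q"
        using less_append[OF foliage_neq_Nil, of "foliage x" y] st(3) s by simp
      let ?H = "hall_span (a + b) {..<?q}"
      note bx = basic_\<Gamma>[OF x] and byy = basic_\<Gamma>[OF y] and bt = basic_\<Gamma>[OF st(2)]
      have carr: "basic x \<in> carrier F" "basic y \<in> carrier F" "basic t \<in> carrier F"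
        using bx byy bt \<Gamma>_carrier by auto
      \<comment> \<open>Both factors are now below \<open>?q\<close>; swapping them if necessary,
        the larger one has smaller rank and the inner hypothesis applies.\<close>
      have claim: "commutator F (basic e) g \<in> ?H"
        if e: "e \<in> hall_trees i" "foliage e < ?q" and g: "g \<in> hall_span j {..<?q}" and ij: "i + j = a + b" "1 \<le> j"
        for e g i j
        unfolding ij(1)[symmetric]
      proof (rule commutator_hall_span[OF hall_trees_length[OF e(1)] basic_\<Gamma>[OF e(1)] ij(2) g])
        fix u assume u: "u \<in> hall_trees j" "foliage u \<in> {..<?q}"
        have ce: "basic e \<in> carrier F" "basic u \<in> carrier F"
          using basic_\<Gamma>[OF e(1)] basic_\<Gamma>[OF u(1)] \<Gamma>_carrier by auto
        consider "foliage e < foliage u" | "foliage u < foliage e" | "foliage e = foliage u"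
          by (metis linorder_cases)
        then show "commutator F (basic e) (basic u) \<in> hall_span (i + j) {..<?q}"
        proof cases
          case 1
          have "word_rank N (foliage u) < word_rank N ?q"
            using word_rank_less[OF u(1), of N ?q] u(2) ij st(4) by simp
          then have "commutator F (basic e) (basic u) \<in> hall_span (i + j) {..<foliage u}"
            using inner[OF _ e(1) u(1) 1] ij st(4) by simp
          moreover have "{..<foliage u} \<subseteq> {..<?q}" using u(2) by auto
          ultimately show ?thesis
            using hall_span_mono by blast
        next
          case 2
          have "word_rank N (foliage e) < word_rank N ?q"
            using word_rank_less[OF e(1), of N ?q] e(2) ij st(4) by simp
          then have "commutator F (basic u) (basic e) \<in> hall_span (i + j) {..<foliage e}"
            using inner[OF _ u(1) e(1) 2] ij st(4) by (simp add: add.commute)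
          moreover have "{..<foliage e} \<subseteq> {..<?q}" using e(2) by auto
          ultimately have "commutator F (basic u) (basic e) \<in> hall_span (i + j) {..<?q}"
            using hall_span_mono by blast
          then show ?thesis
            by (rule commutator_swap[OF hall_span_subgroup ce(2,1)])
        next
          case 3
          then have "e = u"
            using foliage_inj e(1) u(1) by (simp add: hall_trees_def)
          then have "commutator F (basic e) (basic u) = \<one>\<^bsub>F\<^esub>"
            using ce by (simp add: commutator_eq_one_iff)
          then show ?thesis
            using subgroup.one_closed[OF hall_span_subgroup] by simp
        qed
      qed
      have "commutator F (basic y) (basic t) \<in> hall_span (?d + b) {..<?q}"
        using outer[of ?d b y t] y st(2) yq cd a st(4) by (simp add: N_def)
      then have 1: "commutator F (basic t) (basic y) \<in> hall_span (?d + b) {..<?q}"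
        by (rule commutator_swap[OF hall_span_subgroup carr(2,3)])
      have "commutator F (basic x) (basic t) \<in> hall_span (?c + b) {..<?q}"
        using outer[of ?c b x t] x st(2) xq cd a st(4) by (simp add: N_def)
      then have 2: "commutator F (basic t) (basic x) \<in> hall_span (?c + b) {..<?q}"
        by (rule commutator_swap[OF hall_span_subgroup carr(1,3)])
      have "commutator F (basic t) (commutator F (basic x) (basic y)) \<in> ?H"
      proof (rule \<Gamma>_jacobi[OF cd ab(2) bx byy bt hall_span_subgroup])
        show "\<Gamma> (Suc (?c + ?d + b)) \<subseteq> ?H"
          using \<Gamma>_hall_span[of "a + b" "{..<?q}"] a by simp
        show "commutator F (basic x) (commutator F (basic t) (basic y)) \<in> ?H"
          by (rule claim[OF x xq 1]) (use a cd in simp_all)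
        have "commutator F (basic y) (commutator F (basic t) (basic x)) \<in> ?H"
          by (rule claim[OF y yq 2]) (use a cd in simp_all)
        then show "commutator F (commutator F (basic t) (basic x)) (basic y) \<in> ?H"
          by (rule commutator_swap[OF hall_span_subgroup, rotated 2]) (use carr in auto)
      qed
      then have "commutator F (commutator F (basic x) (basic y)) (basic t) \<in> ?H"
        by (rule commutator_swap[OF hall_span_subgroup, rotated 2]) (use carr in auto)
      then show ?thesis by (simp add: s)
    qed
  qed
  then show ?case using less.prems N_def by blast
qed

text \<open>\<Gamma>_{k+1} is generated by commutators of F with \<Gamma>_k. It suffices to treat a
  generator of F against a basic commutator, and a generator is itself basic of weight 1, so
  \<open>hall_commutator\<close> applies up to order.\<close>

lemma hall_span_UNIV: "1 \<le> k \<Longrightarrow> hall_span k UNIV = \<Gamma> k"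
proof (induction k rule: dec_induct)
  case base
  have "gen i \<in> hall_span 1 UNIV" if "i \<in> {1..n}" for i
    using basic_hall_span[of "Leaf i" 1 UNIV] that by (simp add: hall_trees_def)
  then have "generate F (gen ` {1..n}) \<subseteq> hall_span 1 UNIV"
    by (intro generate_subgroup_incl hall_span_subgroup) auto
  then show ?case
    using hall_span_\<Gamma>[of 1 UNIV] generate_gen by auto
next
  case (step k)
  have sk: "hall_span (Suc k) UNIV \<lhd> F" by (rule hall_span_normal) simp
  have "commutator F x y \<in> hall_span (Suc k) UNIV" if x: "x \<in> carrier F" and y: "y \<in> \<Gamma> k" for x y
  proof (rule commutator_generate[OF sk])
    show "x \<in> generate F (gen ` {1..n})" using x generate_gen by simp
    show "y \<in> generate F (\<Gamma> k)" using y by (rule generate.incl)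
    show "gen ` {1..n} \<subseteq> carrier F" using gen_closed by blast
    show "\<Gamma> k \<subseteq> carrier F" using \<Gamma>_carrier by blast
    fix c d assume "c \<in> gen ` {1..n}" and d: "d \<in> \<Gamma> k"
    then obtain i where i: "i \<in> {1..n}" and c: "c = basic (Leaf i)" by auto
    have Li: "Leaf i \<in> hall_trees 1" using i by (simp add: hall_trees_def)
    have d': "d \<in> hall_span k UNIV" using d step by simp
    have "commutator F (basic (Leaf i)) d \<in> hall_span (1 + k) UNIV"
    proof (rule commutator_hall_span[OF _ basic_\<Gamma>[OF Li] step(1) d'])
      fix t assume t: "t \<in> hall_trees k"
      have carr: "basic (Leaf i) \<in> carrier F" "basic t \<in> carrier F"
        using basic_\<Gamma>[OF Li] basic_\<Gamma>[OF t] \<Gamma>_carrier by auto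
      consider "foliage (Leaf i) < foliage t" | "foliage t < foliage (Leaf i)" | "foliage (Leaf i) = foliage t"
        by (metis linorder_cases)
      then show "commutator F (basic (Leaf i)) (basic t) \<in> hall_span (1 + k) UNIV"
      proof cases
        case 1
        show ?thesis
          using hall_commutator[OF Li t 1] hall_span_mono[OF subset_UNIV] by blast
      next
        case 2
        have "commutator F (basic t) (basic (Leaf i)) \<in> hall_span (1 + k) UNIV"
          using hall_commutator[OF t Li 2] hall_span_mono[OF subset_UNIV] unfolding add.commute[of 1 k] by blast
        then show ?thesis
          by (rule commutator_swap[OF hall_span_subgroup carr(2,1)])
      next
        case 3
        then have "t = Leaf i"
          using foliage_inj[of "Leaf i" t] t by (simp add: hall_trees_def)
        then have "commutator F (basic (Leaf i)) (basic t) = \<one>\<^bsub>F\<^esub>"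
          using carr by (simp add: commutator_eq_one_iff)
        then show ?thesis
          using subgroup.one_closed[OF hall_span_subgroup] by simp
      qed
    qed simp
    then show "commutator F c d \<in> hall_span (Suc k) UNIV" by (simp add: c)
  qed
  then have "{commutator F x y |x y. x \<in> carrier F \<and> y \<in> \<Gamma> k} \<subseteq> hall_span (Suc k) UNIV"
    by blast
  then have "generate F {commutator F x y |x y. x \<in> carrier F \<and> y \<in> \<Gamma> k} \<subseteq> hall_span (Suc k) UNIV"
    by (rule generate_subgroup_incl[OF _ hall_span_subgroup])
  then show ?case
    using hall_span_\<Gamma>[of "Suc k" UNIV] step(1) by (simp add: lower_central_Suc commutator_subgroup_eq)
qed

lemma magnus_zero_subgroup:
  assumes "1 \<le> length w"
  shows "subgroup {g \<in> \<Gamma> (length w). magnus n g w = 0} F"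
proof (rule subgroupI)
  show "{g \<in> \<Gamma> (length w). magnus n g w = 0} \<noteq> {}"
  proof -
    have "\<one>\<^bsub>F\<^esub> \<in> \<Gamma> (length w)" by (rule subgroup.one_closed[OF \<Gamma>_subgroup])
    moreover have "magnus n \<one>\<^bsub>F\<^esub> w = 0" using assms by (auto simp: \<mu>.hom_one)
    ultimately show ?thesis by blast
  qed
  fix x y assume x: "x \<in> {g \<in> \<Gamma> (length w). magnus n g w = 0}"
  then show "inv\<^bsub>F\<^esub> x \<in> {g \<in> \<Gamma> (length w). magnus n g w = 0}"
    using magnus_inv_lead[OF assms _ refl, of x] subgroup.m_inv_closed[OF \<Gamma>_subgroup] by simp
  assume "y \<in> {g \<in> \<Gamma> (length w). magnus n g w = 0}"
  then show "x \<otimes>\<^bsub>F\<^esub> y \<in> {g \<in> \<Gamma> (length w). magnus n g w = 0}"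
    using x magnus_mult_lead[OF assms _ _ refl, of x y] subgroup.m_closed[OF \<Gamma>_subgroup] by simp
qed (use \<Gamma>_carrier in blast)

text \<open>Unitriangular elimination, adding words to \<open>V\<close> in decreasing order. The new
  word b is smaller than all earlier ones, so among the available basic commutators only the one
  with word b has a nonzero coefficient at b, and that coefficient is 1.\<close>

lemma hall_span_magnus_zero:
  assumes "1 \<le> k" "finite V" "V \<subseteq> {w. length w = k}" "x \<in> hall_span k V" "\<And>w. length w = k \<Longrightarrow> magnus n x w = 0"
  shows "x \<in> \<Gamma> (Suc k)"
  using assms(2-)
proof (induction V arbitrary: x rule: finite_linorder_min_induct)
  case empty
  have "hall_span k {} \<subseteq> \<Gamma> (Suc k)"
    unfolding hall_span_def by (rule generate_subgroup_incl[OF _ \<Gamma>_subgroup]) simp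
  then show ?case using empty by blast
next
  case (insert b A)
  have b: "length b = k" using insert.prems by simp
  show ?case
  proof (cases "\<exists>t\<in>hall_trees k. foliage t = b")
    case False
    then have "hall_span k (insert b A) = hall_span k A"
      unfolding hall_span_def by (intro arg_cong[of _ _ "generate F"]) auto
    then show ?thesis using insert by simp
  next
    case True
    then obtain t where t: "t \<in> hall_trees k" "foliage t = b" by blast
    let ?P = "basic t" and ?H = "hall_span k A"
    have P: "?P \<in> \<Gamma> k" "?P \<in> carrier F" using basic_\<Gamma>[OF t(1)] \<Gamma>_carrier by auto
    have Pb: "magnus n ?P b = 1" using magnus_basic(1)[OF t(1)] t(2) by simp
    have H0: "magnus n h b = 0" if "h \<in> ?H" for h
    proof -
      have "\<Gamma> (Suc k) \<union> {basic u | u. u \<in> hall_trees k \<and> foliage u \<in> A} \<subseteq> {g \<in> \<Gamma> (length b). magnus n g b = 0}"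
      proof
        fix g assume g: "g \<in> \<Gamma> (Suc k) \<union> {basic u | u. u \<in> hall_trees k \<and> foliage u \<in> A}"
        have "magnus n g b = 0"
        proof (cases "g \<in> \<Gamma> (Suc k)")
          case True
          show ?thesis
            by (rule low_orderD[OF magnus_\<Gamma>[OF _ True]]) (use b assms(1) in auto)
        next
          case False
          then obtain u where u: "g = basic u" "u \<in> hall_trees k" "foliage u \<in> A" using g by blast
          then show ?thesis using magnus_basic(2)[OF u(2) b] insert.hyps(2) by simp
        qed
        then show "g \<in> {g \<in> \<Gamma> (length b). magnus n g b = 0}"
          using g hall_generators[of k A] b by blast
      qed
      then have "?H \<subseteq> {g \<in> \<Gamma> (length b). magnus n g b = 0}"
        unfolding hall_span_def by (rule generate_subgroup_incl) (use b assms(1) in \<open>intro magnus_zero_subgroup, simp\<close>)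
      then show ?thesis using that by blast
    qed
    have sub: "subgroup (?H <#>\<^bsub>F\<^esub> generate F {?P}) F"
      by (rule mult_norm_subgroup[OF hall_span_normal[OF assms(1)] generate_is_subgroup]) (use P in simp)
    have "\<Gamma> (Suc k) \<union> {basic u | u. u \<in> hall_trees k \<and> foliage u \<in> insert b A} \<subseteq> ?H <#>\<^bsub>F\<^esub> generate F {?P}"
    proof
      fix g assume g: "g \<in> \<Gamma> (Suc k) \<union> {basic u | u. u \<in> hall_trees k \<and> foliage u \<in> insert b A}"
      then have gF: "g \<in> carrier F"
        using hall_generators[of k "insert b A"] \<Gamma>_carrier by blast
      have "g \<in> ?H \<or> g = ?P"
      proof (cases "g \<in> \<Gamma> (Suc k)")
        case True
        then show ?thesis using \<Gamma>_hall_span by blast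
      next
        case False
        then obtain u where u: "g = basic u" "u \<in> hall_trees k" "foliage u \<in> insert b A" using g by blast
        show ?thesis
        proof (cases "foliage u = b")
          case True
          then have "u = t" using foliage_inj[of u t] u(2) t by (simp add: hall_trees_def)
          then show ?thesis using u by simp
        next
          case False
          then show ?thesis using u basic_hall_span[of u k A] by simp
        qed
      qed
      then show "g \<in> ?H <#>\<^bsub>F\<^esub> generate F {?P}"
      proof
        assume "g \<in> ?H"
        then have "g \<otimes>\<^bsub>F\<^esub> \<one>\<^bsub>F\<^esub> \<in> ?H <#>\<^bsub>F\<^esub> generate F {?P}"
          unfolding set_mult_def using generate.one by blast
        then show ?thesis using gF by simp
      next
        assume "g = ?P"
        then have "\<one>\<^bsub>F\<^esub> \<otimes>\<^bsub>F\<^esub> g \<in> ?H <#>\<^bsub>F\<^esub> generate F {?P}"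
          unfolding set_mult_def using generate.incl[of ?P "{?P}"] subgroup.one_closed[OF hall_span_subgroup] by blast
        then show ?thesis using gF by simp
      qed
    qed
    then have "hall_span k (insert b A) \<subseteq> ?H <#>\<^bsub>F\<^esub> generate F {?P}"
      unfolding hall_span_def[of k "insert b A"] by (rule generate_subgroup_incl[OF _ sub])
    then obtain h z where h: "h \<in> ?H" and x: "x = h \<otimes>\<^bsub>F\<^esub> (?P [^]\<^bsub>F\<^esub> (z::int))"
      using insert.prems(2) unfolding set_mult_def generate_pow[OF P(2)] by blast
    have hk: "h \<in> \<Gamma> k" using h hall_span_\<Gamma> by blast
    \<comment> \<open>The exponent of the new basic commutator is thus visible as a coefficient, and
      the hypothesis makes it 0.\<close>
    have "magnus n x b = z"
      unfolding x using magnus_mult_lead[OF assms(1) hk subgroup_int_pow_closed[OF \<Gamma>_subgroup P(1), of z] b]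
        magnus_int_pow_lead[OF assms(1) P(1) b, of z] H0[OF h] Pb by simp
    then have "z = 0" using insert.prems(3) b by simp
    then have "x = h" using x hk \<Gamma>_carrier by simp
    then show ?thesis
      using insert.IH[of x] insert.prems h by simp
  qed
qed

lemma magnus_lead_zero:
  assumes "1 \<le> k" "x \<in> \<Gamma> k" "\<And>w. length w = k \<Longrightarrow> magnus n x w = 0"
  shows "x \<in> \<Gamma> (Suc k)"
proof -
  \<comment> \<open>Hall trees of \<open>hall_trees k\<close> only use letters up to
    \<open>n\<close>, so all words may be replaced by a finite set, as the elimination
    requires.\<close>
  let ?V = "{w. set w \<subseteq> {1..n} \<and> length w = k}"
  have "hall_span k UNIV = hall_span k ?V"
    unfolding hall_span_def by (intro arg_cong[of _ _ "generate F"]) (auto simp: hall_trees_def)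
  then have "x \<in> hall_span k ?V" using hall_span_UNIV[OF assms(1)] assms(2) by simp
  moreover have "finite ?V" by (rule finite_lists_length_eq) simp
  ultimately show ?thesis
    using hall_span_magnus_zero[OF assms(1), of ?V x] assms(3) by auto
qed


section \<open>Elements commuting with a generator modulo the lower central series\<close>

lemma magnus_replicate_zero:
  assumes "2 \<le> k" "x \<in> \<Gamma> k"
  shows "magnus n x (replicate k i) = 0"
proof -
  obtain j where k: "k = Suc j" and j: "1 \<le> j" using assms(1) by (cases k) auto
  let ?w = "replicate k i"
  have "{commutator F h g |h g. h \<in> carrier F \<and> g \<in> \<Gamma> j} \<subseteq> {g \<in> \<Gamma> (length ?w). magnus n g ?w = 0}"
  proof
    fix c assume "c \<in> {commutator F h g |h g. h \<in> carrier F \<and> g \<in> \<Gamma> j}"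
    then obtain h g where c: "c = commutator F h g" and h: "h \<in> \<Gamma> 1" and g: "g \<in> \<Gamma> j" by auto
    \<comment> \<open>All blocks of a power of one letter are powers of that letter, so both orders
      of the product give the same number.\<close>
    have "magnus n c ?w = 0"
      using magnus_commutator_lead[OF _ j h g, of ?w] by (simp add: c k mult.commute del: replicate_Suc)
    moreover have "c \<in> \<Gamma> k"
      using lower_central_commutator[OF j _ g, of h] h by (simp add: c k)
    ultimately show "c \<in> {g \<in> \<Gamma> (length ?w). magnus n g ?w = 0}" by simp
  qed
  then have "generate F {commutator F h g |h g. h \<in> carrier F \<and> g \<in> \<Gamma> j} \<subseteq> {g \<in> \<Gamma> (length ?w). magnus n g ?w = 0}"
    by (rule generate_subgroup_incl) (use k in \<open>intro magnus_zero_subgroup, simp\<close>)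
  then show ?thesis
    using assms(2) unfolding k lower_central_Suc[OF j] commutator_subgroup_eq by auto
qed

lemma not_replicate_cases:
  assumes "v \<noteq> replicate (length v) i"
  obtains u p m where "v = u @ [p] @ replicate m i" "p \<noteq> i"
proof -
  have "v = replicate (length v) i \<or> (\<exists>u p m. v = u @ [p] @ replicate m i \<and> p \<noteq> i)"
  proof (induction v rule: rev_induct)
    case (snoc y v)
    show ?case
    proof (cases "y = i")
      case False
      then have "v @ [y] = v @ [y] @ replicate 0 i \<and> y \<noteq> i" by simp
      then show ?thesis by blast
    next
      case True
      from snoc show ?thesis
      proof
        assume "v = replicate (length v) i"
        then have "v @ [y] = replicate (length (v @ [y])) i"
          using True by (metis length_append_singleton replicate_Suc replicate_append_same)
        then show ?thesis by blast
      next
        assume "\<exists>u p m. v = u @ [p] @ replicate m i \<and> p \<noteq> i"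
        then obtain u p m where "v = u @ [p] @ replicate m i" "p \<noteq> i" by blast
        then have "v @ [y] = u @ [p] @ replicate (Suc m) i \<and> p \<noteq> i"
          using True by (simp add: replicate_append_same)
        then show ?thesis by blast
      qed
    qed
  qed simp
  then show thesis using assms that by blast
qed

text \<open>If the leading part of \<^term>\<open>x\<close> commutes with the variable \<^term>\<open>i\<close>, its coefficients are
  invariant under moving a final letter \<^term>\<open>i\<close> to the front, and vanish at words not ending in \<^term>\<open>i\<close>.\<close>

lemma magnus_commuting_lead:
  assumes i: "i \<in> {1..n}" and j: "1 \<le> j" and x: "x \<in> \<Gamma> j"
    and c: "commutator F x (gen i) \<in> \<Gamma> (Suc (Suc j))"
    and v: "length v = j" "v \<noteq> replicate j i"
  shows "magnus n x v = 0"
proof -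
  have g: "gen i \<in> \<Gamma> 1" using gen_closed[OF i] by simp
  \<comment> \<open>The leading part of [x, x_i] vanishes, so left and right multiplication of the
    leading part of \<open>x\<close> by X_i agree coefficientwise.\<close>
  have eq: "magnus n x (take j w) * magnus n (gen i) (drop j w) = magnus n (gen i) (take 1 w) * magnus n x (drop 1 w)"
    if w: "length w = Suc j" for w
  proof -
    have "magnus n (commutator F x (gen i)) w = 0"
      by (rule low_orderD[OF magnus_\<Gamma>[OF _ c]]) (use w in auto)
    then show ?thesis
      using magnus_commutator_lead[OF j _ x g, of w] w by simp
  qed
  obtain u p m where upm: "v = u @ [p] @ replicate m i" and p: "p \<noteq> i"
    using not_replicate_cases[of v i] v by auto
  have "magnus n x (u @ [p] @ replicate m i) = 0" if "length (u @ [p] @ replicate m i) = j" for u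
    using that
  proof (induction m arbitrary: u)
    case 0
    then have "j = Suc (length u)" by simp
    \<comment> \<open>At i # u @ [p] the last letter is not i, which makes the left product 0, while
      the right product is the coefficient at u @ [p].\<close>
    then show ?case
      using eq[of "i # u @ [p]"] p by (simp add: magnus_gen[OF i])
  next
    case (Suc m)
    define y where "y = i # u @ [p] @ replicate m i"
    have y: "length y = j" "u @ [p] @ replicate (Suc m) i = tl y @ [i]"
      using Suc.prems by (simp_all add: y_def replicate_append_same)
    have "magnus n x (tl y @ [i]) = magnus n x y"
      using eq[of "y @ [i]"] y(1) by (simp add: magnus_gen[OF i]) (simp add: y_def)
    then have "magnus n x (u @ [p] @ replicate (Suc m) i) = magnus n x ((i # u) @ [p] @ replicate m i)"
      unfolding y(2) by (simp add: y_def)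
    then show ?case
      using Suc.IH[of "i # u"] Suc.prems by simp
  qed
  then show ?thesis using v upm by simp
qed

text \<open>The exponent is found in degree 1 and stays fixed afterwards: in degree j \<ge> 2 the
  leading part is a multiple of X_i^j, and elements of \<Gamma>_j have coefficient 0 there.
  Multiplying \<open>w\<close> by a power of x_i does not change its commutator with x_i.\<close>

lemma centralizer_gen:
  assumes i: "i \<in> {1..n}" and "1 \<le> j" and w: "w \<in> carrier F"
    and "commutator F w (gen i) \<in> \<Gamma> (Suc j)"
  shows "\<exists>a::int. w \<otimes>\<^bsub>F\<^esub> (gen i [^]\<^bsub>F\<^esub> a) \<in> \<Gamma> j"
  using assms(2,4)
proof (induction j rule: dec_induct)
  case base
  have "w \<otimes>\<^bsub>F\<^esub> (gen i [^]\<^bsub>F\<^esub> (0::int)) \<in> \<Gamma> 1"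
    using w gen_closed[OF i] by simp
  then show ?case by blast
next
  case (step j)
  let ?x = "gen i"
  have x: "?x \<in> carrier F" by (rule gen_closed[OF i])
  obtain a :: int where a: "w \<otimes>\<^bsub>F\<^esub> (?x [^]\<^bsub>F\<^esub> a) \<in> \<Gamma> j"
    using step.IH step.prems \<Gamma>_Suc_subset by blast
  define v where "v = w \<otimes>\<^bsub>F\<^esub> (?x [^]\<^bsub>F\<^esub> a)"
  have v: "v \<in> \<Gamma> j" "v \<in> carrier F" using a \<Gamma>_carrier by (auto simp: v_def)
  have "?x [^]\<^bsub>F\<^esub> a \<otimes>\<^bsub>F\<^esub> ?x = ?x \<otimes>\<^bsub>F\<^esub> ?x [^]\<^bsub>F\<^esub> a"
    using int_pow_mult[OF x, of a 1] int_pow_mult[OF x, of 1 a] x by (simp add: int_pow_1 add.commute)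
  then have "commutator F (?x [^]\<^bsub>F\<^esub> a) ?x = \<one>\<^bsub>F\<^esub>"
    using x by (simp add: commutator_eq_one_iff)
  then have "commutator F v ?x = commutator F w ?x"
    using commutator_mult_left[OF w, of "?x [^]\<^bsub>F\<^esub> a" ?x] x w by (simp add: v_def)
  then have c: "commutator F v ?x \<in> \<Gamma> (Suc (Suc j))" using step.prems by simp
  note zero = magnus_commuting_lead[OF i step(1) v(1) c]
  show ?case
  proof (cases "j = 1")
    case False
    have "magnus n v u = 0" if "length u = j" for u
      using zero[OF that] magnus_replicate_zero[of j v i] v step(1) False by (cases "u = replicate j i") auto
    then have "v \<in> \<Gamma> (Suc j)"
      by (rule magnus_lead_zero[OF step(1) v(1)])
    then show ?thesis by (auto simp: v_def)
  next
    case True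
    \<comment> \<open>This exponent cancels the coefficient at X_i, the only one left in degree
      1.\<close>
    define b where "b = - magnus n v [i]"
    have g: "?x \<in> \<Gamma> j" using x True by simp
    have xb: "?x [^]\<^bsub>F\<^esub> b \<in> \<Gamma> j" by (rule subgroup_int_pow_closed[OF \<Gamma>_subgroup g])
    have "magnus n (v \<otimes>\<^bsub>F\<^esub> ?x [^]\<^bsub>F\<^esub> b) u = 0" if u: "length u = j" for u
    proof -
      have "magnus n (v \<otimes>\<^bsub>F\<^esub> ?x [^]\<^bsub>F\<^esub> b) u = magnus n v u + b * magnus n ?x u"
        using magnus_mult_lead[OF step(1) v(1) xb u] magnus_int_pow_lead[OF step(1) g u, of b] by simp
      then show ?thesis
        using zero[OF u] True u by (cases "u = [i]") (auto simp: magnus_gen[OF i] b_def)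
    qed
    then have "v \<otimes>\<^bsub>F\<^esub> ?x [^]\<^bsub>F\<^esub> b \<in> \<Gamma> (Suc j)"
      by (rule magnus_lead_zero[OF step(1) subgroup.m_closed[OF \<Gamma>_subgroup v(1) xb]])
    moreover have "v \<otimes>\<^bsub>F\<^esub> ?x [^]\<^bsub>F\<^esub> b = w \<otimes>\<^bsub>F\<^esub> ?x [^]\<^bsub>F\<^esub> (a + b)"
      using x w int_pow_mult[OF x, of a b] by (simp add: v_def m_assoc)
    ultimately show ?thesis by (metis)
  qed
qed

end

section \<open>The Andreadakis filtration\<close>

context free_grp
begin

sublocale Aut: group "Aut_free n"
  by (rule AutoGroup)

lemma aut_hom: "\<phi> \<in> carrier (Aut_free n) \<Longrightarrow> \<phi> \<in> hom F F"
  and aut_extensional: "\<phi> \<in> carrier (Aut_free n) \<Longrightarrow> \<phi> \<in> extensional (carrier F)"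
  by (auto simp: AutoGroup_def auto_def Bij_def)

lemma autI: "\<phi> \<in> hom F F \<Longrightarrow> bij_betw \<phi> (carrier F) (carrier F) \<Longrightarrow> \<phi> \<in> extensional (carrier F) \<Longrightarrow>
    \<phi> \<in> carrier (Aut_free n)"
  by (auto simp: AutoGroup_def auto_def Bij_def)

lemma aut_closed: "\<phi> \<in> carrier (Aut_free n) \<Longrightarrow> x \<in> carrier F \<Longrightarrow> \<phi> x \<in> carrier F"
  by (rule hom_in_carrier[OF aut_hom])

lemma aut_hom_mult:
  "\<phi> \<in> carrier (Aut_free n) \<Longrightarrow> x \<in> carrier F \<Longrightarrow> y \<in> carrier F \<Longrightarrow> \<phi> (x \<otimes>\<^bsub>F\<^esub> y) = \<phi> x \<otimes>\<^bsub>F\<^esub> \<phi> y"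
  by (rule hom_mult[OF aut_hom])

lemma aut_hom_inv:
  assumes "\<phi> \<in> carrier (Aut_free n)" "x \<in> carrier F"
  shows "\<phi> (inv\<^bsub>F\<^esub> x) = inv\<^bsub>F\<^esub> (\<phi> x)"
proof -
  interpret \<phi>: group_hom F F \<phi> using aut_hom[OF assms(1)] by unfold_locales
  show ?thesis using assms(2) by simp
qed

lemma aut_mult [simp]:
  "\<phi> \<in> carrier (Aut_free n) \<Longrightarrow> \<psi> \<in> carrier (Aut_free n) \<Longrightarrow> x \<in> carrier F \<Longrightarrow>
    (\<phi> \<otimes>\<^bsub>Aut_free n\<^esub> \<psi>) x = \<phi> (\<psi> x)"
  by (simp add: AutoGroup_def BijGroup_def auto_def compose_def)

lemma aut_one [simp]: "x \<in> carrier F \<Longrightarrow> \<one>\<^bsub>Aut_free n\<^esub> x = x"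
  by (simp add: AutoGroup_def BijGroup_def)

lemma aut_inv [simp]:
  assumes "\<phi> \<in> carrier (Aut_free n)" "x \<in> carrier F"
  shows "(inv\<^bsub>Aut_free n\<^esub> \<phi>) (\<phi> x) = x" "\<phi> ((inv\<^bsub>Aut_free n\<^esub> \<phi>) x) = x"
  using aut_mult[of "inv\<^bsub>Aut_free n\<^esub> \<phi>" \<phi> x] aut_mult[of \<phi> "inv\<^bsub>Aut_free n\<^esub> \<phi>" x] assms by simp_all

lemma aut_eqI:
  assumes "\<phi> \<in> carrier (Aut_free n)" "\<psi> \<in> carrier (Aut_free n)" "\<And>x. x \<in> carrier F \<Longrightarrow> \<phi> x = \<psi> x"
  shows "\<phi> = \<psi>"
  by (rule extensionalityI[OF aut_extensional[OF assms(1)] aut_extensional[OF assms(2)]]) (rule assms(3))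

lemma aut_\<Gamma>: "\<phi> \<in> carrier (Aut_free n) \<Longrightarrow> x \<in> \<Gamma> i \<Longrightarrow> \<phi> x \<in> \<Gamma> i"
  by (rule lower_central_hom[OF is_group aut_hom subgroup_self subgroup_self]) (auto simp: aut_closed)

text \<open>The elements that \<open>h\<close> moves only by a factor in the normal subgroup
  \<open>N\<close> form a subgroup; conjugation by elements of F and by their images is where
  normality enters.\<close>

lemma hom_displacement_generate:
  assumes h: "h \<in> hom F F" and N: "N \<lhd> F" and C: "C \<subseteq> carrier F"
    and gens: "\<And>c. c \<in> C \<Longrightarrow> h c \<otimes>\<^bsub>F\<^esub> inv\<^bsub>F\<^esub> c \<in> N" and x: "x \<in> generate F C"
  shows "h x \<otimes>\<^bsub>F\<^esub> inv\<^bsub>F\<^esub> x \<in> N"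
  using x
proof (induction x rule: generate.induct)
  interpret h: group_hom F F h using h by unfold_locales
  interpret N: normal N F by fact
  {
    case one
    then show ?case by simp
  next
    case (incl c)
    then show ?case by (rule gens)
  next
    case (inv c)
    then have c: "c \<in> carrier F" "h c \<in> carrier F" using C by auto
    have "inv\<^bsub>F\<^esub> (h c \<otimes>\<^bsub>F\<^esub> inv\<^bsub>F\<^esub> c) \<in> N" using gens[OF inv] by simp
    from N.inv_op_closed1[OF c(1) this] show ?case
      using c by (simp add: word_simps)
  next
    case (eng a b)
    have ab: "a \<in> carrier F" "b \<in> carrier F" using eng generate_in_carrier[OF C] by auto
    have "h a \<otimes>\<^bsub>F\<^esub> (h b \<otimes>\<^bsub>F\<^esub> inv\<^bsub>F\<^esub> b) \<otimes>\<^bsub>F\<^esub> inv\<^bsub>F\<^esub> (h a) \<in> N"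
      using N.inv_op_closed2[OF h.hom_closed[OF ab(1)] eng.IH(2)] .
    from N.m_closed[OF this eng.IH(1)] show ?case
      using ab h.hom_closed[OF ab(1)] h.hom_closed[OF ab(2)] by (simp add: word_simps)
  }
qed

abbreviation "A_filt j \<equiv> andreadakis_filtration n j"

lemma A_filt_carrier: "\<phi> \<in> A_filt j \<Longrightarrow> \<phi> \<in> carrier (Aut_free n)"
  by (simp add: andreadakis_filtration_def)

lemma A_filtD: "\<phi> \<in> A_filt j \<Longrightarrow> 1 \<le> i \<Longrightarrow> g \<in> \<Gamma> i \<Longrightarrow> \<phi> g \<otimes>\<^bsub>F\<^esub> inv\<^bsub>F\<^esub> g \<in> \<Gamma> (i + j)"
  by (simp add: andreadakis_filtration_def)

lemma A_filt_1D: "\<phi> \<in> A_filt 1 \<Longrightarrow> x \<in> carrier F \<Longrightarrow> \<phi> x \<otimes>\<^bsub>F\<^esub> inv\<^bsub>F\<^esub> x \<in> \<Gamma> 2"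
  using A_filtD[of \<phi> 1 1 x] by (simp add: numeral_2_eq_2)

lemma A_filtI:
  "\<phi> \<in> carrier (Aut_free n) \<Longrightarrow> (\<And>i g. 1 \<le> i \<Longrightarrow> g \<in> \<Gamma> i \<Longrightarrow> \<phi> g \<otimes>\<^bsub>F\<^esub> inv\<^bsub>F\<^esub> g \<in> \<Gamma> (i + j)) \<Longrightarrow> \<phi> \<in> A_filt j"
  by (simp add: andreadakis_filtration_def)

lemma A_filt_subgroup: "subgroup (A_filt j) (Aut_free n)"
proof (rule Aut.subgroupI)
  show "A_filt j \<subseteq> carrier (Aut_free n)" using A_filt_carrier by blast
  have "\<one>\<^bsub>Aut_free n\<^esub> \<in> A_filt j"
    by (rule A_filtI) (simp_all add: \<Gamma>_carrier subgroup.one_closed[OF \<Gamma>_subgroup])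
  then show "A_filt j \<noteq> {}" by blast
next
  fix \<phi> assume \<phi>: "\<phi> \<in> A_filt j"
  note c = A_filt_carrier[OF \<phi>]
  let ?\<psi> = "inv\<^bsub>Aut_free n\<^esub> \<phi>"
  have c': "?\<psi> \<in> carrier (Aut_free n)" using c by simp
  show "?\<psi> \<in> A_filt j"
  proof (rule A_filtI[OF c'])
    fix i g assume i: "1 \<le> i" and g: "g \<in> \<Gamma> i"
    have gF: "g \<in> carrier F" "\<phi> g \<in> carrier F" using g \<Gamma>_carrier aut_closed[OF c] by auto
    \<comment> \<open>Applying the inverse automorphism to the displacement of g under \<phi> gives
      the inverse of the displacement of g under \<open>?\<psi>\<close>.\<close>
    have "inv\<^bsub>F\<^esub> (?\<psi> (\<phi> g \<otimes>\<^bsub>F\<^esub> inv\<^bsub>F\<^esub> g)) \<in> \<Gamma> (i + j)"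
      by (rule subgroup.m_inv_closed[OF \<Gamma>_subgroup aut_\<Gamma>[OF c' A_filtD[OF \<phi> i g]]])
    then show "?\<psi> g \<otimes>\<^bsub>F\<^esub> inv\<^bsub>F\<^esub> g \<in> \<Gamma> (i + j)"
      using gF c c' aut_closed[OF c' gF(1)]
      by (simp add: aut_hom_mult aut_hom_inv word_simps)
  qed
next
  fix \<phi> \<psi> assume \<phi>: "\<phi> \<in> A_filt j" and \<psi>: "\<psi> \<in> A_filt j"
  note c = A_filt_carrier[OF \<phi>] A_filt_carrier[OF \<psi>]
  show "\<phi> \<otimes>\<^bsub>Aut_free n\<^esub> \<psi> \<in> A_filt j"
  proof (rule A_filtI)
    fix i g assume i: "1 \<le> i" and g: "g \<in> \<Gamma> i"
    have gF: "g \<in> carrier F" using g \<Gamma>_carrier by auto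
    note cl = gF aut_closed[OF c(1) gF] aut_closed[OF c(2) gF] aut_closed[OF c(1) aut_closed[OF c(2) gF]]
    have "\<phi> (\<psi> g \<otimes>\<^bsub>F\<^esub> inv\<^bsub>F\<^esub> g) \<otimes>\<^bsub>F\<^esub> (\<phi> g \<otimes>\<^bsub>F\<^esub> inv\<^bsub>F\<^esub> g) \<in> \<Gamma> (i + j)"
      by (rule subgroup.m_closed[OF \<Gamma>_subgroup aut_\<Gamma>[OF c(1) A_filtD[OF \<psi> i g]] A_filtD[OF \<phi> i g]])
    then show "(\<phi> \<otimes>\<^bsub>Aut_free n\<^esub> \<psi>) g \<otimes>\<^bsub>F\<^esub> inv\<^bsub>F\<^esub> g \<in> \<Gamma> (i + j)"
      using cl c by (simp add: aut_hom_mult aut_hom_inv word_simps)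
  qed (use c in simp)
qed

text \<open>At g = \<psi>(\<phi>(k)) the commutator takes the value \<phi>(\<psi>(k)). With
  \<phi>(k) = a k and \<psi>(k) = b k these two are b' b a k and a' a b k, so the displacement is b'
  [b, a] a'^-1, and each factor is deep enough.\<close>

lemma A_filt_commutator:
  assumes \<phi>: "\<phi> \<in> A_filt 1" and \<psi>: "\<psi> \<in> A_filt j"
  shows "commutator (Aut_free n) \<phi> \<psi> \<in> A_filt (Suc j)"
proof (rule A_filtI)
  note c = A_filt_carrier[OF \<phi>] A_filt_carrier[OF \<psi>]
  show "commutator (Aut_free n) \<phi> \<psi> \<in> carrier (Aut_free n)"
    using c by (rule Aut.commutator_closed)
  fix i g assume i: "1 \<le> i" and g: "g \<in> \<Gamma> i"
  \<comment> \<open>Substituting k for g removes the inverse automorphisms from the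
    computation.\<close>
  let ?\<theta> = "inv\<^bsub>Aut_free n\<^esub> (\<psi> \<otimes>\<^bsub>Aut_free n\<^esub> \<phi>)"
  define k where "k = ?\<theta> g"
  have k: "k \<in> \<Gamma> i" unfolding k_def by (rule aut_\<Gamma>[OF _ g]) (use c in simp)
  have [simp]: "g \<in> carrier F" "k \<in> carrier F" using g k \<Gamma>_carrier by auto
  have gk: "\<psi> (\<phi> k) = g"
  proof -
    have "(\<psi> \<otimes>\<^bsub>Aut_free n\<^esub> \<phi>) k = g"
      unfolding k_def by (rule aut_inv(2)) (use c in simp_all)
    then show ?thesis using c by simp
  qed
  have "commutator (Aut_free n) \<phi> \<psi> = (\<phi> \<otimes>\<^bsub>Aut_free n\<^esub> \<psi>) \<otimes>\<^bsub>Aut_free n\<^esub> ?\<theta>"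
    using c by (simp add: commutator_def Aut.word_simps)
  then have val: "commutator (Aut_free n) \<phi> \<psi> g = \<phi> (\<psi> k)"
    using c \<open>k \<in> carrier F\<close> by (simp add: k_def)
  define a where "a = \<phi> k \<otimes>\<^bsub>F\<^esub> inv\<^bsub>F\<^esub> k"
  define b where "b = \<psi> k \<otimes>\<^bsub>F\<^esub> inv\<^bsub>F\<^esub> k"
  have a: "a \<in> \<Gamma> (i + 1)" and b: "b \<in> \<Gamma> (i + j)"
    using A_filtD[OF \<phi> i k] A_filtD[OF \<psi> i k] by (simp_all add: a_def b_def)
  have [simp]: "a \<in> carrier F" "b \<in> carrier F" using a b \<Gamma>_carrier by auto
  have \<phi>k: "\<phi> k = a \<otimes>\<^bsub>F\<^esub> k" and \<psi>k: "\<psi> k = b \<otimes>\<^bsub>F\<^esub> k"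
    using c aut_closed by (simp_all add: a_def b_def word_simps)
  define a' where "a' = \<psi> a \<otimes>\<^bsub>F\<^esub> inv\<^bsub>F\<^esub> a"
  define b' where "b' = \<phi> b \<otimes>\<^bsub>F\<^esub> inv\<^bsub>F\<^esub> b"
  have a': "a' \<in> \<Gamma> (i + Suc j)" and b': "b' \<in> \<Gamma> (i + Suc j)"
    using A_filtD[OF \<psi> _ a] A_filtD[OF \<phi> _ b] i by (simp_all add: a'_def b'_def)
  have [simp]: "a' \<in> carrier F" "b' \<in> carrier F" using a' b' \<Gamma>_carrier by auto
  have \<psi>a: "\<psi> a = a' \<otimes>\<^bsub>F\<^esub> a" and \<phi>b: "\<phi> b = b' \<otimes>\<^bsub>F\<^esub> b"
    using c aut_closed by (simp_all add: a'_def b'_def word_simps)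
  have 1: "\<phi> (\<psi> k) = b' \<otimes>\<^bsub>F\<^esub> b \<otimes>\<^bsub>F\<^esub> (a \<otimes>\<^bsub>F\<^esub> k)"
    using c by (simp add: \<psi>k aut_hom_mult \<phi>b \<phi>k)
  have 2: "g = a' \<otimes>\<^bsub>F\<^esub> a \<otimes>\<^bsub>F\<^esub> (b \<otimes>\<^bsub>F\<^esub> k)"
    using c gk by (simp add: \<phi>k aut_hom_mult \<psi>a \<psi>k)
  have "commutator F b a \<in> \<Gamma> (i + j + (i + 1))"
    by (rule \<Gamma>_commutator[OF _ _ b a]) (use i in simp_all)
  then have "commutator F b a \<in> \<Gamma> (i + Suc j)"
    using \<Gamma>_antimono[of "i + Suc j" "i + j + (i + 1)"] by auto
  then have "b' \<otimes>\<^bsub>F\<^esub> commutator F b a \<otimes>\<^bsub>F\<^esub> inv\<^bsub>F\<^esub> a' \<in> \<Gamma> (i + Suc j)"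
    using a' b' by (simp add: subgroup.m_closed[OF \<Gamma>_subgroup] subgroup.m_inv_closed[OF \<Gamma>_subgroup] del: add_Suc_right)
  moreover have "\<phi> (\<psi> k) \<otimes>\<^bsub>F\<^esub> inv\<^bsub>F\<^esub> g = b' \<otimes>\<^bsub>F\<^esub> commutator F b a \<otimes>\<^bsub>F\<^esub> inv\<^bsub>F\<^esub> a'"
    unfolding 1 2 by (simp add: commutator_def word_simps)
  ultimately show "commutator (Aut_free n) \<phi> \<psi> g \<otimes>\<^bsub>F\<^esub> inv\<^bsub>F\<^esub> g \<in> \<Gamma> (i + Suc j)"
    by (simp add: val)
qed

text \<open>Trivial action on the abelianization forces trivial action on every \<Gamma>_i /
  \<Gamma>_{i+1}: a generator [h, k] goes to [h a, k b] with a in \<Gamma>_2 and b in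
  \<Gamma>_{i+1}, and these corrections disappear modulo \<Gamma>_{i+2}.\<close>

lemma A_filt_1I:
  assumes \<phi>: "\<phi> \<in> carrier (Aut_free n)" and gens: "\<And>i. i \<in> {1..n} \<Longrightarrow> \<phi> (gen i) \<otimes>\<^bsub>F\<^esub> inv\<^bsub>F\<^esub> (gen i) \<in> \<Gamma> 2"
  shows "\<phi> \<in> A_filt 1"
proof (rule A_filtI[OF \<phi>])
  have disp: "\<phi> h \<otimes>\<^bsub>F\<^esub> inv\<^bsub>F\<^esub> h \<in> \<Gamma> 2" if "h \<in> carrier F" for h
  proof (rule hom_displacement_generate[OF aut_hom[OF \<phi>] \<Gamma>_normal])
    show "h \<in> generate F (gen ` {1..n})" using that by (simp add: generate_gen del: One_nat_def)
  qed (use gens gen_closed in auto)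
  fix i g assume "1 \<le> i" "g \<in> \<Gamma> i"
  then show "\<phi> g \<otimes>\<^bsub>F\<^esub> inv\<^bsub>F\<^esub> g \<in> \<Gamma> (i + 1)"
  proof (induction i arbitrary: g rule: dec_induct)
    case base
    then show ?case using disp by (simp add: numeral_2_eq_2)
  next
    case (step i)
    let ?N = "\<Gamma> (Suc i + 1)"
    interpret N: normal ?N F by (rule \<Gamma>_normal)
    interpret Q: group "F Mod ?N" by (rule N.factorgroup_is_group)
    interpret \<pi>: group_hom F "F Mod ?N" "\<lambda>x. ?N #>\<^bsub>F\<^esub> x"
      using N.r_coset_hom_Mod by unfold_locales
    have D: "\<phi> x \<otimes>\<^bsub>F\<^esub> inv\<^bsub>F\<^esub> x \<in> ?N" if "x \<in> {commutator F h k |h k. h \<in> carrier F \<and> k \<in> \<Gamma> i}" for x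
    proof -
      from that obtain h k where x: "x = commutator F h k" and h: "h \<in> \<Gamma> 1" and k: "k \<in> \<Gamma> i" by auto
      have [simp]: "h \<in> carrier F" "k \<in> carrier F" using h k \<Gamma>_carrier by auto
      have [simp]: "\<phi> h \<in> carrier F" "\<phi> k \<in> carrier F" using aut_closed[OF \<phi>] by auto
      define a where "a = inv\<^bsub>F\<^esub> h \<otimes>\<^bsub>F\<^esub> \<phi> h"
      define b where "b = inv\<^bsub>F\<^esub> k \<otimes>\<^bsub>F\<^esub> \<phi> k"
      have "\<phi> h \<otimes>\<^bsub>F\<^esub> inv\<^bsub>F\<^esub> h \<in> \<Gamma> 2" by (rule disp) simp
      then have a: "a \<in> \<Gamma> 2"
        using normal.inv_op_closed1[OF \<Gamma>_normal, of h "\<phi> h \<otimes>\<^bsub>F\<^esub> inv\<^bsub>F\<^esub> h" 2] by (simp add: a_def word_simps)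
      have b: "b \<in> \<Gamma> (i + 1)"
        using normal.inv_op_closed1[OF \<Gamma>_normal, of k "\<phi> k \<otimes>\<^bsub>F\<^esub> inv\<^bsub>F\<^esub> k" "i + 1"] step.IH[OF k]
        by (simp add: b_def word_simps)
      have [simp]: "a \<in> carrier F" "b \<in> carrier F" by (simp_all add: a_def b_def)
      have hk: "\<phi> h = h \<otimes>\<^bsub>F\<^esub> a" "\<phi> k = k \<otimes>\<^bsub>F\<^esub> b"
        by (simp_all add: a_def b_def word_simps)
      have "\<phi> x = commutator F (h \<otimes>\<^bsub>F\<^esub> a) (k \<otimes>\<^bsub>F\<^esub> b)"
        unfolding x hk[symmetric] using \<phi> by (simp add: commutator_def aut_hom_mult aut_hom_inv)
      then have "?N #>\<^bsub>F\<^esub> \<phi> x = commutator (F Mod ?N) ((?N #>\<^bsub>F\<^esub> h) \<otimes>\<^bsub>F Mod ?N\<^esub> (?N #>\<^bsub>F\<^esub> a)) ((?N #>\<^bsub>F\<^esub> k) \<otimes>\<^bsub>F Mod ?N\<^esub> (?N #>\<^bsub>F\<^esub> b))"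
        by (simp add: Mod_commutator[OF \<Gamma>_normal] Mod_mult[OF \<Gamma>_normal] del: mult_FactGroup \<pi>.hom_mult)
      also have "\<dots> = commutator (F Mod ?N) (?N #>\<^bsub>F\<^esub> h) (?N #>\<^bsub>F\<^esub> k)"
      proof (rule Q.commutator_perturb)
        show "(?N #>\<^bsub>F\<^esub> h) \<otimes>\<^bsub>F Mod ?N\<^esub> (?N #>\<^bsub>F\<^esub> b) = (?N #>\<^bsub>F\<^esub> b) \<otimes>\<^bsub>F Mod ?N\<^esub> (?N #>\<^bsub>F\<^esub> h)"
          by (rule \<Gamma>_commute_mod[OF _ _ h b]) simp_all
        show "(?N #>\<^bsub>F\<^esub> a) \<otimes>\<^bsub>F Mod ?N\<^esub> (?N #>\<^bsub>F\<^esub> b) = (?N #>\<^bsub>F\<^esub> b) \<otimes>\<^bsub>F Mod ?N\<^esub> (?N #>\<^bsub>F\<^esub> a)"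
          by (rule \<Gamma>_commute_mod[OF _ _ a b]) simp_all
        show "(?N #>\<^bsub>F\<^esub> k) \<otimes>\<^bsub>F Mod ?N\<^esub> (?N #>\<^bsub>F\<^esub> b) = (?N #>\<^bsub>F\<^esub> b) \<otimes>\<^bsub>F Mod ?N\<^esub> (?N #>\<^bsub>F\<^esub> k)"
          by (rule \<Gamma>_commute_mod[OF step(1) _ k b]) (use step(1) in simp_all)
        show "(?N #>\<^bsub>F\<^esub> a) \<otimes>\<^bsub>F Mod ?N\<^esub> (?N #>\<^bsub>F\<^esub> k) = (?N #>\<^bsub>F\<^esub> k) \<otimes>\<^bsub>F Mod ?N\<^esub> (?N #>\<^bsub>F\<^esub> a)"
          by (rule \<Gamma>_commute_mod[OF _ step(1) a k]) simp_all
      qed (rule \<pi>.hom_closed, simp)+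
      also have "\<dots> = ?N #>\<^bsub>F\<^esub> x"
        by (simp add: x Mod_commutator[OF \<Gamma>_normal] del: mult_FactGroup)
      finally show ?thesis
        by (rule r_coset_eqD[OF \<Gamma>_normal, rotated 2]) (simp_all add: x aut_closed[OF \<phi>])
    qed
    let ?C = "{commutator F h k |h k. h \<in> carrier F \<and> k \<in> \<Gamma> i}"
    show ?case
    proof (rule hom_displacement_generate[where h = \<phi> and C = ?C])
      show "?C \<subseteq> carrier F"
        using \<Gamma>_carrier by auto
      show "g \<in> generate F ?C"
        using step.prems step.hyps(1) by (simp only: lower_central_Suc commutator_subgroup_eq)
      show "\<phi> \<in> hom F F" by (rule aut_hom[OF \<phi>])
    qed (rule \<Gamma>_normal, rule D)
  qed
qed

lemma derived_eq: "derived F (carrier F) = \<Gamma> 2"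
proof -
  have "(\<Union>h\<in>carrier F. \<Union>k\<in>carrier F. {h \<otimes>\<^bsub>F\<^esub> k \<otimes>\<^bsub>F\<^esub> inv\<^bsub>F\<^esub> h \<otimes>\<^bsub>F\<^esub> inv\<^bsub>F\<^esub> k})
      = {commutator F h k | h k. h \<in> carrier F \<and> k \<in> carrier F}"
    by (auto simp: commutator_def)
  then show ?thesis
    by (simp add: derived_def numeral_2_eq_2 lower_central_Suc commutator_subgroup_eq)
qed

text \<open>Puts \<open>IA n\<close> inside the filtration, so that \<Gamma>_j(IA_n) can be bounded
  by the commutator estimate.\<close>

lemma IA_eq: "IA n = A_filt 1"
proof
  show "IA n \<subseteq> A_filt 1"
  proof
    fix \<phi> assume \<phi>: "\<phi> \<in> IA n"
    show "\<phi> \<in> A_filt 1"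
    proof (rule A_filt_1I)
      show c: "\<phi> \<in> carrier (Aut_free n)" using \<phi> by (simp add: IA_def)
      fix i assume i: "i \<in> {1..n}"
      note x = gen_closed[OF i]
      have "\<Gamma> 2 #>\<^bsub>F\<^esub> gen i \<in> carrier (F Mod \<Gamma> 2)" using x by (auto simp: carrier_FactGroup)
      then have "\<phi> ` (\<Gamma> 2 #>\<^bsub>F\<^esub> gen i) = \<Gamma> 2 #>\<^bsub>F\<^esub> gen i"
        using \<phi> by (simp add: IA_def derived_eq)
      then have "\<phi> (gen i) \<in> \<Gamma> 2 #>\<^bsub>F\<^esub> gen i"
        using rcos_self[OF x \<Gamma>_subgroup[of 2]] by blast
      then show "\<phi> (gen i) \<otimes>\<^bsub>F\<^esub> inv\<^bsub>F\<^esub> (gen i) \<in> \<Gamma> 2"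
        using subgroup.rcos_module[OF \<Gamma>_subgroup[of 2] is_group x aut_closed[OF c x]] by simp
    qed
  qed
  show "A_filt 1 \<subseteq> IA n"
  proof
    fix \<phi> assume \<phi>: "\<phi> \<in> A_filt 1"
    have sub: "\<psi> ` (\<Gamma> 2 #>\<^bsub>F\<^esub> x) \<subseteq> \<Gamma> 2 #>\<^bsub>F\<^esub> x" if \<psi>: "\<psi> \<in> A_filt 1" and x: "x \<in> carrier F" for \<psi> x
    proof
      note c = A_filt_carrier[OF \<psi>]
      fix z assume "z \<in> \<psi> ` (\<Gamma> 2 #>\<^bsub>F\<^esub> x)"
      then obtain d where d: "d \<in> \<Gamma> 2" and z: "z = \<psi> (d \<otimes>\<^bsub>F\<^esub> x)" by (auto simp: r_coset_def)
      note cl = x aut_closed[OF c x] \<Gamma>_carrier[OF d] aut_closed[OF c \<Gamma>_carrier[OF d]]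
      have "\<psi> d \<otimes>\<^bsub>F\<^esub> (\<psi> x \<otimes>\<^bsub>F\<^esub> inv\<^bsub>F\<^esub> x) \<in> \<Gamma> 2"
        by (rule subgroup.m_closed[OF \<Gamma>_subgroup aut_\<Gamma>[OF c d] A_filt_1D[OF \<psi> x]])
      moreover have "z = \<psi> d \<otimes>\<^bsub>F\<^esub> (\<psi> x \<otimes>\<^bsub>F\<^esub> inv\<^bsub>F\<^esub> x) \<otimes>\<^bsub>F\<^esub> x"
        using cl c by (simp add: z aut_hom_mult word_simps)
      ultimately show "z \<in> \<Gamma> 2 #>\<^bsub>F\<^esub> x" unfolding r_coset_def by blast
    qed
    have "\<phi> ` C = C" if "C \<in> carrier (F Mod \<Gamma> 2)" for C
    proof -
      from that obtain x where x: "C = \<Gamma> 2 #>\<^bsub>F\<^esub> x" "x \<in> carrier F"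
        unfolding carrier_FactGroup by (rule imageE)
      have CF: "C \<subseteq> carrier F" using r_coset_subset_G[OF subgroup.subset[OF \<Gamma>_subgroup[of 2]] x(2)] x(1) by simp
      have sub': "(inv\<^bsub>Aut_free n\<^esub> \<phi>) ` C \<subseteq> C"
        unfolding x(1) by (rule sub[OF subgroup.m_inv_closed[OF A_filt_subgroup \<phi>] x(2)])
      \<comment> \<open>Each coset must be hit entirely; the inverse lies in the same filtration
        term and maps the coset into itself.\<close>
      have "C \<subseteq> \<phi> ` C"
      proof
        fix y assume y: "y \<in> C"
        then have "(inv\<^bsub>Aut_free n\<^esub> \<phi>) y \<in> C" using sub' by blast
        moreover have "y = \<phi> ((inv\<^bsub>Aut_free n\<^esub> \<phi>) y)"
          using aut_inv(2)[OF A_filt_carrier[OF \<phi>]] y CF by auto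
        ultimately show "y \<in> \<phi> ` C" by (rule rev_image_eqI)
      qed
      then show ?thesis using sub[OF \<phi> x(2)] x(1) by blast
    qed
    then show "\<phi> \<in> IA n"
      using A_filt_carrier[OF \<phi>] by (simp add: IA_def derived_eq)
  qed
qed

lemma lower_central_IA: "1 \<le> j \<Longrightarrow> lower_central (Aut_free n) (IA n) j \<subseteq> A_filt j"
proof (induction j rule: dec_induct)
  case (step j)
  have "{commutator (Aut_free n) h k |h k. h \<in> IA n \<and> k \<in> lower_central (Aut_free n) (IA n) j} \<subseteq> A_filt (Suc j)"
  proof clarify
    fix h k assume "h \<in> IA n" "k \<in> lower_central (Aut_free n) (IA n) j"
    then have "h \<in> A_filt 1" "k \<in> A_filt j"
      using step.IH by (auto simp only: IA_eq)
    then show "commutator (Aut_free n) h k \<in> A_filt (Suc j)"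
      by (rule A_filt_commutator)
  qed
  from Aut.generate_subgroup_incl[OF this A_filt_subgroup] show ?case
    using step.hyps(1) by (simp only: lower_central_Suc commutator_subgroup_eq)
qed (simp add: IA_eq)

end

section \<open>Triangular automorphisms\<close>

context free_grp
begin

lemma hom_eq_generate:
  assumes h: "h \<in> hom F F" and k: "k \<in> hom F F" and C: "C \<subseteq> carrier F"
    and eq: "\<And>c. c \<in> C \<Longrightarrow> h c = k c" and x: "x \<in> generate F C"
  shows "h x = k x"
proof -
  interpret h: group_hom F F h using h by unfold_locales
  interpret k: group_hom F F k using k by unfold_locales
  from x show ?thesis
  proof (induction x rule: generate.induct)
    case (inv c)
    then have "c \<in> carrier F" using C by auto
    then show ?case using eq[OF inv] by simp
  next
    case (eng a b)
    then have "a \<in> carrier F" "b \<in> carrier F" using generate_in_carrier[OF C] by auto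
    then show ?case using eng by simp
  qed (simp_all add: eq)
qed

lemma hom_eq_carrier:
  assumes "h \<in> hom F F" "k \<in> hom F F" "\<And>i. i \<in> {1..n} \<Longrightarrow> h (gen i) = k (gen i)" "x \<in> carrier F"
  shows "h x = k x"
proof (rule hom_eq_generate[OF assms(1,2), of "gen ` {1..n}"])
  show "x \<in> generate F (gen ` {1..n})" using assms(4) unfolding generate_gen .
qed (use gen_closed assms(3) in auto)

lemma id_hom: "(\<lambda>x. x) \<in> hom F F"
  by (simp add: hom_def)

lemma comp_hom: "h \<in> hom F F \<Longrightarrow> k \<in> hom F F \<Longrightarrow> (\<lambda>x. h (k x)) \<in> hom F F"
  by (auto simp: hom_def Pi_iff)

section \<open>The subgroups F_{m-1}, retractions onto them, and elementary automorphisms\<close>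

lemma gens_below_subset: "m \<le> Suc n \<Longrightarrow> gen ` {1..<m} \<subseteq> carrier F"
  by (rule image_subsetI) (rule gen_closed, auto)

lemma gens_below_subgroup: "m \<le> Suc n \<Longrightarrow> subgroup (gens_below n m) F"
  unfolding gens_below_def by (rule generate_is_subgroup[OF gens_below_subset])

lemma gens_below_carrier: "m \<le> Suc n \<Longrightarrow> x \<in> gens_below n m \<Longrightarrow> x \<in> carrier F"
  by (rule subgroup.mem_carrier[OF gens_below_subgroup])

lemma gens_below_mono: "m \<le> m' \<Longrightarrow> gens_below n m \<subseteq> gens_below n m'"
  unfolding gens_below_def by (rule mono_generate) auto

lemma gen_gens_below: "i \<in> {1..<m} \<Longrightarrow> gen i \<in> gens_below n m"
  unfolding gens_below_def by (rule generate.incl) (rule imageI)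

text \<open>The restriction is there because elements of \<open>AutoGroup\<close> are extensional
  functions; it lets automorphisms be compared on the carrier alone.\<close>

definition endo :: "(nat \<Rightarrow> letter list) \<Rightarrow> letter list \<Rightarrow> letter list" where
  "endo f = restrict (SOME h. h \<in> hom F F \<and> (\<forall>i\<in>{1..n}. h (gen i) = f i)) (carrier F)"

lemma endo_hom: "f \<in> {1..n} \<rightarrow> carrier F \<Longrightarrow> endo f \<in> hom F F"
  and endo_gen: "f \<in> {1..n} \<rightarrow> carrier F \<Longrightarrow> i \<in> {1..n} \<Longrightarrow> endo f (gen i) = f i"
proof -
  assume f: "f \<in> {1..n} \<rightarrow> carrier F"
  define h where "h = (SOME h. h \<in> hom F F \<and> (\<forall>i\<in>{1..n}. h (gen i) = f i))"
  have "\<exists>h. h \<in> hom F F \<and> (\<forall>i\<in>{1..n}. h (gen i) = f i)"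
    using free_group_extension[OF is_group f] by (simp add: Bex_def)
  from someI_ex[OF this] have h: "h \<in> hom F F" "\<forall>i\<in>{1..n}. h (gen i) = f i"
    unfolding h_def by blast+
  have e: "endo f = restrict h (carrier F)" by (simp add: endo_def h_def)
  show "endo f \<in> hom F F"
    using h(1) unfolding e by (auto simp: hom_def)
  show "endo f (gen i) = f i" if "i \<in> {1..n}"
    using h(2) gen_closed[OF that] that unfolding e by simp
qed

lemma endo_extensional: "endo f \<in> extensional (carrier F)"
  by (simp add: endo_def)

text \<open>Retracts F onto F_{m-1} by killing x_i for i \<ge> m. It turns membership of an element
  of F_{m-1} in \<Gamma>_j(F) into membership in \<Gamma>_j(F_{m-1}).\<close>

definition retraction :: "nat \<Rightarrow> letter list \<Rightarrow> letter list" where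
  "retraction m = endo (\<lambda>i. if i < m then gen i else \<one>\<^bsub>F\<^esub>)"

lemma retraction_hom: "retraction m \<in> hom F F"
  unfolding retraction_def by (rule endo_hom) (use gen_closed in auto)

lemma retraction_gen: "i \<in> {1..n} \<Longrightarrow> retraction m (gen i) = (if i < m then gen i else \<one>\<^bsub>F\<^esub>)"
  unfolding retraction_def by (rule endo_gen) (use gen_closed in auto)

lemma retraction_gens_below:
  assumes "m \<le> Suc n" "x \<in> gens_below n m"
  shows "retraction m x = x"
  by (rule hom_eq_generate[OF retraction_hom id_hom gens_below_subset[OF assms(1)]])
     (use assms retraction_gen in \<open>auto simp: gens_below_def\<close>)

lemma retraction_mem:
  assumes "m \<le> Suc n" "x \<in> carrier F"
  shows "retraction m x \<in> gens_below n m"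
proof -
  interpret r: group_hom F F "retraction m" using retraction_hom by unfold_locales
  have C: "gen ` {1..n} \<subseteq> carrier F" using gen_closed by blast
  have "retraction m ` (gen ` {1..n}) \<subseteq> gens_below n m"
    using gen_gens_below subgroup.one_closed[OF gens_below_subgroup[OF assms(1)]] by (auto simp: retraction_gen)
  then have "generate F (retraction m ` (gen ` {1..n})) \<subseteq> gens_below n m"
    by (rule generate_subgroup_incl[OF _ gens_below_subgroup[OF assms(1)]])
  then have "retraction m ` carrier F \<subseteq> gens_below n m"
    unfolding r.generate_img[OF C] generate_gen .
  then show ?thesis using assms(2) by blast
qed

text \<open>The two-sided form covers at once conjugation of x_m by w, the pair (w^-1, w), and right
  multiplication by \<gamma>, the pair (1, \<gamma>). For entries in F_{m-1} it is closed under
  composition.\<close>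

definition elementary :: "nat \<Rightarrow> letter list \<Rightarrow> letter list \<Rightarrow> letter list \<Rightarrow> letter list" where
  "elementary m u v = endo (\<lambda>i. if i = m then u \<otimes>\<^bsub>F\<^esub> gen i \<otimes>\<^bsub>F\<^esub> v else gen i)"

context
  fixes m assumes m: "m \<in> {1..n}"
begin

lemma below_closed [simp]: "x \<in> gens_below n m \<Longrightarrow> x \<in> carrier F"
  using gens_below_carrier[of m x] m by simp

lemma below_subgroup: "subgroup (gens_below n m) F"
  using gens_below_subgroup[of m] m by simp

lemma elementary_hom: "u \<in> carrier F \<Longrightarrow> v \<in> carrier F \<Longrightarrow> elementary m u v \<in> hom F F"
  unfolding elementary_def by (rule endo_hom) (auto simp: gen_closed)

lemma elementary_gen:
  "u \<in> carrier F \<Longrightarrow> v \<in> carrier F \<Longrightarrow> i \<in> {1..n} \<Longrightarrow>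
    elementary m u v (gen i) = (if i = m then u \<otimes>\<^bsub>F\<^esub> gen i \<otimes>\<^bsub>F\<^esub> v else gen i)"
  unfolding elementary_def by (rule endo_gen) (auto simp: gen_closed)

lemma elementary_fixes:
  assumes "u \<in> carrier F" "v \<in> carrier F" "x \<in> gens_below n m"
  shows "elementary m u v x = x"
proof (rule hom_eq_generate[OF elementary_hom[OF assms(1,2)] id_hom gens_below_subset])
  show "x \<in> generate F (gen ` {1..<m})" using assms(3) by (simp add: gens_below_def)
  fix c assume "c \<in> gen ` {1..<m}"
  then show "elementary m u v c = c"
    using elementary_gen[OF assms(1,2)] m by auto
qed (use m in auto)

text \<open>The outer map fixes u' and v', which lie in F_{m-1}, so only x_m between them is
  replaced.\<close>

lemma elementary_comp:
  assumes u: "u \<in> gens_below n m" "v \<in> gens_below n m" "u' \<in> gens_below n m" "v' \<in> gens_below n m" and x: "x \<in> carrier F"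
  shows "elementary m u v (elementary m u' v' x) = elementary m (u' \<otimes>\<^bsub>F\<^esub> u) (v \<otimes>\<^bsub>F\<^esub> v') x"
proof -
  note cl = u[THEN below_closed]
  interpret e: group_hom F F "elementary m u v" using elementary_hom[OF cl(1,2)] by unfold_locales
  show ?thesis
  proof (rule hom_eq_carrier[OF comp_hom[OF elementary_hom[OF cl(1,2)] elementary_hom[OF cl(3,4)]] elementary_hom _ x])
    fix i assume i: "i \<in> {1..n}"
    note g = gen_closed[OF i]
    show "elementary m u v (elementary m u' v' (gen i)) = elementary m (u' \<otimes>\<^bsub>F\<^esub> u) (v \<otimes>\<^bsub>F\<^esub> v') (gen i)"
      using cl g gen_closed[OF m] i by (simp add: elementary_gen elementary_fixes u word_simps)
  qed (use cl in auto)
qed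

lemma elementary_one: "x \<in> carrier F \<Longrightarrow> elementary m \<one>\<^bsub>F\<^esub> \<one>\<^bsub>F\<^esub> x = x"
  by (rule hom_eq_carrier[OF elementary_hom id_hom]) (auto simp: elementary_gen gen_closed)

lemma elementary_aut:
  assumes u: "u \<in> gens_below n m" "v \<in> gens_below n m"
  shows "elementary m u v \<in> carrier (Aut_free n)"
proof (rule autI)
  note cl = u[THEN below_closed]
  have iu: "inv\<^bsub>F\<^esub> u \<in> gens_below n m" "inv\<^bsub>F\<^esub> v \<in> gens_below n m"
    using u by (simp_all add: subgroup.m_inv_closed[OF below_subgroup])
  show h: "elementary m u v \<in> hom F F" by (rule elementary_hom[OF cl])
  show "bij_betw (elementary m u v) (carrier F) (carrier F)"
  proof (rule bij_betwI[where g = "elementary m (inv\<^bsub>F\<^esub> u) (inv\<^bsub>F\<^esub> v)"])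
    show "elementary m u v \<in> carrier F \<rightarrow> carrier F"
      "elementary m (inv\<^bsub>F\<^esub> u) (inv\<^bsub>F\<^esub> v) \<in> carrier F \<rightarrow> carrier F"
      using h elementary_hom[of "inv\<^bsub>F\<^esub> u" "inv\<^bsub>F\<^esub> v"] cl by (simp_all add: hom_def)
    fix x assume "x \<in> carrier F"
    then show "elementary m (inv\<^bsub>F\<^esub> u) (inv\<^bsub>F\<^esub> v) (elementary m u v x) = x"
      "elementary m u v (elementary m (inv\<^bsub>F\<^esub> u) (inv\<^bsub>F\<^esub> v) x) = x"
      using u iu cl by (simp_all add: elementary_comp elementary_one)
  qed
  show "elementary m u v \<in> extensional (carrier F)"
    unfolding elementary_def by (rule endo_extensional)
qed

lemma elementary_mult:
  assumes u: "u \<in> gens_below n m" "v \<in> gens_below n m" "u' \<in> gens_below n m" "v' \<in> gens_below n m"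
  shows "elementary m u v \<otimes>\<^bsub>Aut_free n\<^esub> elementary m u' v' = elementary m (u' \<otimes>\<^bsub>F\<^esub> u) (v \<otimes>\<^bsub>F\<^esub> v')"
proof (rule aut_eqI)
  show "elementary m u v \<otimes>\<^bsub>Aut_free n\<^esub> elementary m u' v' \<in> carrier (Aut_free n)"
    using u by (simp add: elementary_aut)
  show "elementary m (u' \<otimes>\<^bsub>F\<^esub> u) (v \<otimes>\<^bsub>F\<^esub> v') \<in> carrier (Aut_free n)"
    using u by (simp add: elementary_aut subgroup.m_closed[OF below_subgroup])
qed (use u in \<open>simp add: elementary_aut elementary_comp\<close>)

lemma elementary_1: "elementary m \<one>\<^bsub>F\<^esub> \<one>\<^bsub>F\<^esub> = \<one>\<^bsub>Aut_free n\<^esub>"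
  by (rule aut_eqI) (simp_all add: elementary_aut subgroup.one_closed[OF below_subgroup] elementary_one)

lemma elementary_inv:
  assumes u: "u \<in> gens_below n m" "v \<in> gens_below n m"
  shows "inv\<^bsub>Aut_free n\<^esub> (elementary m u v) = elementary m (inv\<^bsub>F\<^esub> u) (inv\<^bsub>F\<^esub> v)"
proof (rule Aut.inv_equality)
  have iu: "inv\<^bsub>F\<^esub> u \<in> gens_below n m" "inv\<^bsub>F\<^esub> v \<in> gens_below n m"
    using u by (simp_all add: subgroup.m_inv_closed[OF below_subgroup])
  show "elementary m (inv\<^bsub>F\<^esub> u) (inv\<^bsub>F\<^esub> v) \<otimes>\<^bsub>Aut_free n\<^esub> elementary m u v = \<one>\<^bsub>Aut_free n\<^esub>"
    using u iu by (simp add: elementary_mult elementary_1)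
  show "elementary m u v \<in> carrier (Aut_free n)" "elementary m (inv\<^bsub>F\<^esub> u) (inv\<^bsub>F\<^esub> v) \<in> carrier (Aut_free n)"
    using u iu by (simp_all add: elementary_aut)
qed

text \<open>The source of all commutators in K beyond conjugations: the partial conjugation by w
  sends the pair (1, g) to (1, w g w^-1), so commutators of F_{m-1} become commutators of
  automorphisms.\<close>

lemma elementary_commutator:
  assumes w: "w \<in> gens_below n m" and g: "g \<in> gens_below n m"
  shows "commutator (Aut_free n) (elementary m (inv\<^bsub>F\<^esub> w) w) (elementary m \<one>\<^bsub>F\<^esub> g) = elementary m \<one>\<^bsub>F\<^esub> (commutator F w g)"
proof -
  have iu: "inv\<^bsub>F\<^esub> w \<in> gens_below n m" "inv\<^bsub>F\<^esub> g \<in> gens_below n m" "\<one>\<^bsub>F\<^esub> \<in> gens_below n m"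
    using w g by (simp_all add: subgroup.m_inv_closed[OF below_subgroup] subgroup.one_closed[OF below_subgroup])
  show ?thesis
    using w g iu
    by (simp add: commutator_def elementary_inv elementary_mult subgroup.m_closed[OF below_subgroup])
qed

end


section \<open>The triangular automorphisms form a group\<close>

lemma IA_plus_carrier: "\<phi> \<in> IA_plus n \<Longrightarrow> \<phi> \<in> carrier (Aut_free n)"
  by (simp add: IA_plus_def)

lemma IA_plusD:
  assumes "\<phi> \<in> IA_plus n" "i \<in> {1..n}"
  obtains w \<gamma> where "w \<in> gens_below n i" "\<gamma> \<in> lower_central F (gens_below n i) 2"
    "\<phi> (gen i) = inv\<^bsub>F\<^esub> w \<otimes>\<^bsub>F\<^esub> gen i \<otimes>\<^bsub>F\<^esub> w \<otimes>\<^bsub>F\<^esub> \<gamma>"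
  using assms unfolding IA_plus_def conj_by_def by blast

lemma IA_plusI:
  assumes "\<phi> \<in> carrier (Aut_free n)"
    and "\<And>i. i \<in> {1..n} \<Longrightarrow> \<exists>w\<in>gens_below n i. \<exists>\<gamma>\<in>lower_central F (gens_below n i) 2.
      \<phi> (gen i) = inv\<^bsub>F\<^esub> w \<otimes>\<^bsub>F\<^esub> gen i \<otimes>\<^bsub>F\<^esub> w \<otimes>\<^bsub>F\<^esub> \<gamma>"
  shows "\<phi> \<in> IA_plus n"
  using assms unfolding IA_plus_def conj_by_def by blast

lemma lower_central_below:
  "m \<le> Suc n \<Longrightarrow> x \<in> lower_central F (gens_below n m) j \<Longrightarrow> x \<in> gens_below n m"
  using lower_central_subgroup[OF gens_below_subgroup[of m], of j] by blast

lemma lower_central_below_subgroup: "m \<le> Suc n \<Longrightarrow> subgroup (lower_central F (gens_below n m) j) F"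
  using lower_central_subgroup[OF gens_below_subgroup[of m], of j] by blast

lemma lower_central_below_\<Gamma>: "m \<le> Suc n \<Longrightarrow> x \<in> lower_central F (gens_below n m) j \<Longrightarrow> x \<in> \<Gamma> j"
  using lower_central_mono[OF gens_below_subgroup subgroup_self, of m j]
    subgroup.subset[OF gens_below_subgroup, of m] by blast

lemma aut_below:
  assumes \<phi>: "\<phi> \<in> carrier (Aut_free n)" and m: "m \<le> Suc n"
    and gens: "\<And>i. i \<in> {1..<m} \<Longrightarrow> \<phi> (gen i) \<in> gens_below n m" and x: "x \<in> gens_below n m"
  shows "\<phi> x \<in> gens_below n m"
proof -
  interpret p: group_hom F F \<phi> using aut_hom[OF \<phi>] by unfold_locales
  have "\<phi> ` (gen ` {1..<m}) \<subseteq> gens_below n m" using gens by auto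
  then have "generate F (\<phi> ` (gen ` {1..<m})) \<subseteq> gens_below n m"
    by (rule generate_subgroup_incl[OF _ gens_below_subgroup[OF m]])
  then have "\<phi> ` gens_below n m \<subseteq> gens_below n m"
    unfolding p.generate_img[OF gens_below_subset[OF m]] gens_below_def[symmetric] .
  then show ?thesis using x by blast
qed

lemma aut_lower_central_below:
  assumes \<phi>: "\<phi> \<in> carrier (Aut_free n)" and m: "m \<le> Suc n"
    and below: "\<And>x. x \<in> gens_below n m \<Longrightarrow> \<phi> x \<in> gens_below n m"
    and x: "x \<in> lower_central F (gens_below n m) j"
  shows "\<phi> x \<in> lower_central F (gens_below n m) j"
  by (rule lower_central_hom[OF is_group aut_hom[OF \<phi>] gens_below_subgroup[OF m] gens_below_subgroup[OF m] _ x])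
     (use below in auto)

lemma IA_plus_below:
  assumes \<phi>: "\<phi> \<in> IA_plus n" and m: "m \<le> Suc n" and x: "x \<in> gens_below n m"
  shows "\<phi> x \<in> gens_below n m"
proof (rule aut_below[OF IA_plus_carrier[OF \<phi>] m _ x])
  fix i assume i: "i \<in> {1..<m}"
  then have i': "i \<in> {1..n}" "i \<le> Suc n" "i \<le> m" using m by auto
  obtain w \<gamma> where w: "w \<in> gens_below n i" and \<gamma>: "\<gamma> \<in> lower_central F (gens_below n i) 2"
    and eq: "\<phi> (gen i) = inv\<^bsub>F\<^esub> w \<otimes>\<^bsub>F\<^esub> gen i \<otimes>\<^bsub>F\<^esub> w \<otimes>\<^bsub>F\<^esub> \<gamma>"
    using IA_plusD[OF \<phi> i'(1)] .
  have "w \<in> gens_below n m" "\<gamma> \<in> gens_below n m"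
    using w lower_central_below[OF i'(2) \<gamma>] gens_below_mono[OF i'(3)] by auto
  then show "\<phi> (gen i) \<in> gens_below n m"
    unfolding eq using gen_gens_below[OF i]
    by (simp add: subgroup.m_closed[OF gens_below_subgroup[OF m]] subgroup.m_inv_closed[OF gens_below_subgroup[OF m]])
qed

lemma IA_plus_mult:
  assumes \<phi>: "\<phi> \<in> IA_plus n" and \<psi>: "\<psi> \<in> IA_plus n"
  shows "\<phi> \<otimes>\<^bsub>Aut_free n\<^esub> \<psi> \<in> IA_plus n"
proof (rule IA_plusI)
  note c = IA_plus_carrier[OF \<phi>] IA_plus_carrier[OF \<psi>]
  show "\<phi> \<otimes>\<^bsub>Aut_free n\<^esub> \<psi> \<in> carrier (Aut_free n)" using c by simp
  fix i assume i: "i \<in> {1..n}"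
  then have m: "i \<le> Suc n" by simp
  note g = gen_closed[OF i]
  obtain v \<delta> where v: "v \<in> gens_below n i" and \<delta>: "\<delta> \<in> lower_central F (gens_below n i) 2"
    and eq\<phi>: "\<phi> (gen i) = inv\<^bsub>F\<^esub> v \<otimes>\<^bsub>F\<^esub> gen i \<otimes>\<^bsub>F\<^esub> v \<otimes>\<^bsub>F\<^esub> \<delta>"
    using IA_plusD[OF \<phi> i] .
  obtain w \<gamma> where w: "w \<in> gens_below n i" and \<gamma>: "\<gamma> \<in> lower_central F (gens_below n i) 2"
    and eq\<psi>: "\<psi> (gen i) = inv\<^bsub>F\<^esub> w \<otimes>\<^bsub>F\<^esub> gen i \<otimes>\<^bsub>F\<^esub> w \<otimes>\<^bsub>F\<^esub> \<gamma>"
    using IA_plusD[OF \<psi> i] .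
  define u where "u = \<phi> w"
  have u: "u \<in> gens_below n i" unfolding u_def by (rule IA_plus_below[OF \<phi> m w])
  have \<phi>\<gamma>: "\<phi> \<gamma> \<in> lower_central F (gens_below n i) 2"
    by (rule aut_lower_central_below[OF c(1) m IA_plus_below[OF \<phi> m] \<gamma>])
  note cl = gens_below_carrier[OF m v] gens_below_carrier[OF m w] gens_below_carrier[OF m u]
    gens_below_carrier[OF m lower_central_below[OF m \<gamma>]] gens_below_carrier[OF m lower_central_below[OF m \<delta>]]
    gens_below_carrier[OF m lower_central_below[OF m \<phi>\<gamma>]]
  have "inv\<^bsub>F\<^esub> u \<otimes>\<^bsub>F\<^esub> \<delta> \<otimes>\<^bsub>F\<^esub> inv\<^bsub>F\<^esub> (inv\<^bsub>F\<^esub> u) \<in> lower_central F (gens_below n i) 2"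
    by (rule lower_central_normalized[OF gens_below_subgroup[OF m] subgroup.m_inv_closed[OF gens_below_subgroup[OF m] u] \<delta>])
  then have "inv\<^bsub>F\<^esub> u \<otimes>\<^bsub>F\<^esub> \<delta> \<otimes>\<^bsub>F\<^esub> u \<otimes>\<^bsub>F\<^esub> \<phi> \<gamma> \<in> lower_central F (gens_below n i) 2"
    using \<phi>\<gamma> cl by (simp add: subgroup.m_closed[OF lower_central_below_subgroup[OF m]])
  moreover have "v \<otimes>\<^bsub>F\<^esub> u \<in> gens_below n i"
    by (rule subgroup.m_closed[OF gens_below_subgroup[OF m] v u])
  \<comment> \<open>With u = \<phi>(w), the conjugators combine to v u, and \<delta> is conjugated
    by u on its way to the right end.\<close>
  moreover have "(\<phi> \<otimes>\<^bsub>Aut_free n\<^esub> \<psi>) (gen i) = inv\<^bsub>F\<^esub> (v \<otimes>\<^bsub>F\<^esub> u) \<otimes>\<^bsub>F\<^esub> gen i \<otimes>\<^bsub>F\<^esub> (v \<otimes>\<^bsub>F\<^esub> u)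
      \<otimes>\<^bsub>F\<^esub> (inv\<^bsub>F\<^esub> u \<otimes>\<^bsub>F\<^esub> \<delta> \<otimes>\<^bsub>F\<^esub> u \<otimes>\<^bsub>F\<^esub> \<phi> \<gamma>)"
    using cl g c by (simp add: eq\<psi> aut_hom_mult aut_hom_inv u_def[symmetric] eq\<phi> word_simps)
  ultimately show "\<exists>w\<in>gens_below n i. \<exists>\<gamma>\<in>lower_central F (gens_below n i) 2.
      (\<phi> \<otimes>\<^bsub>Aut_free n\<^esub> \<psi>) (gen i) = inv\<^bsub>F\<^esub> w \<otimes>\<^bsub>F\<^esub> gen i \<otimes>\<^bsub>F\<^esub> w \<otimes>\<^bsub>F\<^esub> \<gamma>"
    by blast
qed

text \<open>Applying the inverse to the formula for \<phi>(x_i) and solving for the inverse at x_i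
  gives a triangular formula with conjugator w^-1. That the inverse preserves F_{i-1} is assumed
  here, since \<phi> is so far only known to map F_{i-1} into itself.\<close>

lemma IA_plus_inv_gen:
  assumes \<phi>: "\<phi> \<in> IA_plus n" and i: "i \<in> {1..n}"
    and below: "\<And>x. x \<in> gens_below n i \<Longrightarrow> (inv\<^bsub>Aut_free n\<^esub> \<phi>) x \<in> gens_below n i"
  obtains w \<gamma> where "w \<in> gens_below n i" "\<gamma> \<in> lower_central F (gens_below n i) 2"
    "(inv\<^bsub>Aut_free n\<^esub> \<phi>) (gen i) = inv\<^bsub>F\<^esub> w \<otimes>\<^bsub>F\<^esub> gen i \<otimes>\<^bsub>F\<^esub> w \<otimes>\<^bsub>F\<^esub> \<gamma>"
proof -
  let ?\<psi> = "inv\<^bsub>Aut_free n\<^esub> \<phi>"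
  have c: "\<phi> \<in> carrier (Aut_free n)" "?\<psi> \<in> carrier (Aut_free n)" using IA_plus_carrier[OF \<phi>] by simp_all
  have m: "i \<le> Suc n" using i by simp
  note g = gen_closed[OF i]
  obtain v \<delta> where v: "v \<in> gens_below n i" and \<delta>: "\<delta> \<in> lower_central F (gens_below n i) 2"
    and eq: "\<phi> (gen i) = inv\<^bsub>F\<^esub> v \<otimes>\<^bsub>F\<^esub> gen i \<otimes>\<^bsub>F\<^esub> v \<otimes>\<^bsub>F\<^esub> \<delta>"
    using IA_plusD[OF \<phi> i] .
  define w where "w = ?\<psi> v"
  define \<gamma> where "\<gamma> = ?\<psi> \<delta>"
  have w: "w \<in> gens_below n i" unfolding w_def by (rule below[OF v])
  have \<gamma>: "\<gamma> \<in> lower_central F (gens_below n i) 2"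
    unfolding \<gamma>_def by (rule aut_lower_central_below[OF c(2) m below \<delta>])
  note cl = gens_below_carrier[OF m v] gens_below_carrier[OF m w]
    gens_below_carrier[OF m lower_central_below[OF m \<gamma>]] gens_below_carrier[OF m lower_central_below[OF m \<delta>]]
    aut_closed[OF c(2) g]
  have "gen i = ?\<psi> (\<phi> (gen i))" using c(1) g by simp
  also have "\<dots> = inv\<^bsub>F\<^esub> w \<otimes>\<^bsub>F\<^esub> ?\<psi> (gen i) \<otimes>\<^bsub>F\<^esub> w \<otimes>\<^bsub>F\<^esub> \<gamma>"
    unfolding eq using cl g c(2) by (simp add: aut_hom_mult aut_hom_inv w_def \<gamma>_def)
  finally have "w \<otimes>\<^bsub>F\<^esub> gen i \<otimes>\<^bsub>F\<^esub> inv\<^bsub>F\<^esub> \<gamma> \<otimes>\<^bsub>F\<^esub> inv\<^bsub>F\<^esub> w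
      = w \<otimes>\<^bsub>F\<^esub> (inv\<^bsub>F\<^esub> w \<otimes>\<^bsub>F\<^esub> ?\<psi> (gen i) \<otimes>\<^bsub>F\<^esub> w \<otimes>\<^bsub>F\<^esub> \<gamma>) \<otimes>\<^bsub>F\<^esub> inv\<^bsub>F\<^esub> \<gamma> \<otimes>\<^bsub>F\<^esub> inv\<^bsub>F\<^esub> w"
    by (rule arg_cong)
  also have "\<dots> = ?\<psi> (gen i)" using cl by (simp add: word_simps)
  finally have \<psi>: "?\<psi> (gen i) = inv\<^bsub>F\<^esub> (inv\<^bsub>F\<^esub> w) \<otimes>\<^bsub>F\<^esub> gen i \<otimes>\<^bsub>F\<^esub> inv\<^bsub>F\<^esub> w \<otimes>\<^bsub>F\<^esub> (w \<otimes>\<^bsub>F\<^esub> inv\<^bsub>F\<^esub> \<gamma> \<otimes>\<^bsub>F\<^esub> inv\<^bsub>F\<^esub> w)"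
    using cl g by (simp add: word_simps)
  show thesis
    by (rule that[OF _ _ \<psi>])
       (rule subgroup.m_inv_closed[OF gens_below_subgroup[OF m] w],
        rule lower_central_normalized[OF gens_below_subgroup[OF m] w
          subgroup.m_inv_closed[OF lower_central_below_subgroup[OF m] \<gamma>]])
qed

text \<open>Discharges that assumption by strong induction: the images of generators below x_m only
  need the smaller subgroups.\<close>

lemma IA_plus_inv_below:
  assumes \<phi>: "\<phi> \<in> IA_plus n" and "m \<le> Suc n" and "x \<in> gens_below n m"
  shows "(inv\<^bsub>Aut_free n\<^esub> \<phi>) x \<in> gens_below n m"
  using assms(2,3)
proof (induction m arbitrary: x rule: less_induct)
  case (less m)
  let ?\<psi> = "inv\<^bsub>Aut_free n\<^esub> \<phi>"
  have c: "?\<psi> \<in> carrier (Aut_free n)" using IA_plus_carrier[OF \<phi>] by simp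
  show ?case
  proof (rule aut_below[OF c less.prems(1) _ less.prems(2)])
    fix i assume i: "i \<in> {1..<m}"
    then have i': "i \<in> {1..n}" "i \<le> Suc n" "i \<le> m" "i < m" using less.prems(1) by auto
    obtain w \<gamma> where w: "w \<in> gens_below n i" and \<gamma>: "\<gamma> \<in> lower_central F (gens_below n i) 2"
      and eq: "?\<psi> (gen i) = inv\<^bsub>F\<^esub> w \<otimes>\<^bsub>F\<^esub> gen i \<otimes>\<^bsub>F\<^esub> w \<otimes>\<^bsub>F\<^esub> \<gamma>"
      using IA_plus_inv_gen[OF \<phi> i'(1) less.IH[OF i'(4,2)]] .
    have "w \<in> gens_below n m" "\<gamma> \<in> gens_below n m"
      using w lower_central_below[OF i'(2) \<gamma>] gens_below_mono[OF i'(3)] by auto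
    then show "?\<psi> (gen i) \<in> gens_below n m"
      unfolding eq using gen_gens_below[OF i]
      by (simp add: subgroup.m_closed[OF gens_below_subgroup[OF less.prems(1)]]
          subgroup.m_inv_closed[OF gens_below_subgroup[OF less.prems(1)]])
  qed
qed

lemma elementary_IA_plus:
  assumes m: "m \<in> {1..n}" and w: "w \<in> gens_below n m" and \<gamma>: "\<gamma> \<in> lower_central F (gens_below n m) 2"
  shows "elementary m (inv\<^bsub>F\<^esub> w) (w \<otimes>\<^bsub>F\<^esub> \<gamma>) \<in> IA_plus n"
proof (rule IA_plusI)
  have m': "m \<le> Suc n" using m by simp
  note \<gamma>' = lower_central_below[OF m' \<gamma>]
  have u: "inv\<^bsub>F\<^esub> w \<in> gens_below n m" "w \<otimes>\<^bsub>F\<^esub> \<gamma> \<in> gens_below n m"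
    using w \<gamma>' by (simp_all add: subgroup.m_closed[OF below_subgroup[OF m]] subgroup.m_inv_closed[OF below_subgroup[OF m]])
  note cl = u[THEN below_closed[OF m]] below_closed[OF m w] below_closed[OF m \<gamma>']
  show "elementary m (inv\<^bsub>F\<^esub> w) (w \<otimes>\<^bsub>F\<^esub> \<gamma>) \<in> carrier (Aut_free n)"
    by (rule elementary_aut[OF m u])
  fix i assume i: "i \<in> {1..n}"
  show "\<exists>w'\<in>gens_below n i. \<exists>\<gamma>'\<in>lower_central F (gens_below n i) 2.
      elementary m (inv\<^bsub>F\<^esub> w) (w \<otimes>\<^bsub>F\<^esub> \<gamma>) (gen i) = inv\<^bsub>F\<^esub> w' \<otimes>\<^bsub>F\<^esub> gen i \<otimes>\<^bsub>F\<^esub> w' \<otimes>\<^bsub>F\<^esub> \<gamma>'"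
  proof (cases "i = m")
    case True
    have "elementary m (inv\<^bsub>F\<^esub> w) (w \<otimes>\<^bsub>F\<^esub> \<gamma>) (gen m) = inv\<^bsub>F\<^esub> w \<otimes>\<^bsub>F\<^esub> gen m \<otimes>\<^bsub>F\<^esub> w \<otimes>\<^bsub>F\<^esub> \<gamma>"
      using cl gen_closed[OF m] elementary_gen[OF m cl(1,2) m] by (simp add: word_simps)
    then show ?thesis using w \<gamma> True by blast
  next
    case False
    have i': "i \<le> Suc n" using i by simp
    have "elementary m (inv\<^bsub>F\<^esub> w) (w \<otimes>\<^bsub>F\<^esub> \<gamma>) (gen i)
        = inv\<^bsub>F\<^esub> \<one>\<^bsub>F\<^esub> \<otimes>\<^bsub>F\<^esub> gen i \<otimes>\<^bsub>F\<^esub> \<one>\<^bsub>F\<^esub> \<otimes>\<^bsub>F\<^esub> \<one>\<^bsub>F\<^esub>"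
      using gen_closed[OF i] elementary_gen[OF m cl(1,2) i] False by simp
    then show ?thesis
      using subgroup.one_closed[OF gens_below_subgroup[OF i']]
        subgroup.one_closed[OF lower_central_below_subgroup[OF i', of 2]] by blast
  qed
qed

lemma IA_plus_subgroup: "subgroup (IA_plus n) (Aut_free n)"
proof (rule Aut.subgroupI)
  show "IA_plus n \<subseteq> carrier (Aut_free n)" by (simp add: IA_plus_def)
  have "\<one>\<^bsub>Aut_free n\<^esub> \<in> IA_plus n"
  proof (rule IA_plusI)
    fix i assume i: "i \<in> {1..n}"
    then have i': "i \<le> Suc n" by simp
    have "\<one>\<^bsub>Aut_free n\<^esub> (gen i) = inv\<^bsub>F\<^esub> \<one>\<^bsub>F\<^esub> \<otimes>\<^bsub>F\<^esub> gen i \<otimes>\<^bsub>F\<^esub> \<one>\<^bsub>F\<^esub> \<otimes>\<^bsub>F\<^esub> \<one>\<^bsub>F\<^esub>"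
      using gen_closed[OF i] by simp
    then show "\<exists>w\<in>gens_below n i. \<exists>\<gamma>\<in>lower_central F (gens_below n i) 2.
        \<one>\<^bsub>Aut_free n\<^esub> (gen i) = inv\<^bsub>F\<^esub> w \<otimes>\<^bsub>F\<^esub> gen i \<otimes>\<^bsub>F\<^esub> w \<otimes>\<^bsub>F\<^esub> \<gamma>"
      using subgroup.one_closed[OF gens_below_subgroup[OF i']]
        subgroup.one_closed[OF lower_central_below_subgroup[OF i', of 2]] by blast
  qed simp
  then show "IA_plus n \<noteq> {}" by blast
  fix \<phi> \<psi> assume \<phi>: "\<phi> \<in> IA_plus n"
  show "inv\<^bsub>Aut_free n\<^esub> \<phi> \<in> IA_plus n"
  proof (rule IA_plusI)
    show "inv\<^bsub>Aut_free n\<^esub> \<phi> \<in> carrier (Aut_free n)" using IA_plus_carrier[OF \<phi>] by simp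
    fix i assume i: "i \<in> {1..n}"
    then have i': "i \<le> Suc n" by simp
    show "\<exists>w\<in>gens_below n i. \<exists>\<gamma>\<in>lower_central F (gens_below n i) 2.
        (inv\<^bsub>Aut_free n\<^esub> \<phi>) (gen i) = inv\<^bsub>F\<^esub> w \<otimes>\<^bsub>F\<^esub> gen i \<otimes>\<^bsub>F\<^esub> w \<otimes>\<^bsub>F\<^esub> \<gamma>"
      by (rule IA_plus_inv_gen[OF \<phi> i IA_plus_inv_below[OF \<phi> i']]) blast+
  qed
  assume "\<psi> \<in> IA_plus n"
  then show "\<phi> \<otimes>\<^bsub>Aut_free n\<^esub> \<psi> \<in> IA_plus n" by (rule IA_plus_mult[OF \<phi>])
qed

section \<open>Inner automorphisms\<close>

definition inner :: "letter list \<Rightarrow> letter list \<Rightarrow> letter list" where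
  "inner w = (\<lambda>x\<in>carrier F. conj_by F x w)"

lemma Inn_eq: "Inn F = inner ` carrier F"
  unfolding Inn_def inner_def by blast

lemma inner_apply [simp]: "x \<in> carrier F \<Longrightarrow> inner w x = inv\<^bsub>F\<^esub> w \<otimes>\<^bsub>F\<^esub> x \<otimes>\<^bsub>F\<^esub> w"
  by (simp add: inner_def conj_by_def)

lemma inner_aut:
  assumes w: "w \<in> carrier F"
  shows "inner w \<in> carrier (Aut_free n)"
proof (rule autI)
  show "inner w \<in> hom F F"
    using w by (auto simp: hom_def word_simps)
  show "bij_betw (inner w) (carrier F) (carrier F)"
    by (rule bij_betwI[where g = "inner (inv\<^bsub>F\<^esub> w)"]) (use w in \<open>auto simp: word_simps\<close>)
qed (simp add: inner_def)

text \<open>Conjugation x^w is a right action while automorphisms compose on the left, so the order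
  reverses. The homomorphism from F is therefore w \<mapsto> inner (w^-1).\<close>

lemma inner_mult:
  assumes "v \<in> carrier F" "w \<in> carrier F"
  shows "inner v \<otimes>\<^bsub>Aut_free n\<^esub> inner w = inner (w \<otimes>\<^bsub>F\<^esub> v)"
  by (rule aut_eqI) (use assms in \<open>simp_all add: inner_aut word_simps\<close>)

lemma inner_inv:
  assumes "w \<in> carrier F"
  shows "inv\<^bsub>Aut_free n\<^esub> (inner w) = inner (inv\<^bsub>F\<^esub> w)"
proof (rule Aut.inv_equality)
  show "inner (inv\<^bsub>F\<^esub> w) \<otimes>\<^bsub>Aut_free n\<^esub> inner w = \<one>\<^bsub>Aut_free n\<^esub>"
    by (rule aut_eqI) (use assms in \<open>simp_all add: inner_aut word_simps\<close>)
qed (use assms in \<open>simp_all add: inner_aut\<close>)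

text \<open>Conjugating \<open>inner w\<close> by \<phi> gives
  \<open>inner (\<phi> w)\<close>.\<close>

lemma Inn_normal: "Inn F \<lhd> Aut_free n"
  unfolding Aut.normal_inv_iff
proof (intro conjI ballI)
  show "subgroup (Inn F) (Aut_free n)"
  proof (rule Aut.subgroupI)
    show "Inn F \<subseteq> carrier (Aut_free n)" unfolding Inn_eq using inner_aut by (rule image_subsetI)
    show "Inn F \<noteq> {}" unfolding Inn_eq using one_closed by blast
    fix \<phi> \<psi> assume "\<phi> \<in> Inn F"
    then obtain v where v: "\<phi> = inner v" "v \<in> carrier F" unfolding Inn_eq by (rule imageE)
    show "inv\<^bsub>Aut_free n\<^esub> \<phi> \<in> Inn F"
      unfolding Inn_eq v(1) inner_inv[OF v(2)] using v(2) by (intro imageI inv_closed)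
    assume "\<psi> \<in> Inn F"
    then obtain w where w: "\<psi> = inner w" "w \<in> carrier F" unfolding Inn_eq by (rule imageE)
    show "\<phi> \<otimes>\<^bsub>Aut_free n\<^esub> \<psi> \<in> Inn F"
      unfolding Inn_eq v(1) w(1) inner_mult[OF v(2) w(2)] using v(2) w(2) by (intro imageI m_closed)
  qed
  fix \<phi> \<psi> assume \<phi>: "\<phi> \<in> carrier (Aut_free n)" and "\<psi> \<in> Inn F"
  then obtain w where w: "\<psi> = inner w" "w \<in> carrier F" unfolding Inn_eq by (blast elim: imageE)
  have "\<phi> \<otimes>\<^bsub>Aut_free n\<^esub> \<psi> \<otimes>\<^bsub>Aut_free n\<^esub> inv\<^bsub>Aut_free n\<^esub> \<phi> = inner (\<phi> w)"
  proof (rule aut_eqI)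
    fix x assume x: "x \<in> carrier F"
    show "(\<phi> \<otimes>\<^bsub>Aut_free n\<^esub> \<psi> \<otimes>\<^bsub>Aut_free n\<^esub> inv\<^bsub>Aut_free n\<^esub> \<phi>) x = inner (\<phi> w) x"
      using \<phi> w x aut_closed[OF Aut.inv_closed[OF \<phi>] x] by (simp add: inner_aut aut_hom_mult aut_hom_inv)
  qed (use \<phi> w in \<open>simp_all add: inner_aut aut_closed\<close>)
  then show "\<phi> \<otimes>\<^bsub>Aut_free n\<^esub> \<psi> \<otimes>\<^bsub>Aut_free n\<^esub> inv\<^bsub>Aut_free n\<^esub> \<phi> \<in> Inn F"
    unfolding Inn_eq using aut_closed[OF \<phi> w(2)] by simp
qed


section \<open>The product of inner and triangular automorphisms and its lower central
  series\<close>

abbreviation "K \<equiv> Inn F <#>\<^bsub>Aut_free n\<^esub> IA_plus n"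

lemma K_subgroup: "subgroup K (Aut_free n)"
  by (rule Aut.mult_norm_subgroup[OF Inn_normal IA_plus_subgroup])

lemma K_memI: "\<iota> \<in> Inn F \<Longrightarrow> \<psi> \<in> IA_plus n \<Longrightarrow> \<iota> \<otimes>\<^bsub>Aut_free n\<^esub> \<psi> \<in> K"
  unfolding set_mult_def by blast

lemma Inn_K: "Inn F \<subseteq> K"
proof
  fix \<iota> assume \<iota>: "\<iota> \<in> Inn F"
  then have "\<iota> \<in> carrier (Aut_free n)"
    using subgroup.subset[OF normal_imp_subgroup[OF Inn_normal]] by blast
  then show "\<iota> \<in> K"
    using K_memI[OF \<iota> subgroup.one_closed[OF IA_plus_subgroup]] by simp
qed

lemma IA_plus_K: "IA_plus n \<subseteq> K"
proof
  fix \<psi> assume \<psi>: "\<psi> \<in> IA_plus n"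
  then show "\<psi> \<in> K"
    using K_memI[OF subgroup.one_closed[OF normal_imp_subgroup[OF Inn_normal]] \<psi>] IA_plus_carrier[OF \<psi>] by simp
qed

lemma inner_displacement:
  assumes "w \<in> carrier F" "x \<in> carrier F"
  shows "inner w x \<otimes>\<^bsub>F\<^esub> inv\<^bsub>F\<^esub> x = commutator F (inv\<^bsub>F\<^esub> w) x"
  using assms by (simp add: commutator_def)

text \<open>By \<open>A_filt_1I\<close> each factor need only be checked on generators, where a
  conjugation displaces by a commutator and \<gamma> already lies in \<Gamma>_2.\<close>

lemma K_IA: "K \<subseteq> IA n"
proof
  fix \<phi> assume "\<phi> \<in> K"
  then obtain \<iota> \<psi> where \<phi>: "\<phi> = \<iota> \<otimes>\<^bsub>Aut_free n\<^esub> \<psi>" and "\<iota> \<in> Inn F" and \<psi>: "\<psi> \<in> IA_plus n"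
    unfolding set_mult_def by blast
  then obtain w where w: "\<iota> = inner w" "w \<in> carrier F" unfolding Inn_eq by (blast elim: imageE)
  have "\<iota> \<in> A_filt 1"
  proof (rule A_filt_1I)
    show "\<iota> \<in> carrier (Aut_free n)" using w by (simp add: inner_aut)
    fix i assume i: "i \<in> {1..n}"
    have "commutator F (inv\<^bsub>F\<^esub> w) (gen i) \<in> \<Gamma> (Suc 1)"
      by (rule lower_central_commutator) (use w gen_closed[OF i] in simp_all)
    then show "\<iota> (gen i) \<otimes>\<^bsub>F\<^esub> inv\<^bsub>F\<^esub> (gen i) \<in> \<Gamma> 2"
      unfolding w(1) inner_displacement[OF w(2) gen_closed[OF i]] by (simp add: numeral_2_eq_2)
  qed
  moreover have "\<psi> \<in> A_filt 1"
  proof (rule A_filt_1I[OF IA_plus_carrier[OF \<psi>]])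
    fix i assume i: "i \<in> {1..n}"
    then have m: "i \<le> Suc n" by simp
    note g = gen_closed[OF i]
    obtain w \<gamma> where w: "w \<in> gens_below n i" and \<gamma>: "\<gamma> \<in> lower_central F (gens_below n i) 2"
      and eq: "\<psi> (gen i) = inv\<^bsub>F\<^esub> w \<otimes>\<^bsub>F\<^esub> gen i \<otimes>\<^bsub>F\<^esub> w \<otimes>\<^bsub>F\<^esub> \<gamma>"
      using IA_plusD[OF \<psi> i] .
    note wF = gens_below_carrier[OF m w] and \<gamma>2 = lower_central_below_\<Gamma>[OF m \<gamma>]
    note \<gamma>F = \<Gamma>_carrier[OF \<gamma>2]
    have "commutator F (inv\<^bsub>F\<^esub> w) (gen i) \<in> \<Gamma> (Suc 1)"
      by (rule lower_central_commutator) (use wF g in simp_all)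
    then have "commutator F (inv\<^bsub>F\<^esub> w) (gen i) \<in> \<Gamma> 2" by (simp add: numeral_2_eq_2)
    then have "commutator F (inv\<^bsub>F\<^esub> w) (gen i) \<otimes>\<^bsub>F\<^esub> (gen i \<otimes>\<^bsub>F\<^esub> \<gamma> \<otimes>\<^bsub>F\<^esub> inv\<^bsub>F\<^esub> (gen i)) \<in> \<Gamma> 2"
      by (rule subgroup.m_closed[OF \<Gamma>_subgroup _ normal.inv_op_closed2[OF \<Gamma>_normal g \<gamma>2]])
    then show "\<psi> (gen i) \<otimes>\<^bsub>F\<^esub> inv\<^bsub>F\<^esub> (gen i) \<in> \<Gamma> 2"
      unfolding eq using wF \<gamma>F g by (simp add: commutator_def word_simps)
  qed
  ultimately show "\<phi> \<in> IA n"
    unfolding \<phi> IA_eq by (rule subgroup.m_closed[OF A_filt_subgroup])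
qed

abbreviation "\<Gamma>K j \<equiv> lower_central (Aut_free n) K j"

lemma \<Gamma>K_subgroup: "subgroup (\<Gamma>K j) (Aut_free n)" and \<Gamma>K_subset: "\<Gamma>K j \<subseteq> K"
  using Aut.lower_central_subgroup[OF K_subgroup, of j] by simp_all

lemma IA_subgroup: "subgroup (IA n) (Aut_free n)"
  unfolding IA_eq by (rule A_filt_subgroup)

lemma \<Gamma>K_IA: "\<Gamma>K j \<subseteq> lower_central (Aut_free n) (IA n) j"
  by (rule Aut.lower_central_mono[OF K_subgroup IA_subgroup K_IA])

text \<open>Functoriality of the lower central series along w \<mapsto> inner (w^-1), whose image
  lies in K.\<close>

lemma inner_\<Gamma>K:
  assumes w: "w \<in> \<Gamma> j"
  shows "inner w \<in> \<Gamma>K j"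
proof -
  have wF: "w \<in> carrier F" using w \<Gamma>_carrier by blast
  let ?f = "\<lambda>w. inner (inv\<^bsub>F\<^esub> w)"
  have f: "?f \<in> hom F (Aut_free n)"
    by (rule homI) (simp_all add: inner_aut inner_mult inv_mult_group)
  have "?f (inv\<^bsub>F\<^esub> w) \<in> \<Gamma>K j"
  proof (rule lower_central_hom[OF Aut.is_group f subgroup_self K_subgroup])
    show "?f ` carrier F \<subseteq> K"
      using Inn_K unfolding Inn_eq by (auto simp: image_subset_iff)
    show "inv\<^bsub>F\<^esub> w \<in> \<Gamma> j" by (rule subgroup.m_inv_closed[OF \<Gamma>_subgroup w])
  qed
  then show ?thesis using wF by simp
qed

lemma elementary_conj_\<Gamma>K:
  assumes m: "m \<in> {1..n}" and w: "w \<in> lower_central F (gens_below n m) j"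
  shows "elementary m (inv\<^bsub>F\<^esub> w) w \<in> \<Gamma>K j"
proof -
  have m': "m \<le> Suc n" using m by simp
  interpret r: group_hom F F "retraction m" using retraction_hom by unfold_locales
  \<comment> \<open>Precomposing with the retraction extends the map from F_{m-1} to all of F, as
    \<open>lower_central_hom\<close> requires a homomorphism on the ambient group.\<close>
  let ?f = "\<lambda>w. elementary m (inv\<^bsub>F\<^esub> (retraction m w)) (retraction m w)"
  note sub = gens_below_subgroup[OF m']
  have f: "?f \<in> hom F (Aut_free n)"
  proof (rule homI)
    fix x y assume x: "x \<in> carrier F" and y: "y \<in> carrier F"
    note r = retraction_mem[OF m' x] retraction_mem[OF m' y]
    show "?f x \<in> carrier (Aut_free n)"
      by (rule elementary_aut[OF m]) (use r in \<open>simp_all add: subgroup.m_inv_closed[OF sub]\<close>)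
    show "?f (x \<otimes>\<^bsub>F\<^esub> y) = ?f x \<otimes>\<^bsub>Aut_free n\<^esub> ?f y"
      using r x y by (simp add: elementary_mult[OF m] subgroup.m_inv_closed[OF sub] inv_mult_group)
  qed
  have "?f w \<in> \<Gamma>K j"
  proof (rule lower_central_hom[OF Aut.is_group f sub K_subgroup _ w])
    show "?f ` gens_below n m \<subseteq> K"
    proof (rule image_subsetI)
      fix x assume x: "x \<in> gens_below n m"
      have "elementary m (inv\<^bsub>F\<^esub> x) (x \<otimes>\<^bsub>F\<^esub> \<one>\<^bsub>F\<^esub>) \<in> K"
        using elementary_IA_plus[OF m x subgroup.one_closed[OF lower_central_below_subgroup[OF m']]] IA_plus_K by blast
      then show "?f x \<in> K"
        using x gens_below_carrier[OF m' x] by (simp add: retraction_gens_below[OF m'])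
    qed
  qed
  then show ?thesis
    by (simp add: retraction_gens_below[OF m' lower_central_below[OF m' w]])
qed

text \<open>The index drops by one because the weight-1 case is \<gamma> in \<Gamma>_2, the
  condition defining \<open>IA_plus\<close>. Each further commutator with h in F_{m-1} is realized
  by the commutator with the partial conjugation by h.\<close>

lemma elementary_transvection_\<Gamma>K:
  assumes m: "m \<in> {1..n}" and j: "1 \<le> j" and \<gamma>: "\<gamma> \<in> lower_central F (gens_below n m) (Suc j)"
  shows "elementary m \<one>\<^bsub>F\<^esub> \<gamma> \<in> \<Gamma>K j"
  using j \<gamma>
proof (induction j arbitrary: \<gamma> rule: dec_induct)
  case base
  have m': "m \<le> Suc n" using m by simp
  have "\<gamma> \<in> lower_central F (gens_below n m) 2" using base by (simp add: numeral_2_eq_2)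
  from elementary_IA_plus[OF m subgroup.one_closed[OF gens_below_subgroup[OF m']] this]
  have "elementary m \<one>\<^bsub>F\<^esub> \<gamma> \<in> IA_plus n"
    using gens_below_carrier[OF m' lower_central_below[OF m' base]] by simp
  then show ?case using IA_plus_K by auto
next
  case (step j)
  have m': "m \<le> Suc n" using m by simp
  note sub = gens_below_subgroup[OF m']
  let ?B = "gens_below n m"
  let ?C = "{commutator F h k |h k. h \<in> ?B \<and> k \<in> lower_central F ?B (Suc j)}"
  have one: "\<one>\<^bsub>F\<^esub> \<in> ?B" by (rule subgroup.one_closed[OF sub])
  have CB: "generate F ?C \<subseteq> ?B"
    using lower_central_below[OF m', of _ "Suc (Suc j)"] by (auto simp: lower_central_Suc commutator_subgroup_eq)
  have gens: "elementary m \<one>\<^bsub>F\<^esub> c \<in> \<Gamma>K (Suc j) \<and> c \<in> ?B" if "c \<in> ?C" for c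
  proof -
    from that obtain h k where c: "c = commutator F h k" and h: "h \<in> ?B" and k: "k \<in> lower_central F ?B (Suc j)" by blast
    have "elementary m (inv\<^bsub>F\<^esub> h) h \<in> K"
      using elementary_conj_\<Gamma>K[OF m, of h 1] h by simp
    then have "commutator (Aut_free n) (elementary m (inv\<^bsub>F\<^esub> h) h) (elementary m \<one>\<^bsub>F\<^esub> k) \<in> \<Gamma>K (Suc j)"
      by (rule Aut.lower_central_commutator[OF step.hyps(1) _ step.IH[OF k]])
    then show ?thesis
      unfolding elementary_commutator[OF m h lower_central_below[OF m' k]] c[symmetric]
      using CB generate.incl[OF that] by blast
  qed
  have "\<gamma> \<in> generate F ?C"
    using step.prems by (simp add: lower_central_Suc commutator_subgroup_eq)
  then show ?case
  proof (induction \<gamma> rule: generate.induct)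
    case one
    then show ?case using subgroup.one_closed[OF \<Gamma>K_subgroup] by (simp add: elementary_1[OF m])
  next
    case (incl c)
    then show ?case using gens by blast
  next
    case (inv c)
    then have c: "elementary m \<one>\<^bsub>F\<^esub> c \<in> \<Gamma>K (Suc j)" "c \<in> ?B" using gens by blast+
    have "inv\<^bsub>Aut_free n\<^esub> (elementary m \<one>\<^bsub>F\<^esub> c) \<in> \<Gamma>K (Suc j)"
      by (rule subgroup.m_inv_closed[OF \<Gamma>K_subgroup c(1)])
    then show ?case
      unfolding elementary_inv[OF m one c(2)] by simp
  next
    case (eng a b)
    then have ab: "a \<in> ?B" "b \<in> ?B" using CB by blast+
    have "elementary m \<one>\<^bsub>F\<^esub> a \<otimes>\<^bsub>Aut_free n\<^esub> elementary m \<one>\<^bsub>F\<^esub> b \<in> \<Gamma>K (Suc j)"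
      by (rule subgroup.m_closed[OF \<Gamma>K_subgroup eng.IH])
    then show ?case
      unfolding elementary_mult[OF m one ab(1) one ab(2)] by simp
  qed
qed

lemma elementary_\<Gamma>K:
  assumes m: "m \<in> {1..n}" and j: "1 \<le> j"
    and w: "w \<in> lower_central F (gens_below n m) j" and \<gamma>: "\<gamma> \<in> lower_central F (gens_below n m) (Suc j)"
  shows "elementary m (inv\<^bsub>F\<^esub> w) (w \<otimes>\<^bsub>F\<^esub> \<gamma>) \<in> \<Gamma>K j"
proof -
  have m': "m \<le> Suc n" using m by simp
  note sub = gens_below_subgroup[OF m']
  note wB = lower_central_below[OF m' w] and \<gamma>B = lower_central_below[OF m' \<gamma>]
  have "elementary m (inv\<^bsub>F\<^esub> w) w \<otimes>\<^bsub>Aut_free n\<^esub> elementary m \<one>\<^bsub>F\<^esub> \<gamma> \<in> \<Gamma>K j"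
    by (rule subgroup.m_closed[OF \<Gamma>K_subgroup elementary_conj_\<Gamma>K[OF m w] elementary_transvection_\<Gamma>K[OF m j \<gamma>]])
  then show ?thesis
    unfolding elementary_mult[OF m subgroup.m_inv_closed[OF sub wB] wB subgroup.one_closed[OF sub] \<gamma>B]
    using gens_below_carrier[OF m' wB] by simp
qed

lemma \<Gamma>K_A_filt: "1 \<le> j \<Longrightarrow> \<Gamma>K j \<subseteq> A_filt j"
  using \<Gamma>K_IA lower_central_IA by (rule subset_trans)

text \<open>The generators are peeled off from the top: \<open>\<psi>\<close> agrees at the highest generator \<open>x\<^sub>m\<close> that it
  moves with an elementary automorphism in \<open>\<Gamma>\<^sub>j(K)\<close>. The retraction killing \<open>x\<^sub>m\<close> bounds the depth of
  \<open>\<gamma>\<close>, and then the centralizer of \<open>x\<^sub>m\<close> that of \<open>w\<close>.\<close>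

lemma IA_plus_A_filt:
  assumes j: "1 \<le> j" and "m \<le> n" and "\<psi> \<in> IA_plus n" and "\<psi> \<in> A_filt j"
    and "\<And>i. i \<in> {Suc m..n} \<Longrightarrow> \<psi> (gen i) = gen i"
  shows "\<psi> \<in> \<Gamma>K j"
  using assms(2-)
proof (induction m arbitrary: \<psi>)
  case 0
  note c = IA_plus_carrier[OF 0(2)]
  have "\<psi> = \<one>\<^bsub>Aut_free n\<^esub>"
  proof (rule aut_eqI[OF c])
    fix x assume x: "x \<in> carrier F"
    have "\<psi> x = x"
      by (rule hom_eq_carrier[OF aut_hom[OF c] id_hom _ x]) (use 0(4) in simp)
    then show "\<psi> x = \<one>\<^bsub>Aut_free n\<^esub> x" using x by simp
  qed simp
  then show ?case using subgroup.one_closed[OF \<Gamma>K_subgroup] by simp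
next
  case (Suc k)
  define m where "m = Suc k"
  have m: "m \<in> {1..n}" using Suc.prems(1) by (simp add: m_def)
  then have m': "m \<le> Suc n" by simp
  note sub = gens_below_subgroup[OF m']
  note c = IA_plus_carrier[OF Suc.prems(2)]
  note g = gen_closed[OF m]
  interpret r: group_hom F F "retraction m" using retraction_hom by unfold_locales
  have r_\<Gamma>: "retraction m x \<in> lower_central F (gens_below n m) i" if "x \<in> \<Gamma> i" for x i
    by (rule lower_central_hom[OF is_group retraction_hom subgroup_self sub _ that])
       (use retraction_mem[OF m'] in auto)
  obtain w \<gamma> where w: "w \<in> gens_below n m" and \<gamma>: "\<gamma> \<in> lower_central F (gens_below n m) 2"
    and eq: "\<psi> (gen m) = inv\<^bsub>F\<^esub> w \<otimes>\<^bsub>F\<^esub> gen m \<otimes>\<^bsub>F\<^esub> w \<otimes>\<^bsub>F\<^esub> \<gamma>"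
    using IA_plusD[OF Suc.prems(2) m] .
  note \<gamma>B = lower_central_below[OF m' \<gamma>]
  note cl = gens_below_carrier[OF m' w] gens_below_carrier[OF m' \<gamma>B] g
  have disp: "\<psi> (gen m) \<otimes>\<^bsub>F\<^esub> inv\<^bsub>F\<^esub> (gen m) \<in> \<Gamma> (Suc j)"
    using A_filtD[OF Suc.prems(3), of 1 "gen m"] g by simp
  have rm: "retraction m (gen m) = \<one>\<^bsub>F\<^esub>" "retraction m w = w" "retraction m \<gamma> = \<gamma>"
    using retraction_gen[OF m, of m] retraction_gens_below[OF m' w] retraction_gens_below[OF m' \<gamma>B] by simp_all
  \<comment> \<open>Sending x_m to 1 in w^-1 x_m w \<gamma> x_m^-1 leaves exactly \<gamma>.\<close>
  have \<gamma>j: "\<gamma> \<in> lower_central F (gens_below n m) (Suc j)"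
    using r_\<Gamma>[OF disp] cl unfolding eq by (simp add: rm)
  have "(\<psi> (gen m) \<otimes>\<^bsub>F\<^esub> inv\<^bsub>F\<^esub> (gen m)) \<otimes>\<^bsub>F\<^esub> (gen m \<otimes>\<^bsub>F\<^esub> inv\<^bsub>F\<^esub> \<gamma> \<otimes>\<^bsub>F\<^esub> inv\<^bsub>F\<^esub> (gen m)) \<in> \<Gamma> (Suc j)"
    by (rule subgroup.m_closed[OF \<Gamma>_subgroup disp normal.inv_op_closed2[OF \<Gamma>_normal g
          subgroup.m_inv_closed[OF \<Gamma>_subgroup lower_central_below_\<Gamma>[OF m' \<gamma>j]]]])
  then have "commutator F (inv\<^bsub>F\<^esub> w) (gen m) \<in> \<Gamma> (Suc j)"
    unfolding eq using cl by (simp add: commutator_def word_simps)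
  then obtain a :: int where "inv\<^bsub>F\<^esub> w \<otimes>\<^bsub>F\<^esub> (gen m [^]\<^bsub>F\<^esub> a) \<in> \<Gamma> j"
    using centralizer_gen[OF m j, of "inv\<^bsub>F\<^esub> w"] cl by auto
  \<comment> \<open>The exponent \<open>a\<close> is unknown, but the retraction kills x_m^a and
    leaves w^-1.\<close>
  from r_\<Gamma>[OF this] have "inv\<^bsub>F\<^esub> w \<in> lower_central F (gens_below n m) j"
    using cl by (simp add: rm r.hom_int_pow)
  from subgroup.m_inv_closed[OF lower_central_below_subgroup[OF m'] this]
  have wj: "w \<in> lower_central F (gens_below n m) j" using cl by simp
  define \<chi> where "\<chi> = elementary m (inv\<^bsub>F\<^esub> w) (w \<otimes>\<^bsub>F\<^esub> \<gamma>)"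
  have \<chi>: "\<chi> \<in> \<Gamma>K j" "\<chi> \<in> IA_plus n"
    unfolding \<chi>_def by (rule elementary_\<Gamma>K[OF m j wj \<gamma>j], rule elementary_IA_plus[OF m w \<gamma>])
  have \<chi>A: "\<chi> \<in> A_filt j" using \<chi>(1) \<Gamma>K_A_filt[OF j] by blast
  have \<chi>c: "\<chi> \<in> carrier (Aut_free n)" by (rule IA_plus_carrier[OF \<chi>(2)])
  have u: "inv\<^bsub>F\<^esub> w \<in> carrier F" "w \<otimes>\<^bsub>F\<^esub> \<gamma> \<in> carrier F" using cl by simp_all
  \<comment> \<open>\<chi> and \<psi> agree at x_m and both fix all later generators, so this
    quotient fixes everything from x_m on.\<close>
  define \<theta> where "\<theta> = inv\<^bsub>Aut_free n\<^esub> \<chi> \<otimes>\<^bsub>Aut_free n\<^esub> \<psi>"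
  have \<theta>: "\<theta> \<in> IA_plus n" "\<theta> \<in> A_filt j"
    unfolding \<theta>_def
    by (rule subgroup.m_closed[OF IA_plus_subgroup subgroup.m_inv_closed[OF IA_plus_subgroup \<chi>(2)] Suc.prems(2)],
        rule subgroup.m_closed[OF A_filt_subgroup subgroup.m_inv_closed[OF A_filt_subgroup \<chi>A] Suc.prems(3)])
  have "\<theta> (gen i) = gen i" if i: "i \<in> {Suc k..n}" for i
  proof -
    have i': "i \<in> {1..n}" using i by simp
    have "\<psi> (gen i) = \<chi> (gen i)"
    proof (cases "i = m")
      case True
      then show ?thesis
        unfolding \<chi>_def elementary_gen[OF m u i'] using eq cl by (simp add: m_assoc)
    next
      case False
      then show ?thesis
        unfolding \<chi>_def elementary_gen[OF m u i'] using Suc.prems(4)[of i] i m_def by simp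
    qed
    then show ?thesis
      using \<chi>c c gen_closed[OF i'] by (simp add: \<theta>_def)
  qed
  then have "\<theta> \<in> \<Gamma>K j"
    using Suc.IH[OF _ \<theta>] Suc.prems(1) by simp
  then have "\<chi> \<otimes>\<^bsub>Aut_free n\<^esub> \<theta> \<in> \<Gamma>K j"
    by (rule subgroup.m_closed[OF \<Gamma>K_subgroup \<chi>(1)])
  moreover have "\<chi> \<otimes>\<^bsub>Aut_free n\<^esub> \<theta> = \<psi>"
    using \<chi>c c by (simp add: \<theta>_def Aut.cancel_inv)
  ultimately show ?case by simp
qed

lemma K_A_filt:
  assumes n: "1 \<le> n" and j: "1 \<le> j" and \<phi>: "\<phi> \<in> K" "\<phi> \<in> A_filt j"
  shows "\<phi> \<in> \<Gamma>K j"
proof -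
  from \<phi>(1) obtain \<iota> \<psi> where eq: "\<phi> = \<iota> \<otimes>\<^bsub>Aut_free n\<^esub> \<psi>" and "\<iota> \<in> Inn F" and \<psi>: "\<psi> \<in> IA_plus n"
    unfolding set_mult_def by blast
  then obtain w where w: "\<iota> = inner w" "w \<in> carrier F" unfolding Inn_eq by (blast elim: imageE)
  have 1: "1 \<in> {1..n}" using n by simp
  let ?x = "gen 1"
  note x = gen_closed[OF 1]
  note c = IA_plus_carrier[OF \<psi>]
  \<comment> \<open>The subgroup below x_1 is trivial, so the triangular factor fixes x_1 and the
    value there sees only the inner factor.\<close>
  have triv: "z = \<one>\<^bsub>F\<^esub>" if "z \<in> gens_below n 1" for z
    using that generate_empty by (simp add: gens_below_def)
  obtain v \<gamma> where v: "v \<in> gens_below n 1" and \<gamma>: "\<gamma> \<in> lower_central F (gens_below n 1) 2"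
    and "\<psi> ?x = inv\<^bsub>F\<^esub> v \<otimes>\<^bsub>F\<^esub> ?x \<otimes>\<^bsub>F\<^esub> v \<otimes>\<^bsub>F\<^esub> \<gamma>"
    using IA_plusD[OF \<psi> 1] .
  then have \<psi>x: "\<psi> ?x = ?x"
    using triv[OF v] triv[OF lower_central_below[OF _ \<gamma>]] x by simp
  have "\<phi> ?x \<otimes>\<^bsub>F\<^esub> inv\<^bsub>F\<^esub> ?x \<in> \<Gamma> (Suc j)"
    using A_filtD[OF \<phi>(2), of 1 ?x] x by simp
  moreover have "\<phi> ?x = inner w ?x"
    using c x w \<psi>x by (simp add: eq inner_aut)
  ultimately have "commutator F (inv\<^bsub>F\<^esub> w) ?x \<in> \<Gamma> (Suc j)"
    using inner_displacement[OF w(2) x] by simp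
  then obtain a :: int where a: "inv\<^bsub>F\<^esub> w \<otimes>\<^bsub>F\<^esub> (?x [^]\<^bsub>F\<^esub> a) \<in> \<Gamma> j"
    using centralizer_gen[OF 1 j, of "inv\<^bsub>F\<^esub> w"] w(2) by auto
  define y where "y = ?x [^]\<^bsub>F\<^esub> a"
  \<comment> \<open>Splits w = y z with y a power of x_1 and z in \<Gamma>_j; since
    \<open>inner\<close> reverses products, \<open>inner y\<close> ends up next to the triangular
    factor.\<close>
  define z where "z = inv\<^bsub>F\<^esub> (inv\<^bsub>F\<^esub> w \<otimes>\<^bsub>F\<^esub> y)"
  have y: "y \<in> carrier F" using x by (simp add: y_def)
  have z: "z \<in> \<Gamma> j" unfolding z_def y_def by (rule subgroup.m_inv_closed[OF \<Gamma>_subgroup a])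
  have zF: "z \<in> carrier F" by (rule \<Gamma>_carrier[OF z])
  have wz: "w = y \<otimes>\<^bsub>F\<^esub> z" using w(2) y by (simp add: z_def word_simps)
  define \<psi>' where "\<psi>' = inner y \<otimes>\<^bsub>Aut_free n\<^esub> \<psi>"
  have \<phi>_eq: "\<phi> = inner z \<otimes>\<^bsub>Aut_free n\<^esub> \<psi>'"
  proof -
    have "inner z \<otimes>\<^bsub>Aut_free n\<^esub> \<psi>' = (inner z \<otimes>\<^bsub>Aut_free n\<^esub> inner y) \<otimes>\<^bsub>Aut_free n\<^esub> \<psi>"
      unfolding \<psi>'_def using c y zF by (simp add: Aut.m_assoc inner_aut)
    then show ?thesis using inner_mult[OF zF y] by (simp add: eq w(1) wz)
  qed
  \<comment> \<open>Conjugation by a power of x_1 fixes x_1, and for i \<ge> 2 its conjugator lies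
    in F_{i-1}.\<close>
  have "inner y \<in> IA_plus n"
  proof (rule IA_plusI[OF inner_aut[OF y]])
    fix i assume i: "i \<in> {1..n}"
    then have i': "i \<le> Suc n" by simp
    note g = gen_closed[OF i]
    have one: "\<one>\<^bsub>F\<^esub> \<in> lower_central F (gens_below n i) 2"
      by (rule subgroup.one_closed[OF lower_central_below_subgroup[OF i']])
    show "\<exists>w\<in>gens_below n i. \<exists>\<gamma>\<in>lower_central F (gens_below n i) 2.
        inner y (gen i) = inv\<^bsub>F\<^esub> w \<otimes>\<^bsub>F\<^esub> gen i \<otimes>\<^bsub>F\<^esub> w \<otimes>\<^bsub>F\<^esub> \<gamma>"
    proof (cases "i = 1")
      case True
      have yx: "y \<otimes>\<^bsub>F\<^esub> ?x = ?x \<otimes>\<^bsub>F\<^esub> y"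
        using int_pow_mult[OF x, of a 1] int_pow_mult[OF x, of 1 a] x by (simp add: y_def int_pow_1 add.commute)
      have "inv\<^bsub>F\<^esub> y \<otimes>\<^bsub>F\<^esub> (?x \<otimes>\<^bsub>F\<^esub> y) = ?x"
        unfolding yx[symmetric] by (rule cancel_inv(2)[OF y x])
      then have "inner y (gen i) = inv\<^bsub>F\<^esub> \<one>\<^bsub>F\<^esub> \<otimes>\<^bsub>F\<^esub> gen i \<otimes>\<^bsub>F\<^esub> \<one>\<^bsub>F\<^esub> \<otimes>\<^bsub>F\<^esub> \<one>\<^bsub>F\<^esub>"
        using True x y by (simp add: m_assoc)
      then show ?thesis
        using one subgroup.one_closed[OF gens_below_subgroup[OF i']] by blast
    next
      case False
      then have "?x \<in> gens_below n i" using i by (intro gen_gens_below) simp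
      then have "y \<in> gens_below n i"
        unfolding y_def by (rule subgroup_int_pow_closed[OF gens_below_subgroup[OF i']])
      moreover have "inner y (gen i) = inv\<^bsub>F\<^esub> y \<otimes>\<^bsub>F\<^esub> gen i \<otimes>\<^bsub>F\<^esub> y \<otimes>\<^bsub>F\<^esub> \<one>\<^bsub>F\<^esub>"
        using g y by simp
      ultimately show ?thesis using one by blast
    qed
  qed
  then have \<psi>': "\<psi>' \<in> IA_plus n"
    unfolding \<psi>'_def by (rule subgroup.m_closed[OF IA_plus_subgroup _ \<psi>])
  have zK: "inner z \<in> \<Gamma>K j" by (rule inner_\<Gamma>K[OF z])
  have "inv\<^bsub>Aut_free n\<^esub> (inner z) \<otimes>\<^bsub>Aut_free n\<^esub> \<phi> \<in> A_filt j"
    by (rule subgroup.m_closed[OF A_filt_subgroup subgroup.m_inv_closed[OF A_filt_subgroup] \<phi>(2)])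
       (use zK \<Gamma>K_A_filt[OF j] in blast)
  then have "\<psi>' \<in> A_filt j"
    using IA_plus_carrier[OF \<psi>'] inner_aut[OF zF] by (simp add: \<phi>_eq Aut.cancel_inv)
  then have "\<psi>' \<in> \<Gamma>K j"
    using IA_plus_A_filt[OF j order.refl \<psi>'] by simp
  then show ?thesis
    unfolding \<phi>_eq by (rule subgroup.m_closed[OF \<Gamma>K_subgroup zK])
qed

end

theorem theorem5p3:
  fixes n :: nat
  assumes "n \<ge> 1"
  shows "satisfies_andreadakis_equality n (Inn (free_group n) <#>\<^bsub>Aut_free n\<^esub> IA_plus n)"
proof -
  interpret free_grp n .
  show ?thesis
    unfolding satisfies_andreadakis_equality_def
  proof (intro conjI allI impI K_subgroup K_IA)
    fix j :: nat assume j: "1 \<le> j"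
    \<comment> \<open>The three inclusions form a cycle, so all three sets coincide.\<close>
    have 1: "\<Gamma>K j \<subseteq> K \<inter> lower_central (Aut_free n) (IA n) j"
      using \<Gamma>K_subset \<Gamma>K_IA by blast
    have 2: "K \<inter> lower_central (Aut_free n) (IA n) j \<subseteq> K \<inter> andreadakis_filtration n j"
      using lower_central_IA[OF j] by blast
    have 3: "K \<inter> andreadakis_filtration n j \<subseteq> \<Gamma>K j"
      using K_A_filt[OF assms j] by blast
    show "\<Gamma>K j = K \<inter> lower_central (Aut_free n) (IA n) j"
      using 1 2 3 by blast
    show "K \<inter> lower_central (Aut_free n) (IA n) j = K \<inter> andreadakis_filtration n j"
      using 1 2 3 by blast
  qed
qed

end
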